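(* Let $n\ge2$, $1\le s\le\frac{n}{n-1}$, $1\le q\le\frac{n}{s(n-1)}$ and $\alpha=n-qs(n-1)$. Let $\Omega\subset\mathbb{R}^n$ be an $s$-distance John domain with John constant $C_J\ge1$, and let $\mu$ be a (nonnegative) Radon measure on $\mathbb{R}^n$ for which there is a constant $C_\mu\ge1$ with $$\mu(B(x,r))\le C_\mu r^{n-\alpha}$$ for every ball $B(x,r)\subset\mathbb{R}^n$. Then there exists a constant $C>0$ depending only on $n,s,C_\mu,C_J$ and $\operatorname{diam}\Omega$ such that for every $f\in L^1(\Omega)$, $$\left(\int_\Omega|f^*-f_\Omega|^q\,d\mu\right)^{1/q}\le C\,\|Df\|(\Omega).$$
   Context: A domain is a nonempty open connected set; $d(x)=\operatorname{dist}(x,\partial\Omega)$; $f_\Omega=\frac1{|\Omega|}\int_\Omega f\,dx$. A bounded domain $\Omega\subset\mathbb{R}^n$ is an $s$-distance John domain ($s\ge1$) with John constant $C_J\ge 1$ and John center $x_J\in\Omega$ if each $x\in\Omega$ can be joined to $x_J$ by a rectifiable curve $\gamma:[0,1]\to\Omega$, $\gamma(0)=x$, $\gamma(1)=x_J$, with $C_J\, d(\gamma(t))>|\gamma(t)-x|^s$ for all $t\in[0,1]$. The total variation is $\|Df\|(\Omega):=\sup\{\int_\Omega f\,\mathrm{div}\,\phi\,dx:\phi\in C_c^1(\Omega;\mathbb{R}^n),\ |\phi|\le1\}\in[0,\infty]$. A point $x\in\Omega$ is a Lebesgue point of $f\in L^1(\Omega)$ if there is $a\in\mathbb{R}$ with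 $\lim_{r\to0}\frac{1}{|B(x,r)|}\int_{B(x,r)}|f(y)-a|\,dy=0$; $\mathcal{L}_f$ is the set of Lebesgue points and the precise representative $f^*:\mathcal{L}_f\to\mathbb{R}$ is $f^*(x):=a$. Integrals over $\Omega$ involving $f^*$ are understood over $\mathcal{L}_f$. *)

theory Defs
  imports "HOL-Analysis.Analysis"
begin

definition bounded_domain :: "'a::euclidean_space set \<Rightarrow> bool" where
  "bounded_domain \<Omega> \<longleftrightarrow> open \<Omega> \<and> connected \<Omega> \<and> \<Omega> \<noteq> {} \<and> bounded \<Omega>"

definition rectifiable_path :: "(real \<Rightarrow> 'a::metric_space) \<Rightarrow> bool" where
  "rectifiable_path \<gamma> \<longleftrightarrow> path \<gamma> \<and>
     (\<exists>L. \<forall>(k::nat) (t::nat \<Rightarrow> real).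
        mono_on {..k} t \<and> t ` {..k} \<subseteq> {0..1} \<longrightarrow>
        (\<Sum>i<k. dist (\<gamma> (t i)) (\<gamma> (t (Suc i)))) \<le> L)"

definition distance_John_domain :: "real \<Rightarrow> real \<Rightarrow> 'a::euclidean_space \<Rightarrow> 'a set \<Rightarrow> bool" where
  "distance_John_domain s C\<^sub>J x\<^sub>J \<Omega> \<longleftrightarrow>
     bounded_domain \<Omega> \<and> 1 \<le> s \<and> 1 \<le> C\<^sub>J \<and> x\<^sub>J \<in> \<Omega> \<and>
     (\<forall>x\<in>\<Omega>. \<exists>\<gamma>. rectifiable_path \<gamma> \<and> path_image \<gamma> \<subseteq> \<Omega> \<and>
        pathstart \<gamma> = x \<and> pathfinish \<gamma> = x\<^sub>J \<and>
        (\<forall>t\<in>{0..1}. C\<^sub>J * infdist (\<gamma> t) (frontier \<Omega>) > norm (\<gamma> t - x) powr s))"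

(* Borel measure, finite on compact sets, outer regular on Borel sets and inner regular on
   open sets. *)
definition Radon_measure :: "'a::euclidean_space measure \<Rightarrow> bool" where
  "Radon_measure \<mu> \<longleftrightarrow> sets \<mu> = sets borel \<and>
     (\<forall>K. compact K \<longrightarrow> emeasure \<mu> K < \<infinity>) \<and>
     (\<forall>A\<in>sets borel. emeasure \<mu> A = (INF U\<in>{U. open U \<and> A \<subseteq> U}. emeasure \<mu> U)) \<and>
     (\<forall>U. open U \<longrightarrow> emeasure \<mu> U = (SUP K\<in>{K. compact K \<and> K \<subseteq> U}. emeasure \<mu> K))"

(* Compactly supported C^1 vector fields in \<Omega> are represented by their extension by zero. *)
definition C1_compact_support :: "'a::euclidean_space set \<Rightarrow> ('a \<Rightarrow> 'a) set" where
  "C1_compact_support \<Omega> =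
     {\<phi>. (\<exists>\<phi>' :: 'a \<Rightarrow> 'a \<Rightarrow>\<^sub>L 'a. continuous_on UNIV \<phi>' \<and>
            (\<forall>x. (\<phi> has_derivative blinfun_apply (\<phi>' x)) (at x))) \<and>
         compact (closure {x. \<phi> x \<noteq> 0}) \<and> closure {x. \<phi> x \<noteq> 0} \<subseteq> \<Omega>}"

definition divergence :: "('a::euclidean_space \<Rightarrow> 'a) \<Rightarrow> 'a \<Rightarrow> real" where
  "divergence \<phi> x = (\<Sum>b\<in>Basis. frechet_derivative \<phi> (at x) b \<bullet> b)"

(* ennreal sends negative reals to 0; this does not change the supremum, to which the zero
   field contributes 0. *)
definition total_variation :: "'a::euclidean_space set \<Rightarrow> ('a \<Rightarrow> real) \<Rightarrow> ennreal" where
  "total_variation \<Omega> f =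
     (SUP \<phi>\<in>{\<phi>\<in>C1_compact_support \<Omega>. \<forall>x. norm (\<phi> x) \<le> 1}.
        ennreal (LINT x:\<Omega>|lebesgue. f x * divergence \<phi> x))"

definition mean_on :: "'a::euclidean_space set \<Rightarrow> ('a \<Rightarrow> real) \<Rightarrow> real" where
  "mean_on \<Omega> f = (LINT x:\<Omega>|lebesgue. f x) / measure lebesgue \<Omega>"

(* Used for x in an open set on which f is integrable; only small radii matter. *)
definition Lebesgue_value :: "('a::euclidean_space \<Rightarrow> real) \<Rightarrow> 'a \<Rightarrow> real \<Rightarrow> bool" where
  "Lebesgue_value f x a \<longleftrightarrow>
     ((\<lambda>r. mean_on (ball x r) (\<lambda>y. \<bar>f y - a\<bar>)) \<longlongrightarrow> 0) (at_right 0)"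

definition Lebesgue_points :: "'a::euclidean_space set \<Rightarrow> ('a \<Rightarrow> real) \<Rightarrow> 'a set" where
  "Lebesgue_points \<Omega> f = {x\<in>\<Omega>. \<exists>a. Lebesgue_value f x a}"

(* Meaningful at Lebesgue points, where the value is unique. *)
definition precise_representative :: "('a::euclidean_space \<Rightarrow> real) \<Rightarrow> 'a \<Rightarrow> real" where
  "precise_representative f x = (THE a. Lebesgue_value f x a)"

(* Power of an extended nonnegative number, for exponents p > 0. *)
definition ennreal_powr :: "ennreal \<Rightarrow> real \<Rightarrow> ennreal" where
  "ennreal_powr x p = (if x = \<infinity> then \<infinity> else ennreal (enn2real x powr p))"

end

theory Submission
  imports Defs
begin

text \<open>
  For a superlevel set \<open>E = {f > t}\<close> with \<open>t\<close> above a median of \<open>f\<close> on a ball around the John centre,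
  every point \<open>x\<close> with \<open>f\<^sup>* x > t\<close> admits a ball \<open>B(z, r)\<close> well inside \<open>\<Omega>\<close>, with \<open>|z - x|\<^sup>s\<close> at most a
  constant times \<open>r\<close>, in which \<open>E\<close> has density exactly one half. By the relative isoperimetric
  inequality such a ball carries perimeter at least \<open>c r\<^bsup>n-1\<^esup>\<close>. The Vitali covering lemma for the balls
  \<open>B(x, K r\<^bsup>1/s\<^esup>)\<close>, together with \<open>\<mu>(B(x,\<rho>)) \<le> C \<rho>\<^bsup>qs(n-1)\<^esup>\<close> and \<open>\<Sum> a\<^sup>q \<le> (\<Sum> a)\<^sup>q\<close>, gives
  \<open>\<mu>{f\<^sup>* > t}\<^bsup>1/q\<^esup> \<le> C Per({f > t})\<close>. Integrating over \<open>t\<close>, Minkowski's inequality and the coarea formula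
  yield the claim with the median in place of the mean; Lebesgue measure with \<open>q = 1\<close> is an admissible
  choice for \<open>\<mu>\<close> and bounds the difference between the two.
\<close>

section \<open>Translates and the total variation\<close>

text \<open>A median controls both tails: for every \<open>t > 0\<close> the sets
  \<open>{f > m + t}\<close> and \<open>{f < m - t}\<close> fill at most half of the central ball,
  which is the sign that the intermediate value argument requires at the end of the John curve. The
  second family is handled as superlevel sets of \<open>- f\<close>. The growth exponent matches the
  geometry: a radius of order \<open>r powr (1/s)\<close> raised to \<open>q * s * (n - 1)\<close>
  is \<open>(r ^ (n - 1)) powr q\<close>, up to a constant the \<open>q\<close>-th power of the
  perimeter carried by the ball. The factors \<open>5 * K\<close>, \<open>L\<close> and
  \<open>V0\<close> are at least 1, so powers depending on \<open>q\<close> can be enlarged or moved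
  under an outer power \<open>q\<close>, and the final constant is free of \<open>q\<close>. The
  volume of \<Omega> does not enter either, since the John condition bounds it below in terms of the
  diameter. Measurability is the remaining obstacle: neither the set of Lebesgue points nor the
  precise representative is shown to be Borel, so the integral over \<mu> is bounded through simple
  functions below the integrand.\<close>

lemma has_real_derivative_pos_part_square:
  "((\<lambda>u::real. (max 0 u)\<^sup>2) has_real_derivative 2 * max 0 u) (at u)"
proof -
  consider "u < 0" | "u > 0" | "u = 0" by linarith
  then show ?thesis
  proof cases
    case 1
    have "((\<lambda>u::real. 0) has_real_derivative 0) (at u)" by simp
    then have "((\<lambda>u::real. (max 0 u)\<^sup>2) has_real_derivative 0) (at u)"
      by (rule has_field_derivative_transform_within_open[where S="{..<0}"]) (use 1 in auto)
    then show ?thesis using 1 by simp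
  next
    case 2
    have "((\<lambda>u::real. u\<^sup>2) has_real_derivative 2 * u) (at u)"
      by (auto intro!: derivative_eq_intros)
    then have "((\<lambda>u::real. (max 0 u)\<^sup>2) has_real_derivative 2 * u) (at u)"
      by (rule has_field_derivative_transform_within_open[where S="{0<..}"]) (use 2 in auto)
    then show ?thesis using 2 by simp
  next
    case 3
    have "((\<lambda>h::real. (max 0 h)\<^sup>2 / h) \<longlongrightarrow> 0) (at 0)"
    proof (rule Lim_null_comparison)
      show "\<forall>\<^sub>F h::real in at 0. norm ((max 0 h)\<^sup>2 / h) \<le> \<bar>h\<bar>"
        by (rule always_eventually) (auto simp: max_def power2_eq_square)
      show "((\<lambda>h::real. \<bar>h\<bar>) \<longlongrightarrow> 0) (at 0)" by (auto intro!: tendsto_eq_intros)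
    qed
    then show ?thesis using 3 by (simp add: DERIV_def)
  qed
qed

text \<open>Squared positive parts are continuously differentiable, which is the regularity that
  \<open>C1_compact_support\<close> asks for. Finitely many bumps around points of \<open>K\<close>
  are added, and a second squared positive part cuts the sum off at a positive level.\<close>

lemma C1_Urysohn:
  fixes K V :: "'a::euclidean_space set"
  assumes "compact K" "open V" "K \<subseteq> V"
  shows "\<exists>(\<psi>::'a \<Rightarrow> real) (\<psi>'::'a \<Rightarrow> 'a \<Rightarrow>\<^sub>L real).
    continuous_on UNIV \<psi>' \<and> (\<forall>x. (\<psi> has_derivative blinfun_apply (\<psi>' x)) (at x)) \<and>
    (\<forall>x. 0 \<le> \<psi> x \<and> \<psi> x \<le> 1) \<and> (\<forall>x\<in>K. \<psi> x = 1) \<and>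
    compact (closure {x. \<psi> x \<noteq> 0}) \<and> closure {x. \<psi> x \<noteq> 0} \<subseteq> V"
proof -
  obtain e0 where e0: "e0 > 0" "(\<Union>x\<in>K. ball x e0) \<subseteq> V"
    using compact_subset_open_imp_ball_epsilon_subset[OF assms] by blast
  define e where "e = e0 / 2"
  have e: "e > 0" "\<And>x. x \<in> K \<Longrightarrow> cball x e \<subseteq> V"
  proof -
    show "e > 0" using e0 by (simp add: e_def)
    fix x assume "x \<in> K"
    have "cball x e \<subseteq> ball x e0" using e0 by (auto simp: e_def)
    then show "cball x e \<subseteq> V" using e0 \<open>x \<in> K\<close> by blast
  qed
  obtain X where X: "X \<subseteq> K" "finite X" "K \<subseteq> (\<Union>x\<in>X. ball x (e/2))"
    using compactE_image[OF assms(1), of K "\<lambda>x. ball x (e/2)"] e by force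
  define \<eta> where "\<eta> x = (\<Sum>a\<in>X. (max 0 (e\<^sup>2 - (x - a) \<bullet> (x - a)))\<^sup>2)" for x
  define \<eta>' where "\<eta>' x v = (\<Sum>a\<in>X. 2 * max 0 (e\<^sup>2 - (x - a) \<bullet> (x - a)) * - (2 * ((x - a) \<bullet> v)))" for x v
  \<comment> \<open>Value of a single bump at distance \<open>e / 2\<close> from its centre; balls
    of that radius cover \<open>K\<close>, so \<open>\<eta>\<close> is at least \<open>c\<close>
    there.\<close>
  define c where "c = (3/4 * e\<^sup>2)\<^sup>2"
  have c: "c > 0" using e by (simp add: c_def)
  have d\<eta>: "(\<eta> has_derivative \<eta>' x) (at x)" for x
  proof -
    have "((\<lambda>x. (max 0 (e\<^sup>2 - (x - a) \<bullet> (x - a)))\<^sup>2) has_derivative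
        (\<lambda>v. 2 * max 0 (e\<^sup>2 - (x - a) \<bullet> (x - a)) * - (2 * ((x - a) \<bullet> v)))) (at x)" for a
    proof -
      have "((\<lambda>x. e\<^sup>2 - (x - a) \<bullet> (x - a)) has_derivative (\<lambda>v. - (2 * ((x - a) \<bullet> v)))) (at x)"
        by (auto intro!: derivative_eq_intros simp: inner_commute)
      from has_derivative_compose[OF this has_field_derivative_imp_has_derivative[OF has_real_derivative_pos_part_square]]
      show ?thesis by simp
    qed
    then show ?thesis unfolding \<eta>_def[abs_def] \<eta>'_def[abs_def] by (intro has_derivative_sum)
  qed
  \<comment> \<open>As a function of \<open>\<eta> x\<close> this is \<open>C^1\<close>, vanishes at
    0 and equals 1 from \<open>c\<close> on.\<close>
  define \<psi> where "\<psi> x = 1 - (max 0 (1 - \<eta> x / c))\<^sup>2" for x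
  define D where "D x v = 2 * max 0 (1 - \<eta> x / c) * (\<eta>' x v / c)" for x v
  have d\<psi>: "(\<psi> has_derivative D x) (at x)" for x
  proof -
    have "((\<lambda>x. 1 - \<eta> x / c) has_derivative (\<lambda>v. - (\<eta>' x v / c))) (at x)"
      using c by (auto intro!: derivative_eq_intros d\<eta>)
    from has_derivative_compose[OF this has_field_derivative_imp_has_derivative[OF has_real_derivative_pos_part_square]]
    have "((\<lambda>x. (max 0 (1 - \<eta> x / c))\<^sup>2) has_derivative (\<lambda>v. - D x v)) (at x)"
      by (simp add: D_def)
    from has_derivative_diff[OF has_derivative_const[of 1] this]
    show ?thesis by (simp add: \<psi>_def[abs_def])
  qed
  define \<psi>' where "\<psi>' x = Blinfun (D x)" for x
  have \<psi>': "blinfun_apply (\<psi>' x) = D x" for x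
    unfolding \<psi>'_def by (rule bounded_linear_Blinfun_apply) (rule has_derivative_bounded_linear[OF d\<psi>])
  have \<eta>0: "0 \<le> \<eta> x" for x by (simp add: \<eta>_def sum_nonneg)
  have cont\<eta>: "continuous_on UNIV \<eta>"
    unfolding \<eta>_def[abs_def] by (intro continuous_intros)
  show ?thesis
  proof (intro exI[of _ \<psi>] exI[of _ \<psi>'] conjI allI ballI)
    show "continuous_on UNIV \<psi>'"
      by (rule continuous_on_blinfun_componentwise)
        (unfold \<psi>' D_def \<eta>'_def, intro continuous_intros cont\<eta>, use c in auto)
    show "(\<psi> has_derivative blinfun_apply (\<psi>' x)) (at x)" for x using d\<psi> \<psi>' by simp
    show "0 \<le> \<psi> x" for x
    proof -
      have "max 0 (1 - \<eta> x / c) \<le> 1" using \<eta>0[of x] c by simp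
      then have "(max 0 (1 - \<eta> x / c))\<^sup>2 \<le> 1\<^sup>2" by (intro power_mono) auto
      then show ?thesis by (simp add: \<psi>_def)
    qed
    show "\<psi> x \<le> 1" for x by (simp add: \<psi>_def)
    show "\<psi> x = 1" if xK: "x \<in> K" for x
    proof -
      obtain a where a: "a \<in> X" "x \<in> ball a (e/2)" using X(3) xK by blast
      have "(x - a) \<bullet> (x - a) \<le> (e/2)\<^sup>2"
        using a by (auto simp: dist_norm norm_minus_commute power2_norm_eq_inner[symmetric] intro!: power_mono)
      then have "3/4 * e\<^sup>2 \<le> e\<^sup>2 - (x - a) \<bullet> (x - a)" by (simp add: power2_eq_square)
      then have "3/4 * e\<^sup>2 \<le> max 0 (e\<^sup>2 - (x - a) \<bullet> (x - a))" by linarith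
      then have "c \<le> (max 0 (e\<^sup>2 - (x - a) \<bullet> (x - a)))\<^sup>2"
        unfolding c_def by (intro power_mono) auto
      also have "\<dots> \<le> \<eta> x"
        unfolding \<eta>_def using X(2) a(1) member_le_sum[of a X "\<lambda>a. (max 0 (e\<^sup>2 - (x - a) \<bullet> (x - a)))\<^sup>2"] by auto
      finally show ?thesis using c by (simp add: \<psi>_def)
    qed
    have sub: "{x. \<psi> x \<noteq> 0} \<subseteq> (\<Union>a\<in>X. cball a e)"
    proof (rule ccontr)
      assume "\<not> ?thesis"
      then obtain x where x0: "\<psi> x \<noteq> 0" "x \<notin> (\<Union>a\<in>X. cball a e)" by blast
      then have x: "\<psi> x \<noteq> 0" "\<And>a. a \<in> X \<Longrightarrow> e < dist a x" by (auto simp: not_le)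
      have "max 0 (e\<^sup>2 - (x - a) \<bullet> (x - a)) = 0" if "a \<in> X" for a
        using power_mono[of e "norm (x - a)" 2] x(2)[OF that] e
        by (auto simp: dist_norm norm_minus_commute power2_norm_eq_inner[symmetric])
      then have "\<eta> x = 0" by (simp add: \<eta>_def)
      then show False using x(1) by (simp add: \<psi>_def)
    qed
    have cl: "compact (\<Union>a\<in>X. cball a e)" using X by (intro compact_UN) auto
    then have "closure {x. \<psi> x \<noteq> 0} \<subseteq> (\<Union>a\<in>X. cball a e)"
      by (intro closure_minimal sub compact_imp_closed)
    then show "closure {x. \<psi> x \<noteq> 0} \<subseteq> V" using X e by blast
    show "compact (closure {x. \<psi> x \<noteq> 0})"
      using bounded_subset[OF compact_imp_bounded[OF cl] sub] by (simp add: compact_closure)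
  qed
qed

text \<open>By the fundamental theorem of calculus, \<open>\<psi> x - \<psi> (x - h)\<close> is the
  derivative in direction \<open>h\<close> of \<open>\<Psi>\<close>, the average of
  \<open>\<psi>\<close> over the segment from \<open>x - h\<close> to \<open>x\<close>. It is thus
  \<open>norm h\<close> times the divergence of the field \<open>\<Psi>\<close> times
  \<open>h / norm h\<close>, whose norm is at most 1; \<open>seg\<close> keeps its support in
  \<Omega>.\<close>

lemma difference_le_total_variation:
  fixes f :: "'a::euclidean_space \<Rightarrow> real" and \<psi> :: "'a \<Rightarrow> real" and \<psi>' :: "'a \<Rightarrow> 'a \<Rightarrow>\<^sub>L real"
  assumes c: "continuous_on UNIV \<psi>'" and d: "\<And>x. (\<psi> has_derivative blinfun_apply (\<psi>' x)) (at x)"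
    and le1: "\<And>x. \<bar>\<psi> x\<bar> \<le> 1" and S: "compact S" "\<And>x. x \<notin> S \<Longrightarrow> \<psi> x = 0"
    and seg: "\<And>x t. x \<in> S \<Longrightarrow> 0 \<le> t \<Longrightarrow> t \<le> 1 \<Longrightarrow> x + t *\<^sub>R h \<in> \<Omega>"
  shows "ennreal (LINT x:\<Omega>|lebesgue. f x * (\<psi> x - \<psi> (x - h))) \<le> ennreal (norm h) * total_variation \<Omega> f"
proof (cases "h = 0")
  case True then show ?thesis by (simp add: set_lebesgue_integral_def)
next
  case False
  define \<Psi> where "\<Psi> x = integral (cbox 0 1) (\<lambda>t. \<psi> (x - t *\<^sub>R h))" for x
  define \<Psi>' where "\<Psi>' x = integral (cbox 0 1) (\<lambda>t. \<psi>' (x - t *\<^sub>R h))" for x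
  have cont\<psi>: "continuous_on A \<psi>" for A
    by (rule has_derivative_continuous_on) (rule has_derivative_at_withinI[OF d])
  have int\<psi>: "(\<lambda>t. \<psi> (x - t *\<^sub>R h)) integrable_on cbox 0 (1::real)" for x
    by (rule integrable_continuous) (intro continuous_on_compose2[OF cont\<psi>[of UNIV]] continuous_intros; simp)
  have contx: "continuous_on (UNIV \<times> cbox 0 (1::real)) (\<lambda>(x,t). \<psi>' (x - t *\<^sub>R h))"
    unfolding split_beta by (intro continuous_on_compose2[OF c] continuous_intros) simp
  have d\<Psi>: "(\<Psi> has_derivative \<Psi>' x) (at x)" for x
    unfolding \<Psi>_def[abs_def] \<Psi>'_def
  proof (rule leibniz_rule[where U=UNIV])
    fix x :: 'a and t :: real
    have "((\<lambda>x. x - t *\<^sub>R h) has_derivative (\<lambda>v. v)) (at x)" by (auto intro!: derivative_eq_intros)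
    from has_derivative_compose[OF this d]
    show "((\<lambda>x. \<psi> (x - t *\<^sub>R h)) has_derivative blinfun_apply (\<psi>' (x - t *\<^sub>R h))) (at x)" by simp
  qed (use contx int\<psi> in auto)
  have cont\<Psi>': "continuous_on UNIV \<Psi>'"
    unfolding \<Psi>'_def[abs_def] by (rule integral_continuous_on_param[OF contx])
  have \<Psi>'h: "\<Psi>' x h = \<psi> x - \<psi> (x - h)" for x
  proof -
    have "((\<lambda>t. - (\<psi>' (x - t *\<^sub>R h) h)) has_integral (\<psi> (x - 1 *\<^sub>R h) - \<psi> (x - 0 *\<^sub>R h))) {0..1}"
    proof (rule fundamental_theorem_of_calculus)
      fix t :: real assume "t \<in> {0..1}"
      have "((\<lambda>t. x - t *\<^sub>R h) has_derivative (\<lambda>u. - (u *\<^sub>R h))) (at t)" by (auto intro!: derivative_eq_intros)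
      from has_derivative_compose[OF this d]
      have "((\<lambda>t. \<psi> (x - t *\<^sub>R h)) has_derivative (\<lambda>u. \<psi>' (x - t *\<^sub>R h) (- (u *\<^sub>R h)))) (at t)" .
      then show "((\<lambda>t. \<psi> (x - t *\<^sub>R h)) has_vector_derivative - (\<psi>' (x - t *\<^sub>R h) h)) (at t within {0..1})"
        by (simp add: has_vector_derivative_def blinfun.minus_right blinfun.scaleR_right has_derivative_at_withinI)
    qed simp
    from has_integral_neg[OF this] have "((\<lambda>t. \<psi>' (x - t *\<^sub>R h) h) has_integral (\<psi> x - \<psi> (x - h))) (cbox 0 1)"
      by simp
    moreover have "(\<lambda>t. \<psi>' (x - t *\<^sub>R h)) integrable_on cbox 0 (1::real)"
      by (rule integrable_continuous) (intro continuous_on_compose2[OF c] continuous_intros; simp)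
    then have "\<Psi>' x h = integral (cbox 0 1) (\<lambda>t. \<psi>' (x - t *\<^sub>R h) h)"
      unfolding \<Psi>'_def by (rule blinfun_apply_integral)
    ultimately show ?thesis by (simp add: integral_unique)
  qed
  have \<Psi>1: "\<bar>\<Psi> x\<bar> \<le> 1" for x
  proof -
    have "continuous_on {0..1} (\<lambda>t. \<psi> (x - t *\<^sub>R h))"
      by (intro continuous_on_compose2[OF cont\<psi>[of UNIV]] continuous_intros) simp
    then show ?thesis
      using integral_bound[of 0 1 "\<lambda>t. \<psi> (x - t *\<^sub>R h)" 1] le1 by (auto simp: \<Psi>_def)
  qed
  define \<phi> where "\<phi> x = (\<Psi> x / norm h) *\<^sub>R h" for x
  define \<phi>' where "\<phi>' x = blinfun_scaleR_left (h /\<^sub>R norm h) o\<^sub>L \<Psi>' x" for x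
  have \<phi>'_apply: "\<phi>' x v = (\<Psi>' x v / norm h) *\<^sub>R h" for x v
    by (simp add: \<phi>'_def divide_inverse)
  have d\<phi>: "(\<phi> has_derivative \<phi>' x) (at x)" for x
  proof -
    have "((\<lambda>x. (\<Psi> x / norm h) *\<^sub>R h) has_derivative (\<lambda>v. (\<Psi>' x v / norm h) *\<^sub>R h)) (at x)"
      using False by (auto intro!: derivative_eq_intros d\<Psi>)
    then show ?thesis by (simp add: \<phi>_def[abs_def] \<phi>'_apply[abs_def])
  qed
  have div: "divergence \<phi> x = (\<psi> x - \<psi> (x - h)) / norm h" for x
  proof -
    have "frechet_derivative \<phi> (at x) = \<phi>' x" using frechet_derivative_at[OF d\<phi>] by simp
    then have "divergence \<phi> x = (\<Sum>b\<in>Basis. (\<Psi>' x b / norm h) * (h \<bullet> b))"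
      by (simp add: divergence_def \<phi>'_apply)
    also have "\<dots> = (\<Sum>b\<in>Basis. (h \<bullet> b) * \<Psi>' x b) / norm h"
      by (simp add: sum_divide_distrib mult.commute)
    also have "(\<Sum>b\<in>Basis. (h \<bullet> b) * \<Psi>' x b) = \<Psi>' x (\<Sum>b\<in>Basis. (h \<bullet> b) *\<^sub>R b)"
      by (simp add: blinfun.sum_right blinfun.scaleR_right)
    finally show ?thesis by (simp add: euclidean_representation \<Psi>'h)
  qed
  \<comment> \<open>The region swept by \<open>S\<close> along the segment from 0 to
    \<open>h\<close>; the averaged function vanishes outside it.\<close>
  define T where "T = (\<lambda>(x,t). x + t *\<^sub>R h) ` (S \<times> {0..1::real})"
  have T: "compact T" unfolding T_def
    by (intro compact_continuous_image compact_Times S) (auto simp: split_beta intro!: continuous_intros)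
  have T\<Omega>: "T \<subseteq> \<Omega>" using seg by (auto simp: T_def)
  have out: "\<phi> x = 0" if "x \<notin> T" for x
  proof -
    have "\<psi> (x - t *\<^sub>R h) = 0" if t: "t \<in> cbox 0 1" for t
    proof (rule S(2), rule notI)
      assume "x - t *\<^sub>R h \<in> S"
      then have "(\<lambda>(x,t). x + t *\<^sub>R h) (x - t *\<^sub>R h, t) \<in> T" unfolding T_def using t by (intro imageI) auto
      then show False using \<open>x \<notin> T\<close> by simp
    qed
    then have "\<Psi> x = integral (cbox 0 1) (\<lambda>t::real. 0)"
      unfolding \<Psi>_def by (intro integral_cong) auto
    then show ?thesis by (simp add: \<phi>_def)
  qed
  have sub: "closure {x. \<phi> x \<noteq> 0} \<subseteq> T"
    using out by (intro closure_minimal compact_imp_closed T) auto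
  have "\<phi> \<in> C1_compact_support \<Omega>"
    unfolding C1_compact_support_def
  proof (intro CollectI conjI exI[of _ \<phi>'] allI d\<phi>)
    show "continuous_on UNIV \<phi>'"
      unfolding \<phi>'_def by (intro continuous_intros cont\<Psi>')
    show "closure {x. \<phi> x \<noteq> 0} \<subseteq> \<Omega>" using sub T\<Omega> by blast
    show "compact (closure {x. \<phi> x \<noteq> 0})"
      using compact_Int_closed[OF T closed_closure, of "{x. \<phi> x \<noteq> 0}"] sub by (simp add: Int_absorb1)
  qed
  moreover have "norm (\<phi> x) \<le> 1" for x using \<Psi>1[of x] False by (simp add: \<phi>_def)
  ultimately have "ennreal (LINT x:\<Omega>|lebesgue. f x * divergence \<phi> x) \<le> total_variation \<Omega> f"
    unfolding total_variation_def by (intro SUP_upper) auto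
  then have "ennreal (norm h) * ennreal (LINT x:\<Omega>|lebesgue. f x * divergence \<phi> x) \<le> ennreal (norm h) * total_variation \<Omega> f"
    by (rule mult_left_mono) simp
  also have "ennreal (norm h) * ennreal (LINT x:\<Omega>|lebesgue. f x * divergence \<phi> x)
     = ennreal (norm h * (LINT x:\<Omega>|lebesgue. f x * divergence \<phi> x))"
    by (simp add: ennreal_mult')
  also have "norm h * (LINT x:\<Omega>|lebesgue. f x * divergence \<phi> x) = (LINT x:\<Omega>|lebesgue. f x * (\<psi> x - \<psi> (x - h)))"
  proof -
    have "(\<lambda>x. f x * (\<psi> x - \<psi> (x - h))) = (\<lambda>x. norm h * (f x * divergence \<phi> x))"
      using False by (auto simp: div)
    then show ?thesis by (simp only: set_integral_mult_right)
  qed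
  finally show ?thesis .
qed

text \<open>Inner regularity of the finite measure with density \<open>\<bar>g x\<bar>\<close>. It
  serves to replace the sets where a difference is positive or negative by compact sets, which admit
  \<open>C^1\<close> cutoffs.\<close>

lemma compact_subset_density:
  fixes g :: "'a::euclidean_space \<Rightarrow> real"
  assumes g: "integrable lborel g" and A: "A \<in> sets borel" and "0 < e"
  obtains K where "compact K" "K \<subseteq> A"
    "(LINT x:A|lborel. \<bar>g x\<bar>) \<le> (LINT x:K|lborel. \<bar>g x\<bar>) + e"
proof -
  define M where "M = density lborel (\<lambda>x. ennreal \<bar>g x\<bar>)"
  have [measurable]: "g \<in> borel_measurable borel" using g by auto
  have em: "emeasure M B = ennreal (LINT x:B|lborel. \<bar>g x\<bar>)" if [measurable]: "B \<in> sets borel" for B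
  proof -
    have "emeasure M B = (\<integral>\<^sup>+x. ennreal (indicator B x * \<bar>g x\<bar>) \<partial>lborel)"
      unfolding M_def by (subst emeasure_density) (auto intro!: nn_integral_cong split: split_indicator)
    also have "\<dots> = ennreal (LINT x:B|lborel. \<bar>g x\<bar>)"
      unfolding set_lebesgue_integral_def real_scaleR_def
      using integrable_real_mult_indicator[of B lborel "\<lambda>x. \<bar>g x\<bar>"] g
      by (intro nn_integral_eq_integral) (auto simp: mult.commute)
    finally show ?thesis .
  qed
  have fin: "emeasure M (space M) \<noteq> \<infinity>" using em[of UNIV] by (simp add: M_def)
  have s: "sets M = sets borel" by (simp add: M_def)
  have "emeasure M A < \<infinity>" using em[OF A] by simp
  have *: "emeasure M A = (SUP K\<in>{K. K \<subseteq> A \<and> compact K}. emeasure M K)"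
    using inner_regular[OF s fin] A by simp
  have "\<exists>K. compact K \<and> K \<subseteq> A \<and> emeasure M A \<le> emeasure M K + ennreal e"
  proof (rule ccontr)
    assume "\<not> ?thesis"
    then have lt: "emeasure M K + ennreal e \<le> emeasure M A" if "compact K" "K \<subseteq> A" for K
      using that linear[of "emeasure M K + ennreal e" "emeasure M A"] by blast
    have "emeasure M A + ennreal e = (SUP K\<in>{K. K \<subseteq> A \<and> compact K}. emeasure M K + ennreal e)"
      by (subst *, subst ennreal_SUP_add_left) auto
    also have "\<dots> \<le> emeasure M A" by (rule SUP_least) (use lt in auto)
    finally show False using \<open>emeasure M A < \<infinity>\<close> \<open>0 < e\<close>
      using ennreal_add_left_cancel_le[of "emeasure M A" "ennreal e" 0] by simp
  qed
  then obtain K where K: "compact K" "K \<subseteq> A" "emeasure M A \<le> emeasure M K + ennreal e" by blast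
  have nn: "0 \<le> (LINT x:B|lborel. \<bar>g x\<bar>)" for B
    unfolding set_lebesgue_integral_def by (intro Bochner_Integration.integral_nonneg) simp
  have "K \<in> sets borel" using K(1) by (simp add: compact_imp_closed)
  then have "ennreal (LINT x:A|lborel. \<bar>g x\<bar>) \<le> ennreal ((LINT x:K|lborel. \<bar>g x\<bar>) + e)"
    using K(3) em[OF A] em[of K] \<open>0 < e\<close> nn by (simp add: ennreal_plus)
  then have "(LINT x:A|lborel. \<bar>g x\<bar>) \<le> (LINT x:K|lborel. \<bar>g x\<bar>) + e"
    using nn[of K] \<open>0 < e\<close> by (subst (asm) ennreal_le_iff) auto
  then show ?thesis using that K by blast
qed

text \<open>Duality: the \<open>L^1\<close> norm of the difference \<open>g\<close> on
  \<open>U\<close> is nearly attained by testing against a \<open>C^1\<close> function close to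
  minus its sign. Moving the translation from \<open>f\<close> to the test function turns this into
  the integral in \<open>difference_le_total_variation\<close>.\<close>

lemma translate_difference_le_total_variation:
  fixes f :: "'a::euclidean_space \<Rightarrow> real"
  assumes f: "integrable lborel f" and U: "open U" 
    and \<Omega>: "open \<Omega>" and seg: "\<And>x t. x \<in> U \<Longrightarrow> 0 \<le> t \<Longrightarrow> t \<le> 1 \<Longrightarrow> x + t *\<^sub>R h \<in> \<Omega>"
  shows "(\<integral>\<^sup>+x. ennreal (\<bar>f (x + h) - f x\<bar> * indicator U x) \<partial>lborel) \<le> ennreal (norm h) * total_variation \<Omega> f"
proof -
  define g where "g x = (f (x + h) - f x) * indicator U x" for x
  have [measurable]: "f \<in> borel_measurable borel" using f by auto
  have [measurable]: "U \<in> sets borel" using U by auto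
  have fh: "integrable lborel (\<lambda>x. f (x + h))"
    using f
    by (subst (asm) lborel_distr_plus[of h, symmetric]) (simp add: integrable_distr_eq add.commute)
  have g: "integrable lborel g"
    unfolding g_def using f fh by (intro integrable_real_mult_indicator Bochner_Integration.integrable_diff) auto
  have [measurable]: "g \<in> borel_measurable borel" using g by auto
  define a where "a = (LINT x|lborel. \<bar>g x\<bar>)"
  have L: "(\<integral>\<^sup>+x. ennreal (\<bar>f (x + h) - f x\<bar> * indicator U x) \<partial>lborel) = ennreal a"
  proof -
    have "(\<lambda>x. \<bar>f (x + h) - f x\<bar> * indicator U x) = (\<lambda>x. \<bar>g x\<bar>)"
      by (auto simp: g_def abs_mult fun_eq_iff)
    then have "(\<integral>\<^sup>+x. ennreal (\<bar>f (x + h) - f x\<bar> * indicator U x) \<partial>lborel) = (\<integral>\<^sup>+x. ennreal \<bar>g x\<bar> \<partial>lborel)"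
      by metis
    also have "\<dots> = ennreal a"
      unfolding a_def by (rule nn_integral_eq_integral) (use g in auto)
    finally show ?thesis .
  qed
  have main: "ennreal (a - e) \<le> ennreal (norm h) * total_variation \<Omega> f" if e: "e > 0" for e
  proof -
    define P where "P = {x. 0 < g x}"
    define N where "N = {x. g x < 0}"
    have [measurable]: "P \<in> sets borel" "N \<in> sets borel" unfolding P_def N_def by measurable
    have PU: "P \<subseteq> U" "N \<subseteq> U" by (auto simp: P_def N_def g_def split: split_indicator_asm)
    \<comment> \<open>The loss \<open>e / 4\<close> occurs once for each sign and is doubled later,
      which adds up to \<open>e\<close>.\<close>
    obtain K where K: "compact K" "K \<subseteq> P" "(LINT x:P|lborel. \<bar>g x\<bar>) \<le> (LINT x:K|lborel. \<bar>g x\<bar>) + e/4"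
      using compact_subset_density[OF g, of P "e/4"] e by auto
    obtain J where J: "compact J" "J \<subseteq> N" "(LINT x:N|lborel. \<bar>g x\<bar>) \<le> (LINT x:J|lborel. \<bar>g x\<bar>) + e/4"
      using compact_subset_density[OF g, of N "e/4"] e by auto
    have [measurable]: "K \<in> sets borel" "J \<in> sets borel" using K J by (auto simp: compact_imp_closed)
    \<comment> \<open>Disjoint neighbourhoods let at most one cutoff be nonzero at a point, so
      \<open>\<psi>\<close> is exactly -1 on \<open>K\<close> and 1 on \<open>J\<close>.\<close>
    have "K \<inter> J = {}" using K(2) J(2) by (force simp: P_def N_def)
    then obtain V W where VW: "open V" "open W" "K \<subseteq> V" "J \<subseteq> W" "V \<inter> W = {}"
      using separation_normal[OF compact_imp_closed[OF K(1)] compact_imp_closed[OF J(1)]] by blast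
    have VU: "open (V \<inter> U)" "K \<subseteq> V \<inter> U" and WU: "open (W \<inter> U)" "J \<subseteq> W \<inter> U"
      using VW U K(2) J(2) PU by auto
    obtain p and p' :: "'a \<Rightarrow> 'a \<Rightarrow>\<^sub>L real" where p: "continuous_on UNIV p'"
      "\<forall>x. (p has_derivative blinfun_apply (p' x)) (at x)"
      "\<forall>x. 0 \<le> p x \<and> p x \<le> 1" "\<forall>x\<in>K. p x = (1::real)"
      "compact (closure {x. p x \<noteq> 0})" "closure {x. p x \<noteq> 0} \<subseteq> V \<inter> U"
      using C1_Urysohn[OF K(1) VU] by (elim exE conjE)
    obtain q and q' :: "'a \<Rightarrow> 'a \<Rightarrow>\<^sub>L real" where q: "continuous_on UNIV q'"
      "\<forall>x. (q has_derivative blinfun_apply (q' x)) (at x)"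
      "\<forall>x. 0 \<le> q x \<and> q x \<le> 1" "\<forall>x\<in>J. q x = (1::real)"
      "compact (closure {x. q x \<noteq> 0})" "closure {x. q x \<noteq> 0} \<subseteq> W \<inter> U"
      using C1_Urysohn[OF J(1) WU] by (elim exE conjE)
    define S where "S = closure {x. p x \<noteq> 0} \<union> closure {x. q x \<noteq> 0}"
    have p0: "p x = 0" if "x \<notin> V" for x using p(6) closure_subset[of "{x. p x \<noteq> 0}"] that by blast
    have q0: "q x = 0" if "x \<notin> W" for x using q(6) closure_subset[of "{x. q x \<noteq> 0}"] that by blast
    have pq0: "p x = 0 \<or> q x = 0" for x using p0 q0 VW by blast
    define \<psi> where "\<psi> x = q x - p x" for x
    have S: "compact S" unfolding S_def using p q by auto
    have SU: "S \<subseteq> U" unfolding S_def using p q by auto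
    have \<psi>S: "\<psi> x = 0" if "x \<notin> S" for x
    proof -
      have "p x = 0" "q x = 0"
        using that closure_subset[of "{x. q x \<noteq> 0}"] closure_subset[of "{x. p x \<noteq> 0}"]
        unfolding S_def by blast+
      then show ?thesis by (simp add: \<psi>_def)
    qed
    have \<psi>1: "\<bar>\<psi> x\<bar> \<le> 1" for x
      using pq0[of x] spec[OF p(3), of x] spec[OF q(3), of x] unfolding \<psi>_def by auto
    have contp: "continuous_on UNIV p" "continuous_on UNIV q"
      using has_derivative_continuous_on[OF has_derivative_at_withinI[OF spec[OF p(2)]]]
        has_derivative_continuous_on[OF has_derivative_at_withinI[OF spec[OF q(2)]]] by auto
    have [measurable]: "\<psi> \<in> borel_measurable borel"
      unfolding \<psi>_def[abs_def] using contp by (intro borel_measurable_continuous_onI continuous_intros)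
    have TV: "ennreal (LINT x:\<Omega>|lebesgue. f x * (\<psi> x - \<psi> (x - h))) \<le> ennreal (norm h) * total_variation \<Omega> f"
    proof (rule difference_le_total_variation[of "\<lambda>x. q' x - p' x" \<psi> S])
      show "continuous_on UNIV (\<lambda>x. q' x - p' x)" using p q by (intro continuous_intros)
      show "(\<psi> has_derivative blinfun_apply (q' x - p' x)) (at x)" for x
        unfolding \<psi>_def[abs_def] blinfun.diff_left[abs_def] by (intro has_derivative_diff p(2)[rule_format] q(2)[rule_format])
    qed (use \<psi>1 S SU \<psi>S seg in auto)
    have supp\<Omega>: "\<psi> x - \<psi> (x - h) = 0" if "x \<notin> \<Omega>" for x
    proof -
      have "x \<notin> S" using SU seg[of x 0] that by auto
      moreover have "x - h \<notin> S" using SU seg[of "x - h" 1] that by auto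
      ultimately show ?thesis using \<psi>S by simp
    qed
    have mult: "integrable lborel (\<lambda>x. u x * \<psi> x)" if u: "integrable lborel u" for u :: "'a \<Rightarrow> real"
      using \<psi>1 u by (intro Bochner_Integration.integrable_bound[OF u]) (auto simp: abs_mult mult_left_le)
    note i1 = mult[OF f] and i3 = mult[OF fh] and i4 = mult[OF g]
    have i2: "integrable lborel (\<lambda>x. f x * \<psi> (x - h))"
    proof (rule Bochner_Integration.integrable_bound[OF f])
      show "AE x in lborel. norm (f x * \<psi> (x - h)) \<le> norm (f x)"
        using \<psi>1 by (auto simp: abs_mult mult_left_le)
    qed measurable
    \<comment> \<open>Discrete integration by parts: the shift moves from the test function to
      \<open>f\<close>.\<close>
    have shift: "(LINT x|lborel. f x * \<psi> (x - h)) = (LINT x|lborel. f (x + h) * \<psi> x)"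
      by (subst lborel_distr_plus[of h, symmetric], subst integral_distr) (auto simp: add.commute)
    have "(LINT x:\<Omega>|lebesgue. f x * (\<psi> x - \<psi> (x - h))) = (LINT x|lebesgue. f x * (\<psi> x - \<psi> (x - h)))"
      unfolding set_lebesgue_integral_def
      by (intro Bochner_Integration.integral_cong) (use supp\<Omega> in \<open>auto split: split_indicator\<close>)
    also have "\<dots> = (LINT x|lborel. f x * (\<psi> x - \<psi> (x - h)))"
      by (intro integral_completion) measurable
    also have "\<dots> = (LINT x|lborel. f x * \<psi> x) - (LINT x|lborel. f (x + h) * \<psi> x)"
      unfolding right_diff_distrib using i1 i2 by (simp add: shift)
    also have "\<dots> = (LINT x|lborel. f x * \<psi> x - f (x + h) * \<psi> x)"
      by (rule Bochner_Integration.integral_diff[symmetric]) (fact i1 i3)+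
    also have "(\<lambda>x. f x * \<psi> x - f (x + h) * \<psi> x) = (\<lambda>x. - (g x * \<psi> x))"
    proof
      fix x
      show "f x * \<psi> x - f (x + h) * \<psi> x = - (g x * \<psi> x)"
        using SU \<psi>S[of x] by (cases "x \<in> U") (auto simp: g_def algebra_simps)
    qed
    finally have eq: "(LINT x:\<Omega>|lebesgue. f x * (\<psi> x - \<psi> (x - h))) = (LINT x|lborel. - (g x * \<psi> x))" .
    have iB: "integrable lborel (\<lambda>x. \<bar>g x\<bar> * indicator B x)" if "B \<in> sets borel" for B
      using that g by (intro integrable_real_mult_indicator) auto
    have SI: "(LINT x:B|lborel. \<bar>g x\<bar>) = (LINT x|lborel. \<bar>g x\<bar> * indicator B x)" for B
      by (simp add: set_lebesgue_integral_def mult.commute)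
    have aPN: "a = (LINT x|lborel. \<bar>g x\<bar> * indicator P x) + (LINT x|lborel. \<bar>g x\<bar> * indicator N x)"
      unfolding a_def by (subst Bochner_Integration.integral_add[symmetric])
        (auto intro!: iB Bochner_Integration.integral_cong simp: P_def N_def split: split_indicator)
    \<comment> \<open>On \<open>K\<close> and \<open>J\<close> the tested integrand equals
      \<open>\<bar>g x\<bar>\<close>, elsewhere it is at least \<open>- \<bar>g x\<bar>\<close>. The
      mass elsewhere is \<open>a\<close> minus the mass on \<open>K\<close> and \<open>J\<close>,
      whence the factor 2 and the term \<open>- a\<close>.\<close>
    have "a - e \<le> 2 * ((LINT x|lborel. \<bar>g x\<bar> * indicator K x) + (LINT x|lborel. \<bar>g x\<bar> * indicator J x)) - a"
    proof -
      have arith: "a - e \<le> 2 * (k + j) - a" if "p \<le> k + e/4" "q \<le> j + e/4" "a = p + q" for p q k j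
        using that by (simp add: algebra_simps)
      show ?thesis by (rule arith[OF K(3)[unfolded SI] J(3)[unfolded SI] aPN])
    qed
    also have "\<dots> = (LINT x|lborel. 2 * (\<bar>g x\<bar> * indicator K x + \<bar>g x\<bar> * indicator J x) - \<bar>g x\<bar>)"
      unfolding a_def using g by (simp add: iB)
    also have "\<dots> \<le> (LINT x|lborel. - (g x * \<psi> x))"
    proof (intro integral_mono)
      show "integrable lborel (\<lambda>x. 2 * (\<bar>g x\<bar> * indicator K x + \<bar>g x\<bar> * indicator J x) - \<bar>g x\<bar>)"
        using g by (simp add: iB)
      show "integrable lborel (\<lambda>x. - (g x * \<psi> x))" using i4 by simp
      fix x
      consider "x \<in> K" | "x \<in> J" | "x \<notin> K" "x \<notin> J" by blast
      then show "2 * (\<bar>g x\<bar> * indicator K x + \<bar>g x\<bar> * indicator J x) - \<bar>g x\<bar> \<le> - (g x * \<psi> x)"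
      proof cases
        case 1
        then have "x \<notin> J" "g x > 0" "p x = 1" using \<open>K \<inter> J = {}\<close> K(2) p(4) by (auto simp: P_def)
        then show ?thesis using 1 pq0[of x] by (auto simp: \<psi>_def)
      next
        case 2
        then have "x \<notin> K" "g x < 0" "q x = 1" using \<open>K \<inter> J = {}\<close> J(2) q(4) by (auto simp: N_def)
        then show ?thesis using 2 pq0[of x] by (auto simp: \<psi>_def)
      next
        case 3
        have "\<bar>g x * \<psi> x\<bar> \<le> \<bar>g x\<bar>" using \<psi>1[of x] by (simp add: abs_mult mult_left_le)
        then show ?thesis using 3 by auto
      qed
    qed
    finally show ?thesis using TV unfolding eq by (meson ennreal_leI order_trans)
  qed
  have "ennreal a \<le> ennreal (norm h) * total_variation \<Omega> f"
  proof (rule ennreal_le_epsilon)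
    fix e :: real assume "0 < e"
    have "ennreal a \<le> ennreal (a - e) + ennreal e"
    proof (cases "e \<le> a")
      case True
      then show ?thesis using \<open>0 < e\<close> by (simp flip: ennreal_plus)
    next
      case False
      then have "ennreal a \<le> ennreal e" by (intro ennreal_leI) simp
      then show ?thesis by (meson add_increasing zero_le)
    qed
    also have "\<dots> \<le> ennreal (norm h) * total_variation \<Omega> f + ennreal e"
      by (intro add_right_mono main \<open>0 < e\<close>)
    finally show "ennreal a \<le> ennreal (norm h) * total_variation \<Omega> f + ennreal e" .
  qed
  then show ?thesis by (simp add: L)
qed

section \<open>Nonlocal perimeter and the coarea inequality\<close>

text \<open>The perimeter of a set is replaced by a limit of averaged difference quotients at scale \<open>1 / k\<close>:
  for these the coarea formula is Tonelli's theorem and superadditivity over disjoint balls is immediate.\<close>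

definition inner_part :: "'a::metric_space set \<Rightarrow> nat \<Rightarrow> 'a set" where
  "inner_part \<Omega> k = {x. 1 / real k < infdist x (- \<Omega>)}"

definition ball_variation :: "'a::euclidean_space set \<Rightarrow> ('a \<Rightarrow> real) \<Rightarrow> 'a \<Rightarrow> ennreal" where
  "ball_variation B u h = (\<integral>\<^sup>+x. ennreal \<bar>u (x + h) - u x\<bar> * indicator B x * indicator B (x + h) \<partial>lborel)"

text \<open>The increments fill a ball of volume of order \<open>1 / k ^ n\<close>, and the inner
  integral is of order \<open>1 / k\<close> for a function of bounded variation; the factor
  \<open>k ^ (n + 1)\<close> compensates both.\<close>

definition nonlocal_variation :: "nat \<Rightarrow> 'a::euclidean_space set \<Rightarrow> ('a \<Rightarrow> real) \<Rightarrow> ennreal" where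
  "nonlocal_variation k U u = ennreal (real k ^ (DIM('a) + 1)) *
     (\<integral>\<^sup>+h. (\<integral>\<^sup>+x. ennreal \<bar>u (x + h) - u x\<bar> * indicator U x \<partial>lborel) * indicator (ball 0 (1 / real k)) h \<partial>lborel)"

text \<open>A liminf fits both uses: Fatou's lemma bounds its integral over levels from above, and a
  lower bound valid for all large \<open>k\<close> passes to it. \<open>Suc k\<close> avoids the
  degenerate scale 0.\<close>

definition perimeter_density :: "'a::euclidean_space set \<Rightarrow> 'a set \<Rightarrow> ennreal" where
  "perimeter_density \<Omega> E = liminf (\<lambda>k. nonlocal_variation (Suc k) (inner_part \<Omega> (Suc k)) (indicator E))"

lemma ball_sets_borel [measurable]: "ball z r \<in> sets borel"
  by simp

lemma open_inner_part: "open (inner_part \<Omega> k)"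
  unfolding inner_part_def by (intro open_Collect_less continuous_intros)

lemma inner_part_ball:
  assumes "x \<in> inner_part \<Omega> k" "norm h < 1 / real k"
  shows "x + h \<in> \<Omega>"
proof (rule ccontr)
  assume "x + h \<notin> \<Omega>"
  then have "infdist x (- \<Omega>) \<le> dist x (x + h)" by (intro infdist_le) simp
  then show False using assms by (simp add: inner_part_def dist_norm)
qed

lemma nn_integral_translate:
  fixes c :: "'a::euclidean_space"
  assumes [measurable]: "F \<in> borel_measurable borel"
  shows "(\<integral>\<^sup>+x. F (x + c) \<partial>lborel) = (\<integral>\<^sup>+x. F x \<partial>lborel)"
  by (subst (2) lborel_distr_plus[of c, symmetric], subst nn_integral_distr) (auto simp: add.commute)

lemma nn_integral_scale:
  fixes F :: "'a::euclidean_space \<Rightarrow> ennreal"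
  assumes [measurable]: "F \<in> borel_measurable borel" and c: "c > 0"
  shows "(\<integral>\<^sup>+x. F x \<partial>lborel) = ennreal (c ^ DIM('a)) * (\<integral>\<^sup>+x. F (c *\<^sub>R x) \<partial>lborel)"
  by (subst lborel_affine[of c 0]) (use c in \<open>auto simp: nn_integral_density nn_integral_distr nn_integral_cmult\<close>)

section \<open>Subadditivity in the increment and a nonlocal Poincare inequality on balls\<close>

lemma ball_variation_measurable [measurable]:
  assumes [measurable]: "u \<in> borel_measurable borel" "B \<in> sets borel"
  shows "ball_variation B u \<in> borel_measurable borel"
  unfolding ball_variation_def[abs_def] by measurable

text \<open>Triangle inequality through the intermediate point \<open>x + N h\<close>. Convexity
  keeps this point in \<open>B\<close> when both end points are there.\<close>

lemma ball_variation_add: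
  fixes u :: "'a::euclidean_space \<Rightarrow> real"
  assumes [measurable]: "u \<in> borel_measurable borel" "B \<in> sets borel" and B: "convex B"
  shows "ball_variation B u (real (Suc N) *\<^sub>R h) \<le> ball_variation B u (real N *\<^sub>R h) + ball_variation B u h"
proof -
  let ?c = "real N *\<^sub>R h"
  define F where "F x = ennreal \<bar>u (x + h) - u x\<bar> * indicator B x * indicator B (x + h)" for x
  have [measurable]: "F \<in> borel_measurable borel" unfolding F_def by measurable
  have eq: "x + real (Suc N) *\<^sub>R h = (x + ?c) + h" for x by (simp add: algebra_simps)
  have "ball_variation B u (real (Suc N) *\<^sub>R h) \<le>
     (\<integral>\<^sup>+x. ennreal \<bar>u (x + ?c) - u x\<bar> * indicator B x * indicator B (x + ?c) + F (x + ?c) \<partial>lborel)"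
    unfolding ball_variation_def eq
  proof (rule nn_integral_mono)
    fix x
    show "ennreal \<bar>u (x + ?c + h) - u x\<bar> * indicator B x * indicator B (x + ?c + h)
       \<le> ennreal \<bar>u (x + ?c) - u x\<bar> * indicator B x * indicator B (x + ?c) + F (x + ?c)"
    proof (cases "x \<in> B \<and> x + ?c + h \<in> B")
      case True
      have "x + ?c = (1 - real N / real (Suc N)) *\<^sub>R x + (real N / real (Suc N)) *\<^sub>R (x + ?c + h)"
      proof -
        have "(real N / real (Suc N)) *\<^sub>R (?c + h) = ?c"
        proof -
          have "?c + h = real (Suc N) *\<^sub>R h" by (simp add: algebra_simps)
          then show ?thesis by simp
        qed
        then show ?thesis by (simp add: algebra_simps)
      qed
      also have "\<dots> \<in> B" by (intro convexD[OF B]) (use True in auto)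
      finally have "x + ?c \<in> B" .
      moreover have "ennreal \<bar>u (x + ?c + h) - u x\<bar> \<le> ennreal (\<bar>u (x + ?c) - u x\<bar> + \<bar>u (x + ?c + h) - u (x + ?c)\<bar>)"
        by (intro ennreal_leI) linarith
      ultimately show ?thesis using True by (simp add: F_def)
    next
      case False then show ?thesis by (auto split: split_indicator)
    qed
  qed
  also have "\<dots> = ball_variation B u ?c + ball_variation B u h"
  proof -
    have "(\<integral>\<^sup>+x. F (x + ?c) \<partial>lborel) = ball_variation B u h"
      using nn_integral_translate[of F ?c] by (simp add: ball_variation_def F_def[abs_def])
    then show ?thesis
      by (subst nn_integral_add) (auto simp: ball_variation_def)
  qed
  finally show ?thesis .
qed

lemma ball_variation_mult:
  fixes u :: "'a::euclidean_space \<Rightarrow> real"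
  assumes "u \<in> borel_measurable borel" "B \<in> sets borel" "convex B"
  shows "ball_variation B u (real N *\<^sub>R h) \<le> of_nat N * ball_variation B u h"
proof (induction N)
  case 0 then show ?case by (simp add: ball_variation_def)
next
  case (Suc N)
  have "ball_variation B u (real (Suc N) *\<^sub>R h) \<le> of_nat N * ball_variation B u h + ball_variation B u h"
    using ball_variation_add[OF assms, of N h] Suc by (meson add_right_mono order_trans)
  then show ?case by (simp add: distrib_right add.commute)
qed

text \<open>Two points of the ball differ by an increment shorter than \<open>2 * r\<close>.
  Splitting it into \<open>N\<close> equal steps costs a factor \<open>N\<close> by subadditivity,
  and the change of variables from increment to step costs \<open>N ^ n\<close>.\<close>

lemma nonlocal_Poincare:
  fixes u :: "'a::euclidean_space \<Rightarrow> real"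
  assumes [measurable]: "u \<in> borel_measurable borel" and N: "N > 0"
  shows "(\<integral>\<^sup>+x. \<integral>\<^sup>+y. ennreal \<bar>u y - u x\<bar> * indicator (ball z r) x * indicator (ball z r) y \<partial>lborel \<partial>lborel)
     \<le> ennreal (real N ^ (DIM('a) + 1)) * (\<integral>\<^sup>+h. ball_variation (ball z r) u h * indicator (ball 0 (2 * r / real N)) h \<partial>lborel)"
proof -
  let ?B = "ball z r"
  have "(\<integral>\<^sup>+x. \<integral>\<^sup>+y. ennreal \<bar>u y - u x\<bar> * indicator ?B x * indicator ?B y \<partial>lborel \<partial>lborel)
    = (\<integral>\<^sup>+x. \<integral>\<^sup>+h. ennreal \<bar>u (x + h) - u x\<bar> * indicator ?B x * indicator ?B (x + h) \<partial>lborel \<partial>lborel)"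
  proof (rule nn_integral_cong)
    fix x
    show "(\<integral>\<^sup>+y. ennreal \<bar>u y - u x\<bar> * indicator ?B x * indicator ?B y \<partial>lborel)
      = (\<integral>\<^sup>+h. ennreal \<bar>u (x + h) - u x\<bar> * indicator ?B x * indicator ?B (x + h) \<partial>lborel)"
    proof -
      have "(\<lambda>y. ennreal \<bar>u y - u x\<bar> * indicator ?B x * indicator ?B y) \<in> borel_measurable borel"
        by measurable
      from nn_integral_translate[OF this, of x] show ?thesis by (simp add: add.commute)
    qed
  qed
  also have "\<dots> = (\<integral>\<^sup>+h. ball_variation ?B u h \<partial>lborel)"
    unfolding ball_variation_def by (rule lborel_pair.Fubini') measurable
  also have "\<dots> = (\<integral>\<^sup>+h. ball_variation ?B u h * indicator (ball 0 (2*r)) h \<partial>lborel)"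
  proof (rule nn_integral_cong)
    fix h :: 'a
    have "ball_variation ?B u h = 0" if "h \<notin> ball 0 (2*r)"
    proof -
      have "(indicator ?B x * indicator ?B (x + h) :: ennreal) = 0" for x
      proof (rule ccontr)
        assume "(indicator ?B x * indicator ?B (x + h) :: ennreal) \<noteq> 0"
        then have "dist z x < r" "dist z (x + h) < r" by (auto split: split_indicator_asm)
        then have "dist x (x + h) < 2 * r" by metric
        then show False using that by (simp add: dist_norm)
      qed
      then show ?thesis by (simp only: ball_variation_def mult.assoc mult_zero_right nn_integral_const mult_zero_left)
    qed
    then show "ball_variation ?B u h = ball_variation ?B u h * indicator (ball 0 (2*r)) h"
      by (auto split: split_indicator)
  qed
  also have "\<dots> = ennreal (real N ^ DIM('a)) * (\<integral>\<^sup>+h. ball_variation ?B u (real N *\<^sub>R h) * indicator (ball 0 (2*r)) (real N *\<^sub>R h) \<partial>lborel)"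
    using N by (intro nn_integral_scale) auto
  also have "\<dots> \<le> ennreal (real N ^ DIM('a)) * (\<integral>\<^sup>+h. of_nat N * (ball_variation ?B u h * indicator (ball 0 (2*r / real N)) h) \<partial>lborel)"
  proof (intro mult_left_mono nn_integral_mono)
    fix h :: 'a
    have "indicator (ball 0 (2*r)) (real N *\<^sub>R h) = (indicator (ball 0 (2*r / real N)) h :: ennreal)"
      using N by (auto simp: indicator_def field_simps)
    then show "ball_variation ?B u (real N *\<^sub>R h) * indicator (ball 0 (2*r)) (real N *\<^sub>R h)
      \<le> of_nat N * (ball_variation ?B u h * indicator (ball 0 (2*r / real N)) h)"
      using ball_variation_mult[of u ?B N h] by (auto split: split_indicator)
  qed simp
  also have "\<dots> = ennreal (real N ^ (DIM('a) + 1)) * (\<integral>\<^sup>+h. ball_variation ?B u h * indicator (ball 0 (2 * r / real N)) h \<partial>lborel)"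
    by (subst nn_integral_cmult) (auto simp: ennreal_mult ennreal_of_nat_eq_real_of_nat mult_ac)
  finally show ?thesis .
qed


section \<open>The coarea formula at a fixed scale\<close>

lemma layer_cake_difference:
  "(\<integral>\<^sup>+t. ennreal \<bar>indicator {x. t < f x} a - indicator {x. t < f x} b :: real\<bar> \<partial>lborel) = ennreal \<bar>f a - f b :: real\<bar>"
proof -
  have "(\<integral>\<^sup>+t. ennreal \<bar>indicator {x. t < f x} a - indicator {x. t < f x} b :: real\<bar> \<partial>lborel)
     = (\<integral>\<^sup>+t. indicator {min (f a) (f b) ..< max (f a) (f b)} t \<partial>lborel)"
    by (intro nn_integral_cong) (auto split: split_indicator)
  also have "\<dots> = ennreal \<bar>f a - f b\<bar>" by (simp add: min_def max_def abs_if)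
  finally show ?thesis .
qed

lemma nonlocal_variation_measurable_level:
  fixes f :: "'a::euclidean_space \<Rightarrow> real"
  assumes [measurable]: "f \<in> borel_measurable borel" "U \<in> sets borel"
  shows "(\<lambda>t. nonlocal_variation k U (indicator {x. t < f x})) \<in> borel_measurable borel"
proof -
  have eq: "nonlocal_variation k U (indicator {x. t < f x}) = ennreal (real k ^ (DIM('a) + 1)) *
     (\<integral>\<^sup>+h. (\<integral>\<^sup>+x. ennreal \<bar>(if t < f (x + h) then 1 else 0) - (if t < f x then 1 else 0)\<bar> * indicator U x \<partial>lborel) * indicator (ball 0 (1 / real k)) h \<partial>lborel)" for t
  proof -
    \<comment> \<open>The conditional form exhibits joint measurability in the level and the
      point.\<close>
    have "indicator {x. t < f x} = (\<lambda>x. if t < f x then 1 else 0 :: real)" by (auto simp: indicator_def)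
    then show ?thesis by (simp only: nonlocal_variation_def)
  qed
  show ?thesis unfolding eq by measurable
qed

lemma nonlocal_variation_coarea:
  fixes f :: "'a::euclidean_space \<Rightarrow> real"
  assumes [measurable]: "f \<in> borel_measurable borel" "U \<in> sets borel"
  shows "(\<integral>\<^sup>+t. nonlocal_variation k U (indicator {x. t < f x}) \<partial>lborel) = nonlocal_variation k U f"
proof -
  define \<xi> where "\<xi> t x = (if t < f x then 1 else 0 :: real)" for t x
  have [measurable]: "(\<lambda>p. \<xi> (fst p) (snd p)) \<in> borel_measurable (borel \<Otimes>\<^sub>M borel)"
    unfolding \<xi>_def by measurable
  have chi: "indicator {x. t < f x} = \<xi> t" for t by (auto simp: \<xi>_def indicator_def)
  have "(\<integral>\<^sup>+t. nonlocal_variation k U (indicator {x. t < f x}) \<partial>lborel) = ennreal (real k ^ (DIM('a) + 1)) *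
    (\<integral>\<^sup>+t. \<integral>\<^sup>+h. (\<integral>\<^sup>+x. ennreal \<bar>\<xi> t (x + h) - \<xi> t x\<bar> * indicator U x \<partial>lborel) * indicator (ball 0 (1 / real k)) h \<partial>lborel \<partial>lborel)"
    unfolding nonlocal_variation_def chi by (rule nn_integral_cmult) (simp add: \<xi>_def)
  also have "(\<integral>\<^sup>+t. \<integral>\<^sup>+h. (\<integral>\<^sup>+x. ennreal \<bar>\<xi> t (x + h) - \<xi> t x\<bar> * indicator U x \<partial>lborel) * indicator (ball 0 (1 / real k)) h \<partial>lborel \<partial>lborel)
    = (\<integral>\<^sup>+h. \<integral>\<^sup>+t. (\<integral>\<^sup>+x. ennreal \<bar>\<xi> t (x + h) - \<xi> t x\<bar> * indicator U x \<partial>lborel) * indicator (ball 0 (1 / real k)) h \<partial>lborel \<partial>lborel)"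
    by (rule lborel_pair.Fubini') (simp add: \<xi>_def)
  also have "\<dots> = (\<integral>\<^sup>+h. (\<integral>\<^sup>+t. (\<integral>\<^sup>+x. ennreal \<bar>\<xi> t (x + h) - \<xi> t x\<bar> * indicator U x \<partial>lborel) \<partial>lborel) * indicator (ball 0 (1 / real k)) h \<partial>lborel)"
    by (intro nn_integral_cong nn_integral_multc) (simp add: \<xi>_def)
  also have "\<dots> = (\<integral>\<^sup>+h. (\<integral>\<^sup>+x. (\<integral>\<^sup>+t. ennreal \<bar>\<xi> t (x + h) - \<xi> t x\<bar> * indicator U x \<partial>lborel) \<partial>lborel) * indicator (ball 0 (1 / real k)) h \<partial>lborel)"
    by (intro nn_integral_cong arg_cong2[where f="(*)"] lborel_pair.Fubini' refl) (simp add: \<xi>_def)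
  also have "\<dots> = (\<integral>\<^sup>+h. (\<integral>\<^sup>+x. ennreal \<bar>f (x + h) - f x\<bar> * indicator U x \<partial>lborel) * indicator (ball 0 (1 / real k)) h \<partial>lborel)"
  proof -
    have "(\<integral>\<^sup>+t. ennreal \<bar>\<xi> t (x + h) - \<xi> t x\<bar> * indicator U x \<partial>lborel) = ennreal \<bar>f (x + h) - f x\<bar> * indicator U x" for x h
      using layer_cake_difference[of f "x + h" x] unfolding chi
      by (subst nn_integral_multc) (simp_all add: \<xi>_def)
    then show ?thesis by simp
  qed
  finally show ?thesis by (simp add: nonlocal_variation_def)
qed

text \<open>For each increment shorter than \<open>1 / k\<close> the translation estimate gives at
  most the total variation divided by \<open>k\<close>. The ball of increments has volume
  \<open>unit_ball_vol n / k ^ n\<close>, so the normalising factor cancels every power of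
  \<open>k\<close>.\<close>

lemma nonlocal_variation_le:
  fixes f :: "'a::euclidean_space \<Rightarrow> real"
  assumes f: "integrable lborel f" and \<Omega>: "open \<Omega>" and k: "k > 0"
  shows "nonlocal_variation k (inner_part \<Omega> k) f \<le> ennreal (unit_ball_vol DIM('a)) * total_variation \<Omega> f"
proof -
  let ?T = "total_variation \<Omega> f"
  have "(\<integral>\<^sup>+h. (\<integral>\<^sup>+x. ennreal \<bar>f (x + h) - f x\<bar> * indicator (inner_part \<Omega> k) x \<partial>lborel) * indicator (ball 0 (1 / real k)) h \<partial>lborel)
    \<le> (\<integral>\<^sup>+h. ennreal (1 / real k) * ?T * indicator (ball (0::'a) (1 / real k)) h \<partial>lborel)"
  proof (rule nn_integral_mono)
    fix h :: 'a
    show "(\<integral>\<^sup>+x. ennreal \<bar>f (x + h) - f x\<bar> * indicator (inner_part \<Omega> k) x \<partial>lborel) * indicator (ball 0 (1 / real k)) h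
      \<le> ennreal (1 / real k) * ?T * indicator (ball (0::'a) (1 / real k)) h"
    proof (cases "h \<in> ball 0 (1 / real k)")
      case True
      then have h: "norm h < 1 / real k" by simp
      have "(\<integral>\<^sup>+x. ennreal (\<bar>f (x + h) - f x\<bar> * indicator (inner_part \<Omega> k) x) \<partial>lborel) \<le> ennreal (norm h) * ?T"
      proof (rule translate_difference_le_total_variation[OF f open_inner_part \<Omega>])
        fix x t assume "x \<in> inner_part \<Omega> k" and t: "0 \<le> t" "t \<le> (1::real)"
        moreover have "norm (t *\<^sub>R h) \<le> norm h" using t by (simp add: mult_left_le_one_le)
        ultimately show "x + t *\<^sub>R h \<in> \<Omega>" using h by (intro inner_part_ball) auto
      qed
      also have "\<dots> \<le> ennreal (1 / real k) * ?T" using h by (intro mult_right_mono ennreal_leI) auto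
      finally show ?thesis using True by (simp add: ennreal_mult ennreal_indicator)
    qed simp
  qed
  also have "\<dots> = ennreal (1 / real k) * ?T * ennreal (unit_ball_vol DIM('a) * (1 / real k) ^ DIM('a))"
    using k by (subst nn_integral_cmult_indicator) (auto simp: emeasure_ball)
  finally have "nonlocal_variation k (inner_part \<Omega> k) f \<le> ennreal (real k ^ (DIM('a) + 1)) *
    (ennreal (1 / real k) * ?T * ennreal (unit_ball_vol DIM('a) * (1 / real k) ^ DIM('a)))"
    unfolding nonlocal_variation_def by (rule mult_left_mono) simp
  also have "\<dots> = ennreal (real k ^ (DIM('a) + 1) * (1 / real k) * (unit_ball_vol DIM('a) * (1 / real k) ^ DIM('a))) * ?T"
  proof -
    have "ennreal A * (ennreal b * S * ennreal c) = ennreal (A * b * c) * S" if "A \<ge> 0" "b \<ge> 0" "c \<ge> 0" for A b c S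
      using that by (simp add: ennreal_mult mult_ac)
    then show ?thesis by simp
  qed
  also have "real k ^ (DIM('a) + 1) * (1 / real k) * (unit_ball_vol DIM('a) * (1 / real k) ^ DIM('a)) = unit_ball_vol DIM('a)"
    using k by (simp add: power_one_over)
  finally show ?thesis .
qed

section \<open>The perimeter integrated over all levels\<close>

lemma perimeter_density_measurable:
  fixes f :: "'a::euclidean_space \<Rightarrow> real"
  assumes [measurable]: "f \<in> borel_measurable borel"
  shows "(\<lambda>t. perimeter_density \<Omega> {x. t < f x}) \<in> borel_measurable borel"
  unfolding perimeter_density_def
  by (intro borel_measurable_liminf nonlocal_variation_measurable_level assms) (simp add: open_inner_part)

text \<open>Fatou's lemma in the level variable, combined with the exact coarea identity at each
  scale.\<close>

lemma perimeter_density_integral_le: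
  fixes f :: "'a::euclidean_space \<Rightarrow> real"
  assumes fm: "f \<in> borel_measurable borel"
    and le: "\<And>k. nonlocal_variation (Suc k) (inner_part \<Omega> (Suc k)) f \<le> b"
  shows "(\<integral>\<^sup>+t. perimeter_density \<Omega> {x. t < f x} \<partial>lborel) \<le> b"
proof -
  have o: "inner_part \<Omega> k \<in> sets borel" for k by (simp add: open_inner_part)
  have "(\<integral>\<^sup>+t. perimeter_density \<Omega> {x. t < f x} \<partial>lborel) \<le>
     liminf (\<lambda>k. \<integral>\<^sup>+t. nonlocal_variation (Suc k) (inner_part \<Omega> (Suc k)) (indicator {x. t < f x}) \<partial>lborel)"
    unfolding perimeter_density_def
    by (rule nn_integral_liminf) (use nonlocal_variation_measurable_level[OF fm o] in simp)
  also have "\<dots> = liminf (\<lambda>k. nonlocal_variation (Suc k) (inner_part \<Omega> (Suc k)) f)"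
    by (simp add: nonlocal_variation_coarea[OF fm o])
  also have "\<dots> \<le> limsup (\<lambda>k. nonlocal_variation (Suc k) (inner_part \<Omega> (Suc k)) f)"
    by (rule Liminf_le_Limsup) simp
  also have "\<dots> \<le> b"
    by (rule Limsup_bounded) (auto intro!: always_eventually le)
  finally show ?thesis .
qed

text \<open>The second bound serves the sublevel sets of \<open>f\<close>. It follows in the same
  way because absolute differences ignore the sign.\<close>

lemma coarea_inequality:
  fixes f :: "'a::euclidean_space \<Rightarrow> real"
  assumes f: "integrable lborel f" and \<Omega>: "open \<Omega>"
  shows "(\<integral>\<^sup>+t. perimeter_density \<Omega> {x. t < f x} \<partial>lborel) \<le> ennreal (unit_ball_vol DIM('a)) * total_variation \<Omega> f"
    and "(\<integral>\<^sup>+t. perimeter_density \<Omega> {x. t < - f x} \<partial>lborel) \<le> ennreal (unit_ball_vol DIM('a)) * total_variation \<Omega> f"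
proof -
  have [measurable]: "f \<in> borel_measurable borel" using f by auto
  have neg: "nonlocal_variation k U (\<lambda>x. - f x) = nonlocal_variation k U f" for k U
    by (simp add: nonlocal_variation_def abs_minus_commute)
  show "(\<integral>\<^sup>+t. perimeter_density \<Omega> {x. t < f x} \<partial>lborel) \<le> ennreal (unit_ball_vol DIM('a)) * total_variation \<Omega> f"
    by (intro perimeter_density_integral_le nonlocal_variation_le f \<Omega>) auto
  show "(\<integral>\<^sup>+t. perimeter_density \<Omega> {x. t < - f x} \<partial>lborel) \<le> ennreal (unit_ball_vol DIM('a)) * total_variation \<Omega> f"
    by (intro perimeter_density_integral_le) (auto simp: neg intro!: nonlocal_variation_le f \<Omega>)
qed

text \<open>A relative isoperimetric inequality at scale \<open>1 / k\<close>: pairs with one point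
  in \<open>E\<close> and the other outside contribute the product of two half volumes to the double
  integral of \<open>nonlocal_Poincare\<close>. The factor 4 and the squared unit ball volume come
  from this product, \<open>3 ^ (n + 1)\<close> from the number of steps.\<close>

lemma half_density_ball_radius_le:
  fixes E :: "'a::euclidean_space set"
  assumes [measurable]: "E \<in> sets borel" and r: "r > 0" "1 \<le> r * real k"
    and half: "measure lborel (E \<inter> ball z r) = measure lborel (ball z r) / 2"
  shows "ennreal (r ^ (DIM('a) - 1)) \<le> ennreal (4 * 3 ^ (DIM('a) + 1) / (unit_ball_vol DIM('a))\<^sup>2) *
    (ennreal (real k ^ (DIM('a) + 1)) * (\<integral>\<^sup>+h. ball_variation (ball z r) (indicator E) h * indicator (ball 0 (1 / real k)) h \<partial>lborel))"
proof -
  let ?n = "DIM('a)" and ?B = "ball z r"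
  let ?\<omega> = "unit_ball_vol ?n"
  let ?W = "\<integral>\<^sup>+h. ball_variation ?B (indicator E) h * indicator (ball 0 (1 / real k)) h \<partial>lborel"
  have k: "k > 0" using r by (cases k) auto
  \<comment> \<open>At least \<open>2 * r * k\<close> steps make each no longer than
    \<open>1 / k\<close>; as \<open>r * k\<close> is at least 1, rounding up stays within
    \<open>3 * r * k\<close>.\<close>
  define N where "N = nat \<lceil>2 * r * real k\<rceil>"
  have rk: "0 < r * real k" using r k by simp
  have N: "N > 0" "2 * r * real k \<le> real N" "real N \<le> 3 * r * real k"
    using r rk unfolding N_def by (auto simp: ceiling_le_iff) linarith+
  have sub: "ball 0 (2 * r / real N) \<subseteq> ball 0 (1 / real k)"
    using N k by (intro subset_ball) (simp add: field_simps)
  have fin: "emeasure lborel (E \<inter> ?B) \<noteq> \<infinity>"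
    using emeasure_mono[of "E \<inter> ?B" ?B lborel] emeasure_lborel_ball_finite[of z r] by (auto simp: top_unique)
  have vol: "measure lborel ?B = ?\<omega> * r ^ ?n" using r by (simp add: content_ball)
  have e1: "emeasure lborel (E \<inter> ?B) = ennreal (?\<omega> * r ^ ?n / 2)"
    using emeasure_eq_ennreal_measure[OF fin[simplified infinity_ennreal_def]] half[unfolded vol] by presburger
  have "measure lborel (?B - E) = measure lborel ?B - measure lborel (E \<inter> ?B)"
  proof -
    have "?B - E = ?B - (E \<inter> ?B)" by auto
    then show ?thesis using measure_Diff[of lborel ?B "E \<inter> ?B"] emeasure_lborel_ball_finite[of z r] by simp
  qed
  then have m2: "measure lborel (?B - E) = ?\<omega> * r ^ ?n / 2"
    using half vol by simp
  have "emeasure lborel (?B - E) \<noteq> \<infinity>"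
    using emeasure_mono[of "?B - E" ?B lborel] emeasure_lborel_ball_finite[of z r] by (auto simp: top_unique)
  then have e2: "emeasure lborel (?B - E) = ennreal (?\<omega> * r ^ ?n / 2)"
    using emeasure_eq_ennreal_measure[of lborel "?B - E"] unfolding m2 by simp
  have "ennreal (?\<omega> * r ^ ?n / 2) * ennreal (?\<omega> * r ^ ?n / 2)
     = (\<integral>\<^sup>+x. \<integral>\<^sup>+y. indicator (E \<inter> ?B) x * indicator (?B - E) y \<partial>lborel \<partial>lborel)"
    by (simp add: nn_integral_cmult nn_integral_multc e1 e2)
  also have "\<dots> \<le> (\<integral>\<^sup>+x. \<integral>\<^sup>+y. ennreal \<bar>indicator E y - indicator E x\<bar> * indicator ?B x * indicator ?B y \<partial>lborel \<partial>lborel)"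
    by (intro nn_integral_mono) (auto split: split_indicator)
  also have "\<dots> \<le> ennreal (real N ^ (?n + 1)) * (\<integral>\<^sup>+h. ball_variation ?B (indicator E) h * indicator (ball 0 (2 * r / real N)) h \<partial>lborel)"
    by (rule nonlocal_Poincare) (use N in auto)
  also have "\<dots> \<le> ennreal ((3 * r * real k) ^ (?n + 1)) * ?W"
  proof (intro mult_mono ennreal_leI power_mono nn_integral_mono mult_left_mono)
    show "indicator (ball 0 (2 * r / real N)) h \<le> (indicator (ball 0 (1 / real k)) h :: ennreal)" for h :: 'a
      using subsetD[OF sub, of h] by (cases "h \<in> ball 0 (2 * r / real N)") (simp_all del: mem_ball)
  qed (use N in auto)
  finally have main: "ennreal (?\<omega> * r ^ ?n / 2) * ennreal (?\<omega> * r ^ ?n / 2) \<le> ennreal ((3 * r * real k) ^ (?n + 1)) * ?W" .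
  \<comment> \<open>Chosen so that \<open>c\<close> times the squared half volume is
    \<open>r ^ (n - 1)\<close>.\<close>
  define c where "c = 4 / (?\<omega>\<^sup>2 * r ^ (?n + 1))"
  have \<omega>: "?\<omega> > 0" by simp
  then have \<omega>0: "?\<omega> \<noteq> 0" by (rule less_imp_neq[symmetric])
  have c: "c > 0" unfolding c_def using r \<omega> by (intro divide_pos_pos mult_pos_pos zero_less_power) auto
  have n: "?n = Suc (?n - 1)" using DIM_positive[where 'a='a] by simp
  have "c * (?\<omega> * r ^ ?n / 2 * (?\<omega> * r ^ ?n / 2)) = r ^ ?n * r ^ ?n / r ^ (?n + 1)"
    using r \<omega>0 by (simp add: c_def power2_eq_square)
  also have "\<dots> = r ^ (?n - 1)"
  proof -
    obtain m where "?n = Suc m" using n by blast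
    then show ?thesis using r by simp
  qed
  finally have "ennreal (r ^ (?n - 1)) = ennreal c * (ennreal (?\<omega> * r ^ ?n / 2) * ennreal (?\<omega> * r ^ ?n / 2))"
    using c r by (simp flip: ennreal_mult')
  also have "\<dots> \<le> ennreal c * (ennreal ((3 * r * real k) ^ (?n + 1)) * ?W)"
    by (intro mult_left_mono main) simp
  also have "\<dots> = ennreal (c * (3 * r * real k) ^ (?n + 1)) * ?W"
    using c r by (simp add: ennreal_mult' mult.assoc)
  also have "c * (3 * r * real k) ^ (?n + 1) = 4 * 3 ^ (?n + 1) / ?\<omega>\<^sup>2 * real k ^ (?n + 1)"
    using r by (simp add: c_def power_mult_distrib)
  also have "ennreal (4 * 3 ^ (?n + 1) / ?\<omega>\<^sup>2 * real k ^ (?n + 1)) * ?W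
      = ennreal (4 * 3 ^ (?n + 1) / ?\<omega>\<^sup>2) * (ennreal (real k ^ (?n + 1)) * ?W)"
    by (subst ennreal_mult) (auto simp only: mult.assoc zero_le_power2 zero_le_power of_nat_0_le_iff intro!: divide_nonneg_nonneg mult_nonneg_nonneg)
  finally show ?thesis .
qed

text \<open>Disjoint balls use disjoint sets of base points, so at one scale their contributions add
  up to at most the nonlocal variation. Finiteness of \<open>I\<close> yields a single threshold for
  \<open>k\<close> that serves all balls.\<close>

lemma half_density_balls_sum_le:
  fixes E \<Omega> :: "'a::euclidean_space set" and z :: "'i \<Rightarrow> 'a"
  assumes [measurable]: "E \<in> sets borel" and \<Omega>: "- \<Omega> \<noteq> {}" and I: "finite I"
    and r: "\<And>i. i \<in> I \<Longrightarrow> 0 < r i" and sub: "\<And>i. i \<in> I \<Longrightarrow> ball (z i) (4 * r i) \<subseteq> \<Omega>"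
    and disj: "disjoint_family_on (\<lambda>i. ball (z i) (r i)) I"
    and half: "\<And>i. i \<in> I \<Longrightarrow> measure lborel (E \<inter> ball (z i) (r i)) = measure lborel (ball (z i) (r i)) / 2"
  shows "ennreal (\<Sum>i\<in>I. r i ^ (DIM('a) - 1)) \<le>
    ennreal (4 * 3 ^ (DIM('a) + 1) / (unit_ball_vol DIM('a))\<^sup>2) * perimeter_density \<Omega> E"
proof -
  let ?c = "4 * 3 ^ (DIM('a) + 1) / (unit_ball_vol DIM('a))\<^sup>2 :: real"
  let ?V = "\<lambda>k. nonlocal_variation (Suc k) (inner_part \<Omega> (Suc k)) (indicator E)"
  have ev: "\<forall>\<^sub>F k in sequentially. \<forall>i\<in>I. 1 \<le> r i * real (Suc k)"
  proof (rule eventually_ball_finite[OF I], rule ballI)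
    fix i assume "i \<in> I"
    then have "filterlim (\<lambda>k. r i * real (Suc k)) at_top sequentially"
      using r by (intro filterlim_tendsto_pos_mult_at_top[OF tendsto_const])
        (auto simp: filterlim_sequentially_Suc[of real] filterlim_real_sequentially simp del: of_nat_Suc)
    then show "\<forall>\<^sub>F k in sequentially. 1 \<le> r i * real (Suc k)" by (simp add: filterlim_at_top)
  qed
  have *: "ennreal (\<Sum>i\<in>I. r i ^ (DIM('a) - 1)) \<le> ennreal ?c * ?V k" if k: "\<forall>i\<in>I. 1 \<le> r i * real (Suc k)" for k
  proof -
    let ?K = "ennreal (real (Suc k) ^ (DIM('a) + 1))"
    have inn: "ball (z i) (r i) \<subseteq> inner_part \<Omega> (Suc k)" if i: "i \<in> I" for i
    proof
      fix y assume y: "y \<in> ball (z i) (r i)"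
      \<comment> \<open>A point of the small ball is at distance at least
        \<open>4 * r i - r i\<close> from the complement, while the scale \<open>1 / (k + 1)\<close>
        is at most \<open>r i\<close>.\<close>
      have "3 * r i \<le> infdist y (- \<Omega>)"
      proof (subst infdist_notempty[OF \<Omega>], intro cINF_greatest \<Omega>)
        fix w assume "w \<in> - \<Omega>"
        then have "4 * r i \<le> dist (z i) w" using sub[OF i] by (auto simp: not_less[symmetric])
        moreover have "dist (z i) y < r i" using y by simp
        ultimately show "3 * r i \<le> dist y w" by metric
      qed
      moreover have "1 / real (Suc k) < 3 * r i" 
      proof -
        have "1 / real (Suc k) \<le> r i" using k i by (simp add: divide_le_eq)
        then show ?thesis using r[OF i] by linarith
      qed
      ultimately show "y \<in> inner_part \<Omega> (Suc k)" by (simp add: inner_part_def)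
    qed
    have "ennreal (\<Sum>i\<in>I. r i ^ (DIM('a) - 1)) = (\<Sum>i\<in>I. ennreal (r i ^ (DIM('a) - 1)))"
      by (rule sum_ennreal[symmetric]) (use r in \<open>auto intro!: zero_le_power less_imp_le\<close>)
    also have "\<dots> \<le> (\<Sum>i\<in>I. ennreal ?c * (?K * (\<integral>\<^sup>+h. ball_variation (ball (z i) (r i)) (indicator E) h * indicator (ball 0 (1 / real (Suc k))) h \<partial>lborel)))"
      using r half k by (intro sum_mono half_density_ball_radius_le) auto
    also have "\<dots> = ennreal ?c * (?K * (\<integral>\<^sup>+h. (\<Sum>i\<in>I. ball_variation (ball (z i) (r i)) (indicator E) h * indicator (ball 0 (1 / real (Suc k))) h) \<partial>lborel))"
      by (subst nn_integral_sum, measurable) (simp only: sum_distrib_left)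
    also have "\<dots> \<le> ennreal ?c * ?V k"
      unfolding nonlocal_variation_def
    proof (intro mult_left_mono nn_integral_mono)
      fix h :: 'a
      have "(\<Sum>i\<in>I. ball_variation (ball (z i) (r i)) (indicator E) h)
         \<le> (\<Sum>i\<in>I. \<integral>\<^sup>+x. ennreal \<bar>indicator E (x + h) - indicator E x\<bar> * indicator (ball (z i) (r i)) x \<partial>lborel)"
        unfolding ball_variation_def by (intro sum_mono nn_integral_mono) (auto split: split_indicator)
      also have "\<dots> = (\<integral>\<^sup>+x. ennreal \<bar>indicator E (x + h) - indicator E x\<bar> * (\<Sum>i\<in>I. indicator (ball (z i) (r i)) x) \<partial>lborel)"
        by (subst nn_integral_sum[symmetric]) (auto simp: sum_distrib_left)
      also have "\<dots> \<le> (\<integral>\<^sup>+x. ennreal \<bar>indicator E (x + h) - indicator E x\<bar> * indicator (inner_part \<Omega> (Suc k)) x \<partial>lborel)"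
      proof (intro nn_integral_mono mult_left_mono)
        fix x
        have "(\<Sum>i\<in>I. indicator (ball (z i) (r i)) x) = (indicator (\<Union>i\<in>I. ball (z i) (r i)) x :: ennreal)"
          by (rule indicator_UN_disjoint[OF I disj, symmetric])
        also have "\<dots> \<le> indicator (inner_part \<Omega> (Suc k)) x"
          using subsetD[OF UN_least[of I "\<lambda>i. ball (z i) (r i)", OF inn], of x]
          by (cases "x \<in> (\<Union>i\<in>I. ball (z i) (r i))") (simp_all del: mem_ball UN_iff)
        finally show "(\<Sum>i\<in>I. indicator (ball (z i) (r i)) x) \<le> (indicator (inner_part \<Omega> (Suc k)) x :: ennreal)" .
      qed simp
      finally show "(\<Sum>i\<in>I. ball_variation (ball (z i) (r i)) (indicator E) h * indicator (ball 0 (1 / real (Suc k))) h)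
        \<le> (\<integral>\<^sup>+x. ennreal \<bar>indicator E (x + h) - indicator E x\<bar> * indicator (inner_part \<Omega> (Suc k)) x \<partial>lborel) * indicator (ball 0 (1 / real (Suc k))) h"
        unfolding sum_distrib_right[symmetric] by (rule mult_right_mono) simp
    qed simp_all
    finally show ?thesis .
  qed
  have inv: "1 / y * y = 1 \<and> y * (1 / y) = 1" if "y > 0" for y :: real using that by simp
  have c: "?c > 0" by (intro divide_pos_pos mult_pos_pos zero_less_power unit_ball_vol_pos) auto
  \<comment> \<open>Dividing by the constant isolates the term that depends on the scale, so that a
    bound for all large \<open>k\<close> passes to the liminf.\<close>
  have "ennreal (1 / ?c) * ennreal (\<Sum>i\<in>I. r i ^ (DIM('a) - 1)) \<le> ?V k" if "\<forall>i\<in>I. 1 \<le> r i * real (Suc k)" for k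
  proof -
    have "ennreal (1 / ?c) * ennreal (\<Sum>i\<in>I. r i ^ (DIM('a) - 1)) \<le> ennreal (1 / ?c) * (ennreal ?c * ?V k)"
      by (intro mult_left_mono *) (use that in auto)
    also have "\<dots> = ennreal (1 / ?c * ?c) * ?V k"
      using c by (subst ennreal_mult) (auto simp: mult.assoc)
    also have "1 / ?c * ?c = 1" using inv[OF c] by blast
    finally show ?thesis by simp
  qed
  then have "ennreal (1 / ?c) * ennreal (\<Sum>i\<in>I. r i ^ (DIM('a) - 1)) \<le> perimeter_density \<Omega> E"
    unfolding perimeter_density_def by (intro Liminf_bounded eventually_mono[OF ev]) auto
  then have "ennreal ?c * (ennreal (1 / ?c) * ennreal (\<Sum>i\<in>I. r i ^ (DIM('a) - 1))) \<le> ennreal ?c * perimeter_density \<Omega> E"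
    by (rule mult_left_mono) simp
  also have "ennreal ?c * (ennreal (1 / ?c) * ennreal (\<Sum>i\<in>I. r i ^ (DIM('a) - 1))) = ennreal (?c * (1 / ?c)) * ennreal (\<Sum>i\<in>I. r i ^ (DIM('a) - 1))"
    using c by (subst ennreal_mult) (auto simp: mult.assoc)
  also have "?c * (1 / ?c) = 1" using inv[OF c] by blast
  finally show ?thesis by simp
qed

section \<open>Balls of half density and covering of superlevel sets\<close>

text \<open>A point of the second ball outside the first lies in the shell between the radii
  \<open>r\<close> and \<open>max r (r' + dist z z')\<close> around \<open>z\<close>, and the volume
  of this shell bounds the gain.\<close>

lemma measure_Int_ball_diff_le:
  fixes E :: "'a::euclidean_space set"
  assumes [measurable]: "E \<in> sets borel" and r: "0 \<le> r"
  shows "measure lborel (E \<inter> ball z' r') \<le> measure lborel (E \<inter> ball z r)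
    + unit_ball_vol DIM('a) * ((max r (r' + dist z z')) ^ DIM('a) - r ^ DIM('a))"
proof -
  define R where "R = max r (r' + dist z z')"
  have R: "r \<le> R" "0 \<le> R" using r by (auto simp: R_def)
  have fin: "emeasure lborel (ball z R) < \<infinity>" by (rule emeasure_lborel_ball_finite)
  have sub: "ball z r \<subseteq> ball z R" using R by (intro subset_ball)
  have f1: "E \<inter> ball z r \<in> fmeasurable lborel" and f2: "ball z R - ball z r \<in> fmeasurable lborel"
    by (rule fmeasurableI2[of "ball z R"]; use sub fin in \<open>auto simp: fmeasurable_def\<close>)+
  have "measure lborel (E \<inter> ball z' r') \<le> measure lborel ((E \<inter> ball z r) \<union> (ball z R - ball z r))"
  proof (rule measure_mono_fmeasurable)
    have "dist z y < R" if "dist z' y < r'" for y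
    proof -
      have "dist z y < r' + dist z z'" using that by metric
      then show ?thesis by (simp add: R_def)
    qed
    then show "E \<inter> ball z' r' \<subseteq> (E \<inter> ball z r) \<union> (ball z R - ball z r)" by auto
  qed (use f1 f2 in auto)
  also have "\<dots> \<le> measure lborel (E \<inter> ball z r) + measure lborel (ball z R - ball z r)"
    using f1 f2 by (intro measure_Un_le) auto
  also have "measure lborel (ball z R - ball z r) = measure lborel (ball z R) - measure lborel (ball z r)"
    using fin sub by (intro measure_Diff) auto
  also have "\<dots> = unit_ball_vol DIM('a) * (R ^ DIM('a) - r ^ DIM('a))"
    using r R by (simp add: content_ball right_diff_distrib)
  finally show ?thesis by (simp add: R_def)
qed

text \<open>The shell estimate used in both directions bounds the change by \<open>G\<close>, which
  tends to 0 as centres and radii converge.\<close>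

lemma continuous_on_measure_Int_ball:
  fixes E :: "'a::euclidean_space set" and c :: "'b::t2_space \<Rightarrow> 'a"
  assumes E: "E \<in> sets borel" and c: "continuous_on S c" and \<rho>: "continuous_on S \<rho>"
    and pos: "\<And>t. t \<in> S \<Longrightarrow> 0 \<le> \<rho> t"
  shows "continuous_on S (\<lambda>t. measure lborel (E \<inter> ball (c t) (\<rho> t)))"
  unfolding continuous_on_def
proof
  fix a assume a: "a \<in> S"
  let ?F = "at a within S"
  let ?\<omega> = "unit_ball_vol DIM('a)"
  have c': "(c \<longlongrightarrow> c a) ?F" and \<rho>': "(\<rho> \<longlongrightarrow> \<rho> a) ?F" using c \<rho> a by (auto simp: continuous_on_def)
  define G where "G t = ?\<omega> * ((max (\<rho> a) (\<rho> t + dist (c a) (c t))) ^ DIM('a) - \<rho> a ^ DIM('a))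
    + ?\<omega> * ((max (\<rho> t) (\<rho> a + dist (c t) (c a))) ^ DIM('a) - \<rho> t ^ DIM('a))" for t
  have G: "(G \<longlongrightarrow> ?\<omega> * ((max (\<rho> a) (\<rho> a + dist (c a) (c a))) ^ DIM('a) - \<rho> a ^ DIM('a))
    + ?\<omega> * ((max (\<rho> a) (\<rho> a + dist (c a) (c a))) ^ DIM('a) - \<rho> a ^ DIM('a))) ?F"
    unfolding G_def by (intro tendsto_intros c' \<rho>')
  then have G0: "(G \<longlongrightarrow> 0) ?F" by simp
  have "\<forall>\<^sub>F t in ?F. norm (measure lborel (E \<inter> ball (c t) (\<rho> t)) - measure lborel (E \<inter> ball (c a) (\<rho> a))) \<le> G t"
    unfolding eventually_at_filter
  proof (intro always_eventually allI impI)
    fix t assume t: "t \<in> S"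
    have "0 \<le> ?\<omega> * ((max (\<rho> a) (\<rho> t + dist (c a) (c t))) ^ DIM('a) - \<rho> a ^ DIM('a))"
      "0 \<le> ?\<omega> * ((max (\<rho> t) (\<rho> a + dist (c t) (c a))) ^ DIM('a) - \<rho> t ^ DIM('a))"
      using pos[OF a] pos[OF t] by (auto intro!: mult_nonneg_nonneg power_mono)
    then show "norm (measure lborel (E \<inter> ball (c t) (\<rho> t)) - measure lborel (E \<inter> ball (c a) (\<rho> a))) \<le> G t"
      using measure_Int_ball_diff_le[OF E pos[OF a], of "c t" "\<rho> t" "c a"]
        measure_Int_ball_diff_le[OF E pos[OF t], of "c a" "\<rho> a" "c t"]
      unfolding G_def by (simp only: real_norm_def)
  qed
  from Lim_null_comparison[OF this G0]
  show "((\<lambda>t. measure lborel (E \<inter> ball (c t) (\<rho> t))) \<longlongrightarrow> measure lborel (E \<inter> ball (c a) (\<rho> a))) ?F"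
    by (simp add: LIM_zero_cancel)
qed

text \<open>A connected set that meets both \<Omega> and its complement meets the frontier, but no
  frontier point is closer to \<open>z\<close> than the radius.\<close>

lemma ball_infdist_frontier_subset:
  fixes \<Omega> :: "'a::euclidean_space set"
  assumes "z \<in> \<Omega>"
  shows "ball z (infdist z (frontier \<Omega>)) \<subseteq> \<Omega>"
proof (rule ccontr)
  let ?B = "ball z (infdist z (frontier \<Omega>))"
  assume "\<not> ?thesis"
  then obtain y where y: "y \<in> ?B" "y \<notin> \<Omega>" by blast
  have "z \<in> ?B" using y(1) zero_le_dist[of z y] by (auto simp del: zero_le_dist)
  then have "?B \<inter> frontier \<Omega> \<noteq> {}"
    using y assms by (intro connected_Int_frontier connected_ball) blast+
  then obtain w where "w \<in> frontier \<Omega>" "dist z w < infdist z (frontier \<Omega>)" by auto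
  then show False using infdist_le[of w "frontier \<Omega>" z] by simp
qed

text \<open>Only arbitrarily small radii are demanded, not a limit of densities. This supplies the
  starting radius of the intermediate value argument; it holds almost everywhere in
  \<open>E\<close>, and for \<open>{t < f}\<close> at each Lebesgue point with value above
  \<open>t\<close>.\<close>

definition half_dense_at :: "'a::euclidean_space set \<Rightarrow> 'a \<Rightarrow> bool" where
  "half_dense_at E x \<longleftrightarrow> (\<forall>e>0. \<exists>r. 0 < r \<and> r < e \<and> measure lborel (ball x r) / 2 \<le> measure lborel (E \<inter> ball x r))"

text \<open>The intermediate value theorem replaces the usual chain of balls: the density of \<open>E\<close> varies continuously
  along the balls centred at \<open>x\<close> of growing radius, followed by the balls of radius \<open>d/4\<close> along the John curve.\<close>

lemma half_density_ball_exists: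
  fixes E \<Omega> :: "'a::euclidean_space set"
  assumes J: "distance_John_domain s C x\<^sub>J \<Omega>" and x: "x \<in> \<Omega>" and E: "E \<in> sets borel"
    and small: "measure lborel (E \<inter> ball x\<^sub>J (infdist x\<^sub>J (frontier \<Omega>) / 4))
      \<le> measure lborel (ball x\<^sub>J (infdist x\<^sub>J (frontier \<Omega>) / 4)) / 2"
    and dens: "half_dense_at E x"
  shows "\<exists>z r. 0 < r \<and> ball z (4 * r) \<subseteq> \<Omega> \<and> norm (z - x) powr s \<le> 4 * C * r \<and>
    measure lborel (E \<inter> ball z r) = measure lborel (ball z r) / 2"
proof -
  let ?d = "\<lambda>y. infdist y (frontier \<Omega>)"
  \<comment> \<open>Writing the volume of the ball with \<open>UNIV \<inter>\<close> makes it an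
    instance of \<open>continuous_on_measure_Int_ball\<close>.\<close>
  define \<theta> where "\<theta> z r = measure lborel (E \<inter> ball z r) - measure lborel (UNIV \<inter> ball z r) / 2" for z r
  have cont: "continuous_on S (\<lambda>t. \<theta> (c t) (\<rho> t))"
    if "continuous_on S c" "continuous_on S \<rho>" "\<And>t. t \<in> S \<Longrightarrow> 0 \<le> \<rho> t" for S :: "real set" and c \<rho>
    unfolding \<theta>_def using that E by (intro continuous_intros continuous_on_measure_Int_ball) auto
  have CJ: "C \<ge> 1" "s \<ge> 1" using J by (auto simp: distance_John_domain_def)
  obtain \<gamma> where \<gamma>: "path \<gamma>" "path_image \<gamma> \<subseteq> \<Omega>" "\<gamma> 0 = x" "\<gamma> 1 = x\<^sub>J"
    and John: "\<And>t. t \<in> {0..1} \<Longrightarrow> norm (\<gamma> t - x) powr s < C * ?d (\<gamma> t)"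
    using J x unfolding distance_John_domain_def rectifiable_path_def pathstart_def pathfinish_def by blast
  have dpos: "0 < ?d (\<gamma> t)" if "t \<in> {0..1}" for t
  proof -
    have "0 < C * ?d (\<gamma> t)" using John[OF that] powr_ge_zero[of "norm (\<gamma> t - x)" s] by linarith
    then show ?thesis using CJ by (simp add: zero_less_mult_iff)
  qed
  have in\<Omega>: "\<gamma> t \<in> \<Omega>" if "t \<in> {0..1}" for t using \<gamma>(2) that by (auto simp: path_image_def)
  have dx: "0 < ?d x" using dpos[of 0] \<gamma> by simp
  obtain r0 where r0: "0 < r0" "r0 < ?d x / 4" "0 \<le> \<theta> x r0"
    using dens[unfolded half_dense_at_def, rule_format, of "?d x / 4"] dx by (auto simp: \<theta>_def)
  have sub: "ball z (4 * r) \<subseteq> \<Omega>" if "z \<in> \<Omega>" "r \<le> ?d z / 4" for z r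
    using subset_ball[of "4 * r" "?d z" z] ball_infdist_frontier_subset[OF that(1)] that(2) by auto
  show ?thesis
  proof (cases "\<theta> x (?d x / 4) \<le> 0")
    case True
    have "continuous_on {r0..?d x / 4} (\<lambda>r. \<theta> x r)"
      using r0 by (intro cont continuous_intros) auto
    from IVT2'[of "\<lambda>r. \<theta> x r", OF True r0(3) less_imp_le[OF r0(2)] this]
    obtain r where r: "r0 \<le> r" "r \<le> ?d x / 4" "\<theta> x r = 0" by auto
    \<comment> \<open>Here the centre is \<open>x\<close> itself, and \<open>0 powr s\<close> is
      0.\<close>
    have "norm (x - x) powr s \<le> 4 * C * r" using r r0 CJ by simp
    moreover have "ball x (4 * r) \<subseteq> \<Omega>" using r x by (intro sub) auto
    ultimately show ?thesis using r r0 by (intro exI[of _ x] exI[of _ r]) (auto simp: \<theta>_def)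
  next
    case False
    have c: "continuous_on {0..1} (\<lambda>t. \<theta> (\<gamma> t) (?d (\<gamma> t) / 4))"
      using \<gamma>(1) by (intro cont continuous_intros) (auto simp: path_def infdist_nonneg)
    have "\<theta> (\<gamma> 1) (?d (\<gamma> 1) / 4) \<le> 0" using small \<gamma> by (simp add: \<theta>_def)
    moreover have "0 \<le> \<theta> (\<gamma> 0) (?d (\<gamma> 0) / 4)" using False \<gamma> by simp
    ultimately obtain t where t: "t \<in> {0..1}" "\<theta> (\<gamma> t) (?d (\<gamma> t) / 4) = 0"
      using IVT2'[of "\<lambda>t. \<theta> (\<gamma> t) (?d (\<gamma> t) / 4)" 1 0 0] c by auto
    \<comment> \<open>The John bound involves the full distance to the frontier and the radius is a
      quarter of it, hence the factor 4.\<close>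
    have "norm (\<gamma> t - x) powr s \<le> 4 * C * (?d (\<gamma> t) / 4)" using John[OF t(1)] by simp
    moreover have "ball (\<gamma> t) (4 * (?d (\<gamma> t) / 4)) \<subseteq> \<Omega>" using in\<Omega>[OF t(1)] by (intro sub) auto
    ultimately show ?thesis using t dpos[OF t(1)]
      by (intro exI[of _ "\<gamma> t"] exI[of _ "?d (\<gamma> t) / 4"]) (auto simp: \<theta>_def)
  qed
qed

text \<open>Each summand is \<open>a i * a i powr (q - 1)\<close>, and the second factor is at most
  the total to the power \<open>q - 1\<close>.\<close>

lemma sum_powr_le_powr_sum:
  fixes a :: "'i \<Rightarrow> real"
  assumes "finite F" "\<And>i. i \<in> F \<Longrightarrow> 0 \<le> a i" "1 \<le> q"
  shows "(\<Sum>i\<in>F. a i powr q) \<le> (\<Sum>i\<in>F. a i) powr q"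
proof -
  let ?S = "\<Sum>i\<in>F. a i"
  have powr: "b powr q = b * b powr (q - 1)" if "b \<ge> 0" for b :: real
    using that powr_mult_base[of b "q - 1"] by simp
  have "(\<Sum>i\<in>F. a i powr q) = (\<Sum>i\<in>F. a i * a i powr (q - 1))"
    using assms powr by (intro sum.cong) auto
  also have "\<dots> \<le> (\<Sum>i\<in>F. a i * ?S powr (q - 1))"
    using assms by (intro sum_mono mult_left_mono powr_mono2 member_le_sum) auto
  also have "\<dots> = ?S * ?S powr (q - 1)" by (simp add: sum_distrib_right)
  also have "\<dots> = ?S powr q" using assms by (intro powr[symmetric] sum_nonneg) auto
  finally show ?thesis .
qed

text \<open>Continuity from below reduces the union to finite subfamilies. The Vitali family is
  countable, whereas the perimeter bound concerns finite families of balls.\<close>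

lemma emeasure_countable_Union_le:
  assumes "countable C" "\<And>i. i \<in> C \<Longrightarrow> X i \<in> sets M"
    and "\<And>F. finite F \<Longrightarrow> F \<subseteq> C \<Longrightarrow> (\<Sum>i\<in>F. emeasure M (X i)) \<le> b"
  shows "emeasure M (\<Union>i\<in>C. X i) \<le> b"
proof (cases "C = {}")
  case False
  let ?c = "from_nat_into C"
  have rng: "range ?c = C" using False assms(1) by (rule range_from_nat_into)
  then have cC: "?c i \<in> C" for i by auto
  define W where "W N = (\<Union>i\<in>?c ` {..<N}. X i)" for N :: nat
  have W: "W N \<in> sets M" for N unfolding W_def using assms(2) cC by (intro sets.finite_UN) auto
  have "(\<Union>i\<in>C. X i) = (\<Union>N. W N)"
  proof (intro equalityI subsetI)
    fix y assume "y \<in> (\<Union>i\<in>C. X i)"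
    then obtain m where "y \<in> X (?c m)" using rng by (metis UN_E imageE)
    then have "y \<in> W (Suc m)" by (auto simp: W_def)
    then show "y \<in> (\<Union>N. W N)" by blast
  qed (use cC in \<open>auto simp: W_def\<close>)
  also have "emeasure M \<dots> = (SUP N. emeasure M (W N))"
  proof (rule SUP_emeasure_incseq[symmetric])
    show "incseq W" unfolding incseq_def W_def by (intro allI impI UN_mono image_mono) auto
  qed (use W in auto)
  also have "\<dots> \<le> b"
  proof (rule SUP_least)
    fix N
    have "emeasure M (W N) \<le> (\<Sum>i\<in>?c ` {..<N}. emeasure M (X i))"
      unfolding W_def using assms(2) cC by (intro emeasure_subadditive_finite) auto
    also have "\<dots> \<le> b" using cC by (intro assms(3)) auto
    finally show "emeasure M (W N) \<le> b" .
  qed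
  finally show ?thesis .
qed simp

lemma ball_subset_radius_le:
  fixes z :: "'a::euclidean_space"
  assumes "0 < r" "ball z (4 * r) \<subseteq> \<Omega>" "bounded \<Omega>"
  shows "r \<le> diameter \<Omega>"
proof -
  obtain b :: 'a where b: "b \<in> Basis" using nonempty_Basis by blast
  have "dist z (z + r *\<^sub>R b) = r" using b assms by (simp add: dist_norm)
  moreover have "z \<in> \<Omega>" "z + r *\<^sub>R b \<in> \<Omega>" using assms b by (auto intro!: subsetD[OF assms(2)] simp: dist_norm)
  ultimately show ?thesis using diameter_bounded_bound[OF assms(3)] by metis
qed


text \<open>The conclusion provides a Borel superset because \<open>A\<close> may fail to be
  measurable. Growth is demanded only up to the largest radius in the cover, which allows Lebesgue
  measure as an instance. In \<open>K\<close>, the summand \<open>4 * C\<close> accounts for the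
  distance from \<open>x\<close> to the centre of its half density ball, and
  \<open>max 1 (diameter \<Omega>)\<close> for the radius of that ball.\<close>

lemma level_set_cover:
  fixes E A \<Omega> :: "'a::euclidean_space set" and \<mu> :: "'a measure"
  assumes J: "distance_John_domain s C x\<^sub>J \<Omega>" and A: "A \<subseteq> \<Omega>" and E: "E \<in> sets borel"
    and small: "measure lborel (E \<inter> ball x\<^sub>J (infdist x\<^sub>J (frontier \<Omega>) / 4))
      \<le> measure lborel (ball x\<^sub>J (infdist x\<^sub>J (frontier \<Omega>) / 4)) / 2"
    and dens: "\<And>x. x \<in> A \<Longrightarrow> half_dense_at E x"
    and K: "K = 4 * C + max 1 (diameter \<Omega>)"
    and q: "1 \<le> q" "q * s * (real DIM('a) - 1) \<le> real DIM('a)"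
    and \<mu>: "sets \<mu> = sets borel" and M: "0 \<le> M"
    and growth: "\<And>x r. 0 < r \<Longrightarrow> r \<le> 5 * K * max 1 (diameter \<Omega>) \<Longrightarrow>
       emeasure \<mu> (ball x r) \<le> ennreal (M * r powr (q * s * (real DIM('a) - 1)))"
    and P: "perimeter_density \<Omega> E = ennreal P" "0 \<le> P"
  shows "\<exists>W\<in>sets borel. A \<subseteq> W \<and> emeasure \<mu> W \<le>
    ennreal (M * (5 * K) ^ DIM('a) * (4 * 3 ^ (DIM('a) + 1) / (unit_ball_vol DIM('a))\<^sup>2 * P) powr q)"
proof -
  let ?n = "DIM('a)" and ?D = "max 1 (diameter \<Omega>)"
  let ?c = "4 * 3 ^ (DIM('a) + 1) / (unit_ball_vol DIM('a))\<^sup>2 :: real"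
  have n: "1 \<le> ?n" by (simp add: Suc_leI)
  have CJ: "C \<ge> 1" "s \<ge> 1" and bd: "bounded \<Omega>" using J by (auto simp: distance_John_domain_def bounded_domain_def)
  have K1: "K \<ge> 1" using CJ K by simp
  \<comment> \<open>\<open>infdist\<close> to the empty set is 0, so \<open>inner_part\<close> would
    be empty if \<Omega> were the whole space.\<close>
  have nonfull: "- \<Omega> \<noteq> {}" using bd not_bounded_UNIV by (metis Compl_UNIV_eq double_complement)
  have "\<forall>x\<in>A. \<exists>z r. 0 < r \<and> ball z (4 * r) \<subseteq> \<Omega> \<and> norm (z - x) powr s \<le> 4 * C * r \<and>
    measure lborel (E \<inter> ball z r) = measure lborel (ball z r) / 2"
    using half_density_ball_exists[OF J _ E small dens] A by blast
  from bchoice[OF this] obtain z where "\<forall>x\<in>A. \<exists>r. 0 < r \<and> ball (z x) (4 * r) \<subseteq> \<Omega> \<and>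
    norm (z x - x) powr s \<le> 4 * C * r \<and> measure lborel (E \<inter> ball (z x) r) = measure lborel (ball (z x) r) / 2" ..
  from bchoice[OF this] obtain r where zr: "\<forall>x\<in>A. 0 < r x \<and> ball (z x) (4 * r x) \<subseteq> \<Omega> \<and>
    norm (z x - x) powr s \<le> 4 * C * r x \<and>
    measure lborel (E \<inter> ball (z x) (r x)) = measure lborel (ball (z x) (r x)) / 2" ..
  then have r: "0 < r x" and sub: "ball (z x) (4 * r x) \<subseteq> \<Omega>" and near: "norm (z x - x) powr s \<le> 4 * C * r x"
    and half: "measure lborel (E \<inter> ball (z x) (r x)) = measure lborel (ball (z x) (r x)) / 2" if "x \<in> A" for x
    using that by blast+
  have rD: "r x \<le> ?D" if "x \<in> A" for x
    using ball_subset_radius_le[OF r[OF that] sub[OF that] bd] by simp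
  define R where "R x = K * r x powr (1/s)" for x
  have R0: "0 < R x" if "x \<in> A" for x using r[OF that] K1 by (simp add: R_def)
  have rpD: "r x powr (1/s) \<le> ?D" if "x \<in> A" for x
  proof -
    have "r x powr (1/s) \<le> ?D powr (1/s)" using r[OF that] rD[OF that] CJ by (intro powr_mono2) auto
    also have "\<dots> \<le> ?D powr 1" using CJ by (intro powr_mono) auto
    finally show ?thesis by simp
  qed
  have RD: "R x \<le> K * ?D" if "x \<in> A" for x using rpD[OF that] K1 by (simp add: R_def)
  \<comment> \<open>The radius is bounded by \<open>?D\<close> and \<open>1 - 1/s\<close> lies in
    \<open>[0, 1)\<close>, so the surplus power of \<open>r x\<close> over the root is at most
    \<open>?D\<close>.\<close>
  have rr: "r x \<le> ?D * r x powr (1/s)" if "x \<in> A" for x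
  proof -
    have "r x = r x powr (1 - 1/s) * r x powr (1/s)" using r[OF that] by (simp flip: powr_add)
    also have "\<dots> \<le> ?D powr (1 - 1/s) * r x powr (1/s)"
      using r[OF that] rD[OF that] CJ by (intro mult_right_mono powr_mono2) auto
    also have "\<dots> \<le> ?D powr 1 * r x powr (1/s)" using CJ by (intro mult_right_mono powr_mono) auto
    finally show ?thesis by simp
  qed
  have ballsub: "ball (z x) (r x) \<subseteq> ball x (R x)" if x: "x \<in> A" for x
  proof -
    have "norm (z x - x) = (norm (z x - x) powr s) powr (1/s)" using CJ by (simp add: powr_powr)
    also have "\<dots> \<le> (4 * C * r x) powr (1/s)" using near[OF x] CJ by (intro powr_mono2) auto
    also have "\<dots> = (4 * C) powr (1/s) * r x powr (1/s)" using r[OF x] CJ by (simp add: powr_mult)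
    also have "\<dots> \<le> (4 * C) powr 1 * r x powr (1/s)" using CJ by (intro mult_right_mono powr_mono) auto
    finally have "norm (z x - x) + r x \<le> 4 * C * r x powr (1/s) + ?D * r x powr (1/s)" using rr[OF x] CJ by simp
    also have "\<dots> = R x" by (simp add: R_def K distrib_right)
    finally have le: "norm (z x - x) + r x \<le> R x" .
    show ?thesis
    proof
      fix y assume "y \<in> ball (z x) (r x)"
      then have "dist (z x) y < r x" by simp
      moreover have "dist (z x) x = norm (z x - x)" by (simp add: dist_norm)
      ultimately have "dist x y < R x" using le dist_triangle[of x y "z x"] by (simp add: dist_commute)
      then show "y \<in> ball x (R x)" by simp
    qed
  qed
  have Acov: "A \<subseteq> (\<Union>x\<in>A. ball x (R x))" using R0 by force
  \<comment> \<open>The balls \<open>ball (z x) (r x)\<close> inherit disjointness from the selected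
    balls \<open>ball x (R x)\<close>, while the fivefold balls cover \<open>A\<close>.\<close>
  obtain I where I: "countable I" "I \<subseteq> A" "pairwise (\<lambda>i j. disjnt (ball i (R i)) (ball j (R j))) I"
    "A \<subseteq> (\<Union>i\<in>I. ball i (5 * R i))"
    by (rule Vitali_covering_lemma_balls[where a = "\<lambda>x. x" and B = "K * ?D", OF Acov]) (use R0 RD in auto)
  define W where "W = (\<Union>i\<in>I. ball i (5 * R i))"
  have "emeasure \<mu> W \<le> ennreal (M * (5 * K) ^ ?n * (?c * P) powr q)"
    unfolding W_def
  proof (rule emeasure_countable_Union_le[OF I(1)])
    show "ball i (5 * R i) \<in> sets \<mu>" for i by (simp add: \<mu>)
    fix F assume F: "finite F" "F \<subseteq> I"
    then have FA: "x \<in> A" if "x \<in> F" for x using that I by auto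
    have dis: "disjoint_family_on (\<lambda>i. ball (z i) (r i)) F"
      unfolding disjoint_family_on_def
    proof (intro ballI impI)
      fix i j assume "i \<in> F" "j \<in> F" "i \<noteq> j"
      then have "ball i (R i) \<inter> ball j (R j) = {}"
        using I(3) F by (auto simp: pairwise_def disjnt_def)
      then show "ball (z i) (r i) \<inter> ball (z j) (r j) = {}"
        using ballsub[OF FA[OF \<open>i \<in> F\<close>]] ballsub[OF FA[OF \<open>j \<in> F\<close>]] by blast
    qed
    have "ennreal (\<Sum>i\<in>F. r i ^ (?n - 1)) \<le> ennreal ?c * perimeter_density \<Omega> E"
      by (rule half_density_balls_sum_le[OF E nonfull F(1) _ _ dis]) (use r sub half FA in auto)
    also have "\<dots> = ennreal (?c * P)" unfolding P(1) using P(2) by (subst ennreal_mult) auto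
    finally have "ennreal (\<Sum>i\<in>F. r i ^ (?n - 1)) \<le> ennreal (?c * P)" .
    then have S: "(\<Sum>i\<in>F. r i ^ (?n - 1)) \<le> ?c * P"
      by (subst (asm) ennreal_le_iff) (use P(2) in \<open>auto intro!: mult_nonneg_nonneg divide_nonneg_nonneg\<close>)
    have one: "emeasure \<mu> (ball x (5 * R x)) \<le> ennreal (M * (5 * K) ^ ?n * (r x ^ (?n - 1)) powr q)" if "x \<in> F" for x
    proof -
      note x = FA[OF that]
      let ?e = "q * s * (real ?n - 1)"
      have "emeasure \<mu> (ball x (5 * R x)) \<le> ennreal (M * (5 * R x) powr ?e)"
        using R0[OF x] RD[OF x] by (intro growth) auto
      also have "(5 * R x) powr ?e = (5 * K) powr ?e * (r x powr (1/s)) powr ?e"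
        using r[OF x] K1 unfolding R_def by (subst powr_mult[symmetric]) (auto simp: mult.assoc)
      \<comment> \<open>The factor \<open>s\<close> in the exponent cancels the root in the
        radius.\<close>
      also have "(r x powr (1/s)) powr ?e = r x powr (q * (real ?n - 1))"
        using CJ by (simp add: powr_powr)
      also have "\<dots> = (r x ^ (?n - 1)) powr q"
        using r[OF x] n by (simp add: powr_realpow[symmetric] powr_powr mult.commute of_nat_diff)
      \<comment> \<open>The base is at least 1 and the exponent at most \<open>n\<close>, so this
        factor becomes free of \<open>q\<close>.\<close>
      also have "ennreal (M * ((5 * K) powr ?e * (r x ^ (?n - 1)) powr q)) \<le> ennreal (M * ((5 * K) powr real ?n * (r x ^ (?n - 1)) powr q))"
        using q K1 M by (intro ennreal_leI mult_left_mono mult_right_mono powr_mono) auto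
      finally show ?thesis using K1 by (simp add: powr_realpow mult.assoc)
    qed
    have "(\<Sum>i\<in>F. emeasure \<mu> (ball i (5 * R i))) \<le> (\<Sum>i\<in>F. ennreal (M * (5 * K) ^ ?n * (r i ^ (?n - 1)) powr q))"
      by (intro sum_mono one)
    also have "\<dots> = ennreal (M * (5 * K) ^ ?n * (\<Sum>i\<in>F. (r i ^ (?n - 1)) powr q))"
      using M K1 by (subst sum_ennreal) (auto simp: sum_distrib_left)
    also have "\<dots> \<le> ennreal (M * (5 * K) ^ ?n * (?c * P) powr q)"
    proof (intro ennreal_leI mult_left_mono)
      have "(\<Sum>i\<in>F. (r i ^ (?n - 1)) powr q) \<le> (\<Sum>i\<in>F. r i ^ (?n - 1)) powr q"
        using r FA q by (intro sum_powr_le_powr_sum F) (auto intro!: zero_le_power less_imp_le)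
      also have "\<dots> \<le> (?c * P) powr q"
        using S q r FA by (intro powr_mono2 sum_nonneg) (auto intro!: zero_le_power less_imp_le)
      finally show "(\<Sum>i\<in>F. (r i ^ (?n - 1)) powr q) \<le> (?c * P) powr q" .
    qed (use M K1 in auto)
    finally show "(\<Sum>i\<in>F. emeasure \<mu> (ball i (5 * R i))) \<le> ennreal (M * (5 * K) ^ ?n * (?c * P) powr q)" .
  qed
  moreover have "W \<in> sets borel" unfolding W_def by (intro borel_open open_UN) auto
  ultimately show ?thesis using I(4) W_def by blast
qed

text \<open>A weak density theorem. On \<open>S m\<close> every ball of small radius has density at
  most one half. Vitali's theorem covers almost all of \<open>S m\<close> by disjoint such balls
  inside an open set of nearly the same measure, so its measure is at most half of itself plus an
  arbitrarily small amount.\<close>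

lemma negligible_not_half_dense:
  fixes E :: "'a::euclidean_space set"
  assumes E: "E \<in> sets borel"
  shows "negligible {x\<in>E. \<not> half_dense_at E x}"
proof -
  \<comment> \<open>The ball makes the measure finite, so that the half can be absorbed; the
    non-strict inequality makes the condition closed in \<open>x\<close> for each radius.\<close>
  define S where "S m = {x\<in>E \<inter> ball 0 (real m). \<forall>r\<in>{0<..<1 / real (Suc m)}.
     measure lborel (E \<inter> ball x r) \<le> measure lborel (ball x r) / 2}" for m :: nat
  have "negligible (S m)" for m
  proof -
    let ?e = "1 / real (Suc m)"
    have "closed {x. measure lborel (E \<inter> ball x r) \<le> measure lborel (UNIV \<inter> ball x r) / 2}" if "0 < r" for r
      using that E by (intro closed_Collect_le continuous_intros continuous_on_measure_Int_ball) auto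
    \<comment> \<open>The intersection runs over uncountably many radii; closedness of each set is
      what makes \<open>S m\<close> Borel.\<close>
    then have cl: "closed (\<Inter>r\<in>{0<..<?e}. {x. measure lborel (E \<inter> ball x r) \<le> measure lborel (ball x r) / 2})"
      by (intro closed_INT) auto
    have "S m = E \<inter> ball 0 (real m) \<inter> (\<Inter>r\<in>{0<..<?e}. {x. measure lborel (E \<inter> ball x r) \<le> measure lborel (ball x r) / 2})"
      by (auto simp: S_def)
    then have Sb: "S m \<in> sets borel" using E cl by (auto intro!: borel_closed)
    have Sfin: "emeasure lborel (S m) < \<infinity>"
    proof -
      have "S m \<subseteq> ball 0 (real m)" by (auto simp: S_def)
      then have "emeasure lborel (S m) \<le> emeasure lborel (ball (0::'a) (real m))" by (intro emeasure_mono) auto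
      also have "\<dots> < \<infinity>" by (rule emeasure_lborel_ball_finite)
      finally show ?thesis .
    qed
    have le: "emeasure lborel (S m) \<le> ennreal (1/2) * (emeasure lborel (S m) + ennreal \<eta>)" if \<eta>: "0 < \<eta>" for \<eta> :: real
    proof -
      obtain V where V: "open V" "S m \<subseteq> V" "emeasure lebesgue (V - S m) < ennreal \<eta>"
        by (rule sets_lebesgue_outer_open[of "S m" \<eta>]) (use Sb \<eta> in auto)
      define K where "K = {(x, r). x \<in> S m \<and> 0 < r \<and> r < ?e \<and> ball x r \<subseteq> V}"
      have Kc: "\<exists>i. i \<in> K \<and> x \<in> ball (fst i) (snd i) \<and> snd i < d" if x: "x \<in> S m" and d: "0 < d" for x d
      proof -
        obtain e where e: "e > 0" "ball x e \<subseteq> V" using V x open_contains_ball by blast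
        obtain r where r: "0 < r" "r < min (min e d) ?e"
          using dense[of 0 "min (min e d) ?e"] e d by auto
        then have "0 < r" "r < ?e" "r < d" "r \<le> e" by auto
        moreover have "ball x r \<subseteq> V" using e(2) subset_ball[OF \<open>r \<le> e\<close>, of x] by blast
        ultimately show ?thesis using x by (intro exI[of _ "(x, r)"]) (auto simp: K_def)
      qed
      obtain I where I: "countable I" "I \<subseteq> K"
        "pairwise (\<lambda>i j. disjnt (ball (fst i) (snd i)) (ball (fst j) (snd j))) I"
        "negligible (S m - (\<Union>i\<in>I. ball (fst i) (snd i)))"
        by (rule Vitali_covering_theorem_balls[where a=fst and r=snd, OF Kc]) auto
      let ?B = "\<lambda>i::'a \<times> real. ball (fst i) (snd i)"
      have disj: "disjoint_family_on ?B I"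
        using I(3) by (auto simp: disjoint_family_on_def pairwise_def disjnt_def)
      have disjE: "disjoint_family_on (\<lambda>i. E \<inter> ?B i) I"
        using disj by (fastforce simp: disjoint_family_on_def)
      have Ub: "(\<Union>i\<in>I. ?B i) \<in> sets borel" by (intro borel_open open_UN) auto
      have "S m - (\<Union>i\<in>I. ?B i) \<in> null_sets lborel"
        using I(4) Sb Ub by (auto simp: negligible_iff_null_sets null_sets_completion_iff)
      then have "emeasure lborel (S m) = emeasure lborel (S m \<inter> (\<Union>i\<in>I. ?B i))"
        using Sb Ub emeasure_Diff_null_set[of "S m - (\<Union>i\<in>I. ?B i)" lborel "S m"] by (simp add: Diff_Diff_Int)
      also have "\<dots> \<le> emeasure lborel (\<Union>i\<in>I. E \<inter> ?B i)"
      proof (rule emeasure_mono)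
        show "(\<Union>i\<in>I. E \<inter> ?B i) \<in> sets lborel" using I(1) E by (intro sets.countable_UN') auto
      qed (auto simp: S_def)
      also have "\<dots> = (\<integral>\<^sup>+i. emeasure lborel (E \<inter> ?B i) \<partial>count_space I)"
        by (rule emeasure_UN_countable[OF _ I(1) disjE]) (use E in auto)
      also have "\<dots> \<le> (\<integral>\<^sup>+i. ennreal (1/2) * emeasure lborel (?B i) \<partial>count_space I)"
      proof (rule nn_integral_mono)
        fix i assume "i \<in> space (count_space I)"
        then have "i \<in> K" using I by auto
        then have m: "measure lborel (E \<inter> ?B i) \<le> measure lborel (?B i) / 2"
          by (auto simp: K_def S_def)
        have f: "emeasure lborel (?B i) < \<infinity>" by (rule emeasure_lborel_ball_finite)
        moreover have "emeasure lborel (E \<inter> ?B i) \<le> emeasure lborel (?B i)" by (intro emeasure_mono) auto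
        ultimately have "emeasure lborel (E \<inter> ?B i) = ennreal (measure lborel (E \<inter> ?B i))"
          by (intro emeasure_eq_ennreal_measure) (auto simp: top_unique)
        also have "\<dots> \<le> ennreal (1/2 * measure lborel (?B i))" using m by (intro ennreal_leI) simp
        also have "\<dots> = ennreal (1/2) * ennreal (measure lborel (?B i))" by (rule ennreal_mult) auto
        also have "ennreal (measure lborel (?B i)) = emeasure lborel (?B i)"
          using f by (intro emeasure_eq_ennreal_measure[symmetric]) auto
        finally show "emeasure lborel (E \<inter> ?B i) \<le> ennreal (1/2) * emeasure lborel (?B i)" .
      qed
      also have "\<dots> = ennreal (1/2) * (\<integral>\<^sup>+i. emeasure lborel (?B i) \<partial>count_space I)"
        by (rule nn_integral_cmult) simp
      also have "(\<integral>\<^sup>+i. emeasure lborel (?B i) \<partial>count_space I) = emeasure lborel (\<Union>i\<in>I. ?B i)"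
        by (rule emeasure_UN_countable[OF _ I(1) disj, symmetric]) auto
      also have "\<dots> \<le> emeasure lborel V"
      proof (rule emeasure_mono)
        show "(\<Union>i\<in>I. ?B i) \<subseteq> V" 
        proof (rule UN_least)
          fix i assume "i \<in> I"
          then have "i \<in> K" using I(2) by blast
          then show "?B i \<subseteq> V" by (cases i) (simp add: K_def)
        qed
      qed (use V(1) in auto)
      also have "emeasure lborel V = emeasure lborel (S m) + emeasure lborel (V - S m)"
        using V Sb by (subst plus_emeasure) (auto simp: Un_absorb1)
      also have "emeasure lborel (V - S m) \<le> ennreal \<eta>"
        using V(1,3) Sb by simp
      finally show ?thesis by (simp add: mult_left_mono)
    qed
    obtain v where v: "emeasure lborel (S m) = ennreal v" "v \<ge> 0" using Sfin by (cases "emeasure lborel (S m)") auto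
    have "v \<le> \<eta>" if "\<eta> > 0" for \<eta>
    proof -
      have "ennreal v \<le> ennreal (1/2 * (v + \<eta>))"
      proof -
        have "ennreal v + ennreal \<eta> = ennreal (v + \<eta>)" using v(2) that by simp
        moreover have "ennreal (1/2) * ennreal (v + \<eta>) = ennreal (1/2 * (v + \<eta>))"
          using v(2) that by (intro ennreal_mult[symmetric]) auto
        ultimately show ?thesis using le[OF that] unfolding v(1) by metis
      qed
      then have "v \<le> 1/2 * (v + \<eta>)" using v that by (subst (asm) ennreal_le_iff) auto
      then show ?thesis by simp
    qed
    then have "v \<le> 0" using dense_ge by blast
    then have "S m \<in> null_sets lborel" using v Sb by (auto simp: null_sets_def)
    then show ?thesis by (simp add: negligible_iff_null_sets null_sets_completionI)
  qed
  then have "negligible (\<Union>m. S m)" by (intro negligible_countable_Union) auto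
  moreover have "{x\<in>E. \<not> half_dense_at E x} \<subseteq> (\<Union>m. S m)"
  proof
    fix x assume "x \<in> {x\<in>E. \<not> half_dense_at E x}"
    then obtain e where x: "x \<in> E" and e: "e > 0" "\<And>r. 0 < r \<Longrightarrow> r < e \<Longrightarrow> measure lborel (E \<inter> ball x r) < measure lborel (ball x r) / 2"
      unfolding half_dense_at_def by force
    obtain m1 :: nat where m1: "norm x < real m1" using reals_Archimedean2 by blast
    obtain m2 :: nat where m2: "1 / real (Suc m2) < e" using nat_approx_posE e(1) by blast
    let ?m = "max m1 m2"
    have "1 / real (Suc ?m) \<le> 1 / real (Suc m2)" by (intro divide_left_mono) auto
    then have "x \<in> S ?m" using x m1 m2 e(2) by (force simp: S_def less_imp_le)
    then show "x \<in> (\<Union>m. S m)" by blast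
  qed
  ultimately show ?thesis by (rule negligible_subset)
qed

section \<open>Integration over superlevel sets\<close>

text \<open>Hoelder's inequality for \<open>G powr (q - 1)\<close> and the indicator of a superlevel
  set, with exponents \<open>q / (q - 1)\<close> and \<open>q\<close>. It is derived from a
  pointwise Young inequality, a form that includes \<open>q = 1\<close>.\<close>

lemma powr_integral_superlevel_le:
  fixes G :: "'a \<Rightarrow> real"
  assumes M: "finite_measure M" and [measurable]: "G \<in> borel_measurable M"
    and G0: "\<And>x. 0 \<le> G x" and q: "1 \<le> q" and N: "0 < N"
    and eq: "(\<integral>\<^sup>+x. ennreal (G x powr q) \<partial>M) = ennreal (N powr q)"
  shows "(\<integral>\<^sup>+x. ennreal (G x powr (q - 1)) * indicator {x. t < G x} x \<partial>M)
     \<le> ennreal (N powr (q - 1)) * ennreal (measure M {x\<in>space M. t < G x} powr (1/q))"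
proof -
  interpret finite_measure M by fact
  let ?A = "{x\<in>space M. t < G x}"
  define a where "a = measure M ?A powr (1/q)"
  show ?thesis
  proof (cases "measure M ?A = 0")
    case True
    then have "emeasure M ?A = 0" by (simp add: emeasure_eq_measure)
    then have "AE x in M. \<not> t < G x" by (subst (asm) AE_iff_measurable[symmetric, of _ M "\<lambda>x. \<not> t < G x"]) auto
    then have "(\<integral>\<^sup>+x. ennreal (G x powr (q - 1)) * indicator {x. t < G x} x \<partial>M) = (\<integral>\<^sup>+x. 0 \<partial>M)"
      by (intro nn_integral_cong_AE) auto
    then show ?thesis by simp
  next
    case False
    then have mpos: "measure M ?A > 0" by (simp add: zero_less_measure_iff)
    then have a: "a > 0" by (simp add: a_def)
    have aq: "a powr q = measure M ?A" using q mpos by (simp add: a_def powr_powr)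
    \<comment> \<open>The scaling for which the two Young terms integrate to the shares
      \<open>1/q\<close> and \<open>1 - 1/q\<close> of the desired bound.\<close>
    define c where "c = (N / a) powr (q - 1)"
    have c: "c \<ge> 0" by (simp add: c_def)
    have young: "y powr (q - 1) \<le> c * (1/q + (1 - 1/q) * ((a * y / N) powr q))" if y: "y \<ge> 0" for y
    proof (cases "q = 1 \<or> y = 0")
      case True
      have "y powr (q - 1) \<le> c / q" if "y = 0" using that c q by simp
      moreover have "y powr (q - 1) \<le> c * (1/q + (1 - 1/q) * ((a * y / N) powr q))" if "q = 1" 
        using that a N by (auto simp: c_def)
      moreover have "c / q \<le> c * (1/q + (1 - 1/q) * ((a * y / N) powr q))"
        using c q by (simp add: distrib_left)
      ultimately show ?thesis using True by force
    next
      case False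
      then have q1: "q > 1" and yp: "y > 0" using q y by auto
      define v where "v = a * y / N"
      have v: "v > 0" using a yp N by (simp add: v_def)
      have "1 powr (1/q) * (v powr q) powr (1 - 1/q) \<le> 1/q * 1 + (1 - 1/q) * v powr q"
        by (rule Youngs_inequality_0) (use q1 v in auto)
      moreover have "(v powr q) powr (1 - 1/q) = v powr (q - 1)"
      proof -
        have "q * (1 - 1/q) = q - 1" using q1 by (simp add: right_diff_distrib)
        then show ?thesis by (simp only: powr_powr)
      qed
      ultimately have "v powr (q - 1) \<le> 1/q + (1 - 1/q) * v powr q" by simp
      then have "c * v powr (q - 1) \<le> c * (1/q + (1 - 1/q) * v powr q)" using c by (rule mult_left_mono)
      moreover have "c * v powr (q - 1) = y powr (q - 1)"
        unfolding c_def using a v N yp by (subst powr_mult[symmetric]) (auto simp: v_def)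
      ultimately show ?thesis by (simp add: v_def)
    qed
    have split: "(a * y / N) powr q = a powr q / N powr q * y powr q" if "y \<ge> 0" for y
      using that a N by (simp add: powr_mult powr_divide)
    have "(\<integral>\<^sup>+x. ennreal (G x powr (q - 1)) * indicator {x. t < G x} x \<partial>M)
      \<le> (\<integral>\<^sup>+x. ennreal (c / q) * indicator ?A x + ennreal (c * (1 - 1/q) * (a powr q / N powr q)) * ennreal (G x powr q) \<partial>M)"
    proof (rule nn_integral_mono)
      fix x assume x: "x \<in> space M"
      show "ennreal (G x powr (q - 1)) * indicator {x. t < G x} x
         \<le> ennreal (c / q) * indicator ?A x + ennreal (c * (1 - 1/q) * (a powr q / N powr q)) * ennreal (G x powr q)"
      proof (cases "t < G x")
        case True
        have "G x powr (q - 1) \<le> c / q + c * (1 - 1/q) * (a powr q / N powr q) * G x powr q"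
          using young[OF G0[of x]] split[OF G0[of x]] by (simp add: distrib_left mult.assoc)
        then have "ennreal (G x powr (q - 1)) \<le> ennreal (c / q) + ennreal (c * (1 - 1/q) * (a powr q / N powr q)) * ennreal (G x powr q)"
          using c q by (simp flip: ennreal_mult ennreal_plus)
        then show ?thesis using True x by simp
      qed simp
    qed
    also have "\<dots> = ennreal (c / q) * emeasure M ?A + ennreal (c * (1 - 1/q) * (a powr q / N powr q)) * ennreal (N powr q)"
      by (subst nn_integral_add) (auto simp: nn_integral_cmult eq)
    also have "\<dots> = ennreal (c / q * a powr q + c * (1 - 1/q) * (a powr q / N powr q) * N powr q)"
      using c q by (simp add: emeasure_eq_measure aq flip: ennreal_mult ennreal_plus)
    also have "c / q * a powr q + c * (1 - 1/q) * (a powr q / N powr q) * N powr q = c * a powr q"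
      using q N by (simp add: field_simps)
    also have "c * a powr q = N powr (q - 1) * a"
    proof -
      have "a powr q = a powr (q - 1) * a" using a powr_add[of a "q - 1" 1] by simp
      moreover have "c * a powr (q - 1) = N powr (q - 1)"
        unfolding c_def using a N by (subst powr_mult[symmetric]) auto
      ultimately show ?thesis by simp
    qed
    finally show ?thesis by (simp add: a_def ennreal_mult)
  qed
qed

text \<open>This is Minkowski's integral inequality for \<open>G = \<integral> 1{t < G} dt\<close>. Swapping integrals in
  \<open>\<integral> G powr q = \<integral>\<integral> G powr (q - 1) * 1{t < G}\<close> reduces it to Hoelder's inequality on superlevel sets.\<close>

lemma Lq_norm_le_integral_superlevel:
  fixes G :: "'a \<Rightarrow> real"
  assumes M: "finite_measure M" and G[measurable]: "G \<in> borel_measurable M"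
    and G0: "\<And>x. 0 \<le> G x" and q: "1 \<le> q"
    and fin: "(\<integral>\<^sup>+x. ennreal (G x powr q) \<partial>M) \<noteq> \<infinity>"
    and le: "(\<integral>\<^sup>+t. ennreal (measure M {x\<in>space M. t < G x} powr (1/q)) * indicator {0<..} t \<partial>lborel) \<le> ennreal S"
    and S: "0 \<le> S"
  shows "(\<integral>\<^sup>+x. ennreal (G x powr q) \<partial>M) \<le> ennreal (S powr q)"
proof -
  interpret finite_measure M by fact
  interpret p: pair_sigma_finite M lborel ..
  let ?I = "\<integral>\<^sup>+x. ennreal (G x powr q) \<partial>M"
  obtain i where i: "?I = ennreal i" "i \<ge> 0" using fin by (cases ?I) auto
  show ?thesis
  proof (cases "i = 0")
    case True then show ?thesis using i by simp
  next
    case False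
    define N where "N = i powr (1/q)"
    have N: "N > 0" "N powr q = i" using False i q by (auto simp: N_def powr_powr)
    have eqN: "?I = ennreal (N powr q)" using i N by simp
    \<comment> \<open>One factor \<open>G x\<close> is written as the length of
      \<open>{0<..<G x}\<close>.\<close>
    have "?I = (\<integral>\<^sup>+x. \<integral>\<^sup>+t. ennreal (G x powr (q - 1)) * indicator {0<..<G x} t \<partial>lborel \<partial>M)"
    proof (rule nn_integral_cong)
      fix x
      have "G x powr q = G x powr (q - 1) * G x"
        using powr_mult_base[OF G0[of x], of "q - 1"] by (simp add: mult.commute)
      then show "ennreal (G x powr q) = (\<integral>\<^sup>+t. ennreal (G x powr (q - 1)) * indicator {0<..<G x} t \<partial>lborel)"
        using G0[of x] by (simp add: nn_integral_cmult_indicator ennreal_mult)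
    qed
    also have "\<dots> = (\<integral>\<^sup>+x. \<integral>\<^sup>+t. ennreal (G x powr (q - 1)) * (if 0 < t \<and> t < G x then 1 else 0) \<partial>lborel \<partial>M)"
      by (intro nn_integral_cong) (auto split: split_indicator)
    also have "\<dots> = (\<integral>\<^sup>+t. \<integral>\<^sup>+x. ennreal (G x powr (q - 1)) * (if 0 < t \<and> t < G x then 1 else 0) \<partial>M \<partial>lborel)"
      by (rule p.Fubini'[symmetric]) measurable
    also have "\<dots> \<le> (\<integral>\<^sup>+t. ennreal (N powr (q - 1)) * (ennreal (measure M {x\<in>space M. t < G x} powr (1/q)) * indicator {0<..} t) \<partial>lborel)"
    proof (rule nn_integral_mono)
      fix t :: real
      show "(\<integral>\<^sup>+x. ennreal (G x powr (q - 1)) * (if 0 < t \<and> t < G x then 1 else 0) \<partial>M)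
        \<le> ennreal (N powr (q - 1)) * (ennreal (measure M {x\<in>space M. t < G x} powr (1/q)) * indicator {0<..} t)"
      proof (cases "t > 0")
        case True
        have "(\<integral>\<^sup>+x. ennreal (G x powr (q - 1)) * (if 0 < t \<and> t < G x then 1 else 0) \<partial>M)
          = (\<integral>\<^sup>+x. ennreal (G x powr (q - 1)) * indicator {x. t < G x} x \<partial>M)"
          using True by (intro nn_integral_cong) (auto split: split_indicator)
        then show ?thesis using powr_integral_superlevel_le[OF M G G0 q N(1) eqN, of t] True by simp
      qed simp
    qed
    also have "\<dots> \<le> ennreal (N powr (q - 1)) * ennreal S"
    proof (subst nn_integral_cmult)
      \<comment> \<open>Measurability in the level comes from monotonicity: superlevel sets
        shrink.\<close>
      have "antimono (\<lambda>t. measure M {x\<in>space M. t < G x} powr (1/q))"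
        using q by (intro antimonoI powr_mono2 finite_measure_mono) auto
      then have "mono (\<lambda>t. - (measure M {x\<in>space M. t < G x} powr (1/q)))"
        by (auto simp: mono_def antimono_def)
      from borel_measurable_mono[OF this] have "(\<lambda>t. - (- (measure M {x\<in>space M. t < G x} powr (1/q)))) \<in> borel_measurable borel"
        by (rule borel_measurable_uminus)
      then show "(\<lambda>t. ennreal (measure M {x\<in>space M. t < G x} powr (1/q)) * indicator {0<..} t) \<in> borel_measurable lborel"
        by simp
    qed (intro mult_left_mono le, simp)
    finally have "ennreal (N powr q) \<le> ennreal (N powr (q - 1) * S)" 
      unfolding eqN using S by (simp add: ennreal_mult)
    \<comment> \<open>Cancelling \<open>N powr (q - 1)\<close> requires a finite nonzero norm; this
      is the purpose of \<open>fin\<close>.\<close>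
    then have "N powr (q - 1) * N \<le> N powr (q - 1) * S"
      using S N(1) powr_mult_base[of N "q - 1"] by (simp add: mult.commute)
    then have "N \<le> S" using N(1) by simp
    then have "N powr q \<le> S powr q" using N(1) q by (intro powr_mono2) auto
    then show ?thesis unfolding eqN by (rule ennreal_leI)
  qed
qed

section \<open>The trace inequality around a median\<close>

lemma powr_add_powr_le:
  fixes a b :: real
  assumes "0 \<le> a" "0 \<le> b" "1 \<le> q"
  shows "a powr q + b powr q \<le> (a + b) powr q"
  using sum_powr_le_powr_sum[of "{False, True}" "\<lambda>i. if i then a else b" q] assms by (simp add: add.commute)

lemma nn_integral_real_translate:
  fixes F :: "real \<Rightarrow> ennreal"
  assumes [measurable]: "F \<in> borel_measurable borel"
  shows "(\<integral>\<^sup>+t. F (m + t) \<partial>lborel) = (\<integral>\<^sup>+t. F t \<partial>lborel)"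
  using nn_integral_translate[OF assms, of m] by (simp add: add.commute)

text \<open>An abstract \<open>G\<close> lets this apply twice: to the deviation
  \<open>\<bar>f x - m\<bar>\<close> under Lebesgue measure on \<Omega>, where half density holds
  almost everywhere, and to a truncated simple function under the restriction of \<mu>, where it
  holds at every relevant point because that is a Lebesgue point.\<close>

lemma trace_inequality_truncated:
  fixes f :: "'a::euclidean_space \<Rightarrow> real" and \<Omega> :: "'a set" and \<nu> :: "'a measure" and B :: "'a set"
  assumes J: "distance_John_domain s C x\<^sub>J \<Omega>" 
    and B: "B = ball x\<^sub>J (infdist x\<^sub>J (frontier \<Omega>) / 4)"
    and f: "integrable lborel f" and T: "total_variation \<Omega> f = ennreal T" "0 \<le> T"
    and m: "measure lborel ({x. m < f x} \<inter> B) \<le> measure lborel B / 2"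
      "measure lborel ({x. f x < m} \<inter> B) \<le> measure lborel B / 2"
    and K: "K = 4 * C + max 1 (diameter \<Omega>)"
    and q: "1 \<le> q" "q * s * (real DIM('a) - 1) \<le> real DIM('a)"
    and \<nu>: "finite_measure \<nu>" "sets \<nu> = sets borel" and M: "1 \<le> M"
    and growth: "\<And>x r. 0 < r \<Longrightarrow> r \<le> 5 * K * max 1 (diameter \<Omega>) \<Longrightarrow>
       emeasure \<nu> (ball x r) \<le> ennreal (M * r powr (q * s * (real DIM('a) - 1)))"
    and G: "G \<in> borel_measurable borel" "\<And>x. 0 \<le> G x" "(\<integral>\<^sup>+x. ennreal (G x powr q) \<partial>\<nu>) \<noteq> \<infinity>"
    and dense: "\<And>t. 0 < t \<Longrightarrow> AE x in \<nu>. t < G x \<longrightarrow>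
       x \<in> \<Omega> \<and> (half_dense_at {y. m + t < f y} x \<or> half_dense_at {y. f y < m - t} x)"
  shows "(\<integral>\<^sup>+x. ennreal (G x powr q) \<partial>\<nu>) \<le>
    ennreal ((M * (5 * K) ^ DIM('a) * (4 * 3 ^ (DIM('a) + 1) / (unit_ball_vol DIM('a))\<^sup>2) *
      (2 * unit_ball_vol DIM('a)) * T) powr q)"
proof -
  interpret finite_measure \<nu> by fact
  have Gm[measurable]: "G \<in> borel_measurable \<nu>" using G(1) \<nu>(2) by (simp cong: measurable_cong_sets)
  have [measurable]: "f \<in> borel_measurable borel" using f by auto
  have sp: "space \<nu> = UNIV" using sets_eq_imp_space_eq[OF \<nu>(2)] by simp
  let ?n = "DIM('a)"
  define c where "c = 4 * 3 ^ (?n + 1) / (unit_ball_vol ?n)\<^sup>2"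
  define L where "L = M * (5 * K) ^ ?n"
  define p where "p t = perimeter_density \<Omega> {x. t < f x}" for t
  define p' where "p' t = perimeter_density \<Omega> {x. t < - f x}" for t
  have pm: "p \<in> borel_measurable borel" "p' \<in> borel_measurable borel"
    unfolding p_def p'_def by (intro perimeter_density_measurable; measurable)+
  note [measurable] = pm
  have c: "c > 0" unfolding c_def by (intro divide_pos_pos mult_pos_pos zero_less_power unit_ball_vol_pos) auto
  have "C \<ge> 1" and o: "open \<Omega>" using J by (auto simp: distance_John_domain_def bounded_domain_def)
  then have K1: "K \<ge> 1" using K by simp
  have "1 * 1 \<le> M * (5 * K) ^ ?n" using M K1 by (intro mult_mono one_le_power) auto
  then have L1: "L \<ge> 1" by (simp add: L_def)
  have Bf: "measure lborel (E' \<inter> B) \<le> measure lborel B / 2"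
    if "E' \<in> sets borel" "E \<in> sets borel" "E' \<subseteq> E" "measure lborel (E \<inter> B) \<le> measure lborel B / 2" for E E' :: "'a set"
  proof -
    have "measure lborel (E' \<inter> B) \<le> measure lborel (E \<inter> B)"
    proof (rule measure_mono_fmeasurable)
      show "E \<inter> B \<in> fmeasurable lborel"
        by (rule fmeasurableI2[of B]) (use that emeasure_lborel_ball_finite in \<open>auto simp: B fmeasurable_def\<close>)
    qed (use that in \<open>auto simp: B\<close>)
    then show ?thesis using that(4) by linarith
  qed
  \<comment> \<open>Two covers, one for \<open>f\<close> above \<open>m + t\<close> and one for
    \<open>f\<close> below \<open>m - t\<close>, bound the superlevel set of \<open>G\<close>; with
    an infinite perimeter the bound is trivial.\<close>
  have level: "ennreal (measure \<nu> {x\<in>space \<nu>. t < G x} powr (1/q)) \<le> ennreal (L * c) * (p (m + t) + p' (- m + t))" if t: "0 < t" for t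
  proof (cases "p (m + t) = \<infinity> \<or> p' (- m + t) = \<infinity>")
    case True
    have "ennreal (L * c) * (p (m + t) + p' (- m + t)) = \<infinity>"
      using True L1 c by (auto simp: ennreal_mult_eq_top_iff)
    then show ?thesis by simp
  next
    case False
    then obtain P P' where P: "p (m + t) = ennreal P" "0 \<le> P" and P': "p' (- m + t) = ennreal P'" "0 \<le> P'"
      by (cases "p (m + t)"; cases "p' (- m + t)") auto
    have s1: "{y. m + t < f y} \<subseteq> {y. m < f y}" and s2: "{y. f y < m - t} \<subseteq> {y. f y < m}"
      using t by auto
    have eq': "{x. f x < m - t} = {x. - m + t < - f x}" by auto
    have "\<exists>W\<in>sets borel. {x\<in>\<Omega>. half_dense_at {y. m + t < f y} x} \<subseteq> W \<and> emeasure \<nu> W \<le> ennreal (M * (5 * K) ^ ?n * (c * P) powr q)"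
      unfolding c_def
    proof (rule level_set_cover[OF J _ _ _ _ K q \<nu>(2) _ growth, where E="{y. m + t < f y}"])
      show "measure lborel ({y. m + t < f y} \<inter> ball x\<^sub>J (infdist x\<^sub>J (frontier \<Omega>) / 4)) \<le> measure lborel (ball x\<^sub>J (infdist x\<^sub>J (frontier \<Omega>) / 4)) / 2"
        using Bf[OF _ _ s1 m(1)] unfolding B by auto
      show "perimeter_density \<Omega> {y. m + t < f y} = ennreal P" using P(1) by (simp add: p_def)
    qed (use P M in auto)
    then obtain W where W: "W \<in> sets borel" "{x\<in>\<Omega>. half_dense_at {y. m + t < f y} x} \<subseteq> W"
      "emeasure \<nu> W \<le> ennreal (L * (c * P) powr q)" unfolding L_def by blast
    have "\<exists>W\<in>sets borel. {x\<in>\<Omega>. half_dense_at {y. f y < m - t} x} \<subseteq> W \<and> emeasure \<nu> W \<le> ennreal (M * (5 * K) ^ ?n * (c * P') powr q)"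
      unfolding c_def
    proof (rule level_set_cover[OF J _ _ _ _ K q \<nu>(2) _ growth, where E="{y. f y < m - t}"])
      show "measure lborel ({y. f y < m - t} \<inter> ball x\<^sub>J (infdist x\<^sub>J (frontier \<Omega>) / 4)) \<le> measure lborel (ball x\<^sub>J (infdist x\<^sub>J (frontier \<Omega>) / 4)) / 2"
        using Bf[OF _ _ s2 m(2)] unfolding B by auto
      show "perimeter_density \<Omega> {y. f y < m - t} = ennreal P'" using P'(1) by (simp add: p'_def eq')
    qed (use P' M in auto)
    then obtain W' where W': "W' \<in> sets borel" "{x\<in>\<Omega>. half_dense_at {y. f y < m - t} x} \<subseteq> W'"
      "emeasure \<nu> W' \<le> ennreal (L * (c * P') powr q)" unfolding L_def by blast
    have "emeasure \<nu> {x\<in>space \<nu>. t < G x} \<le> emeasure \<nu> (W \<union> W')"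
    proof (rule emeasure_mono_AE)
      show "AE x in \<nu>. x \<in> {x \<in> space \<nu>. t < G x} \<longrightarrow> x \<in> W \<union> W'"
        using dense[OF t] by eventually_elim (use W(2) W'(2) in auto)
    qed (use W(1) W'(1) \<nu>(2) in auto)
    also have "\<dots> \<le> emeasure \<nu> W + emeasure \<nu> W'"
      using W(1) W'(1) \<nu>(2) by (intro emeasure_subadditive) auto
    also have "\<dots> \<le> ennreal (L * (c * P) powr q) + ennreal (L * (c * P') powr q)"
      using W(3) W'(3) by (rule add_mono)
    also have "\<dots> = ennreal (L * ((c * P) powr q + (c * P') powr q))"
      using L1 by (simp add: distrib_left flip: ennreal_plus)
    also have "\<dots> \<le> ennreal (L powr q * (c * P + c * P') powr q)"
    proof (intro ennreal_leI mult_mono powr_add_powr_le)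
      \<comment> \<open>\<open>L\<close> is at least 1, so it can be moved under the power
        \<open>q\<close>.\<close>
      have "L powr 1 \<le> L powr q" using L1 q by (intro powr_mono) auto
      then show "L \<le> L powr q" using L1 by simp
    qed (use c P P' q in auto)
    also have "L powr q * (c * P + c * P') powr q = (L * c * (P + P')) powr q"
      using L1 c P P' by (subst powr_mult[symmetric]) (auto simp: algebra_simps)
    finally have "measure \<nu> {x\<in>space \<nu>. t < G x} \<le> (L * c * (P + P')) powr q"
      by (simp add: emeasure_eq_measure)
    then have "measure \<nu> {x\<in>space \<nu>. t < G x} powr (1/q) \<le> ((L * c * (P + P')) powr q) powr (1/q)"
      using q by (intro powr_mono2) auto
    also have "\<dots> = L * c * (P + P')" using q L1 c P P' by (simp add: powr_powr)
    finally have "ennreal (measure \<nu> {x\<in>space \<nu>. t < G x} powr (1/q)) \<le> ennreal (L * c * (P + P'))"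
      by (rule ennreal_leI)
    also have "\<dots> = ennreal (L * c) * (p (m + t) + p' (- m + t))"
      unfolding P P' using L1 c P(2) P'(2) by (subst ennreal_mult) auto
    finally show ?thesis .
  qed
  \<comment> \<open>On the right the levels \<open>t > 0\<close> are enlarged to the whole line,
    where the shift by the median has no effect.\<close>
  have "(\<integral>\<^sup>+t. ennreal (measure \<nu> {x\<in>space \<nu>. t < G x} powr (1/q)) * indicator {0<..} t \<partial>lborel)
    \<le> (\<integral>\<^sup>+t. ennreal (L * c) * (p (m + t) + p' (- m + t)) \<partial>lborel)"
    by (intro nn_integral_mono) (use level in \<open>auto split: split_indicator\<close>)
  also have "\<dots> = ennreal (L * c) * ((\<integral>\<^sup>+t. p (m + t) \<partial>lborel) + (\<integral>\<^sup>+t. p' (- m + t) \<partial>lborel))"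
    by (simp add: nn_integral_cmult nn_integral_add)
  also have "(\<integral>\<^sup>+t. p (m + t) \<partial>lborel) = (\<integral>\<^sup>+t. p t \<partial>lborel)" by (rule nn_integral_real_translate[OF pm(1)])
  also have "(\<integral>\<^sup>+t. p' (- m + t) \<partial>lborel) = (\<integral>\<^sup>+t. p' t \<partial>lborel)" by (rule nn_integral_real_translate[OF pm(2)])
  also have "ennreal (L * c) * ((\<integral>\<^sup>+t. p t \<partial>lborel) + (\<integral>\<^sup>+t. p' t \<partial>lborel))
    \<le> ennreal (L * c) * (ennreal (unit_ball_vol ?n) * ennreal T + ennreal (unit_ball_vol ?n) * ennreal T)"
    using coarea_inequality[OF f o] unfolding p_def p'_def T(1) by (intro mult_left_mono add_mono) auto
  also have "\<dots> = ennreal (L * c * (2 * unit_ball_vol ?n) * T)"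
  proof -
    have "ennreal w * ennreal T + ennreal w * ennreal T = ennreal (2 * w * T)" if "w \<ge> 0" for w
      using that T(2) by (simp flip: ennreal_mult ennreal_plus)
    from this[OF unit_ball_vol_nonneg] show ?thesis
      using L1 c T(2) by (simp add: mult.assoc flip: ennreal_mult)
  qed
  finally have "(\<integral>\<^sup>+t. ennreal (measure \<nu> {x\<in>space \<nu>. t < G x} powr (1/q)) * indicator {0<..} t \<partial>lborel)
    \<le> ennreal (L * c * (2 * unit_ball_vol ?n) * T)" .
  moreover have nn: "0 \<le> L * c * (2 * unit_ball_vol ?n) * T"
    using L1 c T(2) by (intro mult_nonneg_nonneg) auto
  ultimately have "(\<integral>\<^sup>+x. ennreal (G x powr q) \<partial>\<nu>) \<le> ennreal ((L * c * (2 * unit_ball_vol ?n) * T) powr q)"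
    by (rule Lq_norm_le_integral_superlevel[OF \<nu>(1) Gm G(2) q(1) G(3)])
  then show ?thesis unfolding L_def c_def .
qed

text \<open>The median is the infimum of the levels whose superlevel set fills at most half of the
  ball. Continuity of the measure along increasing unions turns bounds at nearby levels into the two
  bounds at \<open>m\<close> itself.\<close>

lemma median_exists:
  fixes f :: "'a::euclidean_space \<Rightarrow> real"
  assumes [measurable]: "f \<in> borel_measurable borel"
  shows "\<exists>m. measure lborel ({x. m < f x} \<inter> ball z r) \<le> measure lborel (ball z r) / 2 \<and>
             measure lborel ({x. f x < m} \<inter> ball z r) \<le> measure lborel (ball z r) / 2"
proof (cases "r > 0")
  case r: True
  let ?B = "ball z r"
  define b where "b = measure lborel ?B"
  have b: "b > 0" using r by (simp add: b_def content_ball)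
  have fm: "A \<inter> ?B \<in> fmeasurable lborel" if "A \<in> sets borel" for A
    by (rule fmeasurableI2[of ?B]) (use that emeasure_lborel_ball_finite in \<open>auto simp: fmeasurable_def\<close>)
  have fin: "emeasure lborel (A \<inter> ?B) \<noteq> \<infinity>" if "A \<in> sets borel" for A
    using fm[OF that] by (auto simp: fmeasurable_def)
  define F where "F t = measure lborel ({x. t < f x} \<inter> ?B)" for t
  have anti: "F t' \<le> F t" if "t \<le> t'" for t t'
    unfolding F_def by (rule measure_mono_fmeasurable) (use that fm[of "{x. t < f x}"] in auto)
  have lim_gt: "(\<lambda>k. F (m + 1 / real (Suc k))) \<longlonglongrightarrow> F m" for m
  proof -
    have "(\<lambda>k. measure lborel ({x. m + 1 / real (Suc k) < f x} \<inter> ?B)) \<longlonglongrightarrow> measure lborel (\<Union>k. {x. m + 1 / real (Suc k) < f x} \<inter> ?B)"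
    proof (rule Lim_measure_incseq)
      show "incseq (\<lambda>k. {x. m + 1 / real (Suc k) < f x} \<inter> ?B)"
      proof (rule incseq_SucI, intro Int_mono Collect_mono impI order_refl)
        fix k x assume "m + 1 / real (Suc k) < f x"
        moreover have "1 / real (Suc (Suc k)) \<le> 1 / real (Suc k)" by (intro divide_left_mono) auto
        ultimately show "m + 1 / real (Suc (Suc k)) < f x" by linarith
      qed
      have "(\<Union>k. {x. m + 1 / real (Suc k) < f x} \<inter> ?B) = (\<Union>k. {x. m + 1 / real (Suc k) < f x}) \<inter> ?B" by auto
      then show "emeasure lborel (\<Union>k. {x. m + 1 / real (Suc k) < f x} \<inter> ?B) \<noteq> \<infinity>"
        by (simp only:) (rule fin, measurable)
    qed auto
    moreover have "(\<Union>k. {x. m + 1 / real (Suc k) < f x} \<inter> ?B) = {x. m < f x} \<inter> ?B"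
    proof (intro equalityI subsetI)
      fix x assume "x \<in> {x. m < f x} \<inter> ?B"
      moreover then obtain k where "1 / real (Suc k) < f x - m" using nat_approx_posE[of "f x - m"] by auto
      ultimately show "x \<in> (\<Union>k. {x. m + 1 / real (Suc k) < f x} \<inter> ?B)" by (auto intro!: exI[of _ k])
    next
      fix x assume "x \<in> (\<Union>k. {x. m + 1 / real (Suc k) < f x} \<inter> ?B)"
      then obtain k where "m + 1 / real (Suc k) < f x" "x \<in> ?B" by auto
      moreover have "0 < 1 / real (Suc k)" by simp
      ultimately have "m < f x" by linarith
      then show "x \<in> {x. m < f x} \<inter> ?B" using \<open>x \<in> ?B\<close> by auto
    qed
    ultimately show ?thesis by (simp add: F_def)
  qed
  have lim0: "(\<lambda>k. F (real k)) \<longlonglongrightarrow> 0"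
  proof -
    have "(\<lambda>k. measure lborel ({x. real k < f x} \<inter> ?B)) \<longlonglongrightarrow> measure lborel (\<Inter>k. {x. real k < f x} \<inter> ?B)"
      by (rule Lim_measure_decseq) (use fin in \<open>auto simp: decseq_def\<close>)
    moreover have "(\<Inter>k. {x. real k < f x} \<inter> ?B) = {}"
    proof -
      have "\<exists>k. \<not> real k < f x" for x using reals_Archimedean2[of "f x"] less_asym by blast
      then show ?thesis by blast
    qed
    ultimately show ?thesis by (simp add: F_def)
  qed
  have lim1: "(\<lambda>k. F (- real k)) \<longlonglongrightarrow> b"
  proof -
    have "(\<lambda>k. measure lborel ({x. - real k < f x} \<inter> ?B)) \<longlonglongrightarrow> measure lborel (\<Union>k. {x. - real k < f x} \<inter> ?B)"
    proof (rule Lim_measure_incseq)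
      have "(\<Union>k. {x. - real k < f x} \<inter> ?B) = (\<Union>k. {x. - real k < f x}) \<inter> ?B" by auto
      then show "emeasure lborel (\<Union>k. {x. - real k < f x} \<inter> ?B) \<noteq> \<infinity>"
        by (simp only:) (rule fin, measurable)
    qed (auto simp: incseq_def)
    moreover have "(\<Union>k. {x. - real k < f x} \<inter> ?B) = ?B"
    proof -
      have "\<exists>k. - real k < f x" for x using reals_Archimedean2[of "- f x"] by (auto simp: minus_less_iff)
      then show ?thesis by blast
    qed
    ultimately show ?thesis by (simp add: F_def b_def)
  qed
  \<comment> \<open>The limits of \<open>F\<close> at both ends of the line make this set nonempty
    and bounded below.\<close>
  define S where "S = {t. F t \<le> b / 2}"
  have "\<forall>\<^sub>F k in sequentially. F (real k) < b / 2" using order_tendstoD(2)[OF lim0, of "b/2"] b by simp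
  then obtain k1 where "F (real k1) < b / 2" by (auto simp: eventually_sequentially)
  then have ne: "S \<noteq> {}" by (auto simp: S_def intro: less_imp_le)
  have "\<forall>\<^sub>F k in sequentially. b / 2 < F (- real k)" using order_tendstoD(1)[OF lim1, of "b/2"] b by simp
  then obtain k2 where k2: "b / 2 < F (- real k2)" by (auto simp: eventually_sequentially)
  have bdd: "bdd_below S"
  proof (rule bdd_belowI)
    fix t assume "t \<in> S"
    show "- real k2 \<le> t"
    proof (rule ccontr)
      assume "\<not> ?thesis"
      then have "F (- real k2) \<le> F t" by (intro anti) simp
      then show False using k2 \<open>t \<in> S\<close> by (simp add: S_def)
    qed
  qed
  define m where "m = Inf S"
  have above: "F t \<le> b / 2" if mt: "m < t" for t
  proof -
    obtain u where "u \<in> S" "u < t" using cInf_lessD[OF ne, of t] mt by (auto simp: m_def)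
    then show ?thesis using anti[of u t] by (simp add: S_def)
  qed
  have below: "b / 2 < F t" if "t < m" for t
  proof (rule ccontr)
    assume "\<not> ?thesis"
    then have "m \<le> t" unfolding m_def by (intro cInf_lower bdd) (simp add: S_def)
    then show False using that by simp
  qed
  have "F m \<le> b / 2"
  proof (rule LIMSEQ_le_const2[OF lim_gt], intro exI[of _ 0] allI impI)
    show "F (m + 1 / real (Suc k)) \<le> b / 2" for k by (rule above) simp
  qed
  moreover have "measure lborel ({x. f x < m} \<inter> ?B) \<le> b / 2"
  proof -
    have le: "measure lborel ({x. f x \<le> t} \<inter> ?B) \<le> b / 2" if "t < m" for t
    proof -
      have "{x. f x \<le> t} \<inter> ?B = ?B - ({x. t < f x} \<inter> ?B)" by auto
      then have "measure lborel ({x. f x \<le> t} \<inter> ?B) = b - F t"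
        using measure_Diff[of lborel ?B "{x. t < f x} \<inter> ?B"] fin[of UNIV] by (simp add: b_def F_def)
      then show ?thesis using below[OF that] by simp
    qed
    have "(\<lambda>k. measure lborel ({x. f x \<le> m - 1 / real (Suc k)} \<inter> ?B)) \<longlonglongrightarrow> measure lborel (\<Union>k. {x. f x \<le> m - 1 / real (Suc k)} \<inter> ?B)"
    proof (rule Lim_measure_incseq)
      show "incseq (\<lambda>k. {x. f x \<le> m - 1 / real (Suc k)} \<inter> ?B)"
      proof (rule incseq_SucI, intro Int_mono Collect_mono impI order_refl)
        fix k x assume "f x \<le> m - 1 / real (Suc k)"
        moreover have "1 / real (Suc (Suc k)) \<le> 1 / real (Suc k)" by (intro divide_left_mono) auto
        ultimately show "f x \<le> m - 1 / real (Suc (Suc k))" by linarith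
      qed
      have "(\<Union>k. {x. f x \<le> m - 1 / real (Suc k)} \<inter> ?B) = (\<Union>k. {x. f x \<le> m - 1 / real (Suc k)}) \<inter> ?B" by auto
      then show "emeasure lborel (\<Union>k. {x. f x \<le> m - 1 / real (Suc k)} \<inter> ?B) \<noteq> \<infinity>"
        by (simp only:) (rule fin, measurable)
    qed auto
    moreover have "(\<Union>k. {x. f x \<le> m - 1 / real (Suc k)} \<inter> ?B) = {x. f x < m} \<inter> ?B"
    proof (intro equalityI subsetI)
      fix x assume x: "x \<in> {x. f x < m} \<inter> ?B"
      then obtain k where "1 / real (Suc k) < m - f x" using nat_approx_posE[of "m - f x"] by auto
      then have "x \<in> {x. f x \<le> m - 1 / real (Suc k)} \<inter> ?B" using x by auto
      then show "x \<in> (\<Union>k. {x. f x \<le> m - 1 / real (Suc k)} \<inter> ?B)" by blast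
    next
      fix x assume "x \<in> (\<Union>k. {x. f x \<le> m - 1 / real (Suc k)} \<inter> ?B)"
      then obtain k where "f x \<le> m - 1 / real (Suc k)" "x \<in> ?B" by auto
      moreover have "0 < 1 / real (Suc k)" by simp
      ultimately have "f x < m" by linarith
      then show "x \<in> {x. f x < m} \<inter> ?B" using \<open>x \<in> ?B\<close> by auto
    qed
    ultimately have "(\<lambda>k. measure lborel ({x. f x \<le> m - 1 / real (Suc k)} \<inter> ?B)) \<longlonglongrightarrow> measure lborel ({x. f x < m} \<inter> ?B)" by simp
    then show ?thesis
    proof (rule LIMSEQ_le_const2, intro exI[of _ 0] allI impI)
      show "measure lborel ({x. f x \<le> m - 1 / real (Suc k)} \<inter> ?B) \<le> b / 2" for k by (rule le) simp
    qed
  qed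
  ultimately show ?thesis unfolding F_def b_def by blast
qed (simp add: ball_empty)

section \<open>Lebesgue points\<close>

lemma mean_on_ball_eq:
  assumes [measurable]: "u \<in> borel_measurable borel"
  shows "mean_on (ball x r) u = (LINT y:ball x r|lborel. u y) / measure lborel (ball x r)"
  unfolding mean_on_def set_lebesgue_integral_def by (subst integral_completion) auto

lemma integrable_indicator_ball_abs_diff:
  fixes f :: "'a::euclidean_space \<Rightarrow> real"
  assumes "integrable lborel f" and B: "B \<in> sets borel" "emeasure lborel B < \<infinity>"
  shows "integrable lborel (\<lambda>y. indicator B y *\<^sub>R \<bar>f y - a\<bar>)"
proof -
  have "integrable lborel (\<lambda>y. indicator B y * f y - a * indicator B y)"
    using assms integrable_real_mult_indicator[of B lborel f]
    by (intro Bochner_Integration.integrable_diff Bochner_Integration.integrable_mult_right integrable_real_indicator)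
      (auto simp: mult.commute)
  from Bochner_Integration.integrable_abs[OF this]
  show ?thesis by (rule Bochner_Integration.integrable_cong[THEN iffD1, rotated 2]) (auto split: split_indicator)
qed

text \<open>Markov's inequality: where \<open>f y \<le> t\<close>, the deviation from
  \<open>a\<close> is at least \<open>a - t\<close>, so a mean deviation below
  \<open>(a - t) / 2\<close> leaves that set less than half of the ball.\<close>

lemma Lebesgue_value_half_dense:
  fixes f :: "'a::euclidean_space \<Rightarrow> real"
  assumes f: "integrable lborel f" and L: "Lebesgue_value f x a" and t: "t < a"
  shows "half_dense_at {y. t < f y} x"
  unfolding half_dense_at_def
proof (intro allI impI)
  fix e :: real assume e: "0 < e"
  have [measurable]: "f \<in> borel_measurable borel" using f by auto
  have "\<forall>\<^sub>F r in at_right 0. mean_on (ball x r) (\<lambda>y. \<bar>f y - a\<bar>) < (a - t) / 2"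
    using L t unfolding Lebesgue_value_def by (intro order_tendstoD(2)) auto
  moreover have "\<forall>\<^sub>F r in at_right 0. r \<in> {0<..<e}" by (rule eventually_at_right_real[OF e])
  ultimately have "\<forall>\<^sub>F r in at_right (0::real). mean_on (ball x r) (\<lambda>y. \<bar>f y - a\<bar>) < (a - t) / 2 \<and> r \<in> {0<..<e}"
    by (rule eventually_conj)
  then obtain r where r: "0 < r" "r < e" and mean: "mean_on (ball x r) (\<lambda>y. \<bar>f y - a\<bar>) < (a - t) / 2"
    using eventually_happens[of _ "at_right (0::real)"] by (auto simp: trivial_limit_at_right_real)
  let ?B = "ball x r"
  have fin: "emeasure lborel ?B < \<infinity>" by (rule emeasure_lborel_ball_finite)
  have b: "measure lborel ?B > 0" using r by (simp add: content_ball)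
  define D where "D = {y. f y \<le> t} \<inter> ?B"
  have D: "D \<in> fmeasurable lborel"
    unfolding D_def by (rule fmeasurableI2[of ?B]) (use fin in \<open>auto simp: fmeasurable_def\<close>)
  have "(a - t) * measure lborel D = (LINT y|lborel. (a - t) * indicator D y)"
    using D by (simp add: fmeasurable_def)
  also have "\<dots> \<le> (LINT y|lborel. indicator ?B y *\<^sub>R \<bar>f y - a\<bar>)"
  proof (rule integral_mono)
    show "integrable lborel (\<lambda>y. (a - t) * indicator D y)"
      using D by (intro Bochner_Integration.integrable_mult_right integrable_real_indicator) (auto simp: fmeasurable_def)
    show "integrable lborel (\<lambda>y. indicator ?B y *\<^sub>R \<bar>f y - a\<bar>)"
      by (intro integrable_indicator_ball_abs_diff f fin) auto
    show "(a - t) * indicator D y \<le> indicator ?B y *\<^sub>R \<bar>f y - a\<bar>" for y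
      using t by (auto simp: D_def split: split_indicator)
  qed
  also have "\<dots> < (a - t) / 2 * measure lborel ?B"
    using mean b by (simp add: mean_on_ball_eq set_lebesgue_integral_def divide_less_eq)
  finally have "(a - t) * measure lborel D < (a - t) * (measure lborel ?B / 2)" by simp
  then have lt: "measure lborel D < measure lborel ?B / 2" using t by (simp only: mult_less_cancel_left_pos diff_gt_0_iff_gt)
  have "{y. t < f y} \<inter> ?B = ?B - D" by (auto simp: D_def)
  then have "measure lborel ({y. t < f y} \<inter> ?B) = measure lborel ?B - measure lborel D"
    using D fin by (auto simp: fmeasurable_def D_def intro!: measure_Diff)
  then show "\<exists>r>0. r < e \<and> measure lborel (ball x r) / 2 \<le> measure lborel ({y. t < f y} \<inter> ball x r)"
    using lt r by (intro exI[of _ r]) auto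
qed

lemma Lebesgue_value_half_dense_below:
  fixes f :: "'a::euclidean_space \<Rightarrow> real"
  assumes f: "integrable lborel f" and L: "Lebesgue_value f x a" and t: "a < t"
  shows "half_dense_at {y. f y < t} x"
proof -
  have "Lebesgue_value (\<lambda>y. - f y) x (- a)"
    using L by (simp add: Lebesgue_value_def abs_minus_commute)
  from Lebesgue_value_half_dense[OF _ this, of "- t"] f t show ?thesis by simp
qed

text \<open>Average \<open>\<bar>a - b\<bar> \<le> \<bar>f y - a\<bar> + \<bar>f y - b\<bar>\<close>
  over small balls. This makes the description operator in \<open>precise_representative\<close>
  well defined at Lebesgue points.\<close>

lemma Lebesgue_value_unique:
  fixes f :: "'a::euclidean_space \<Rightarrow> real"
  assumes f: "integrable lborel f" and L: "Lebesgue_value f x a" "Lebesgue_value f x b"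
  shows "a = b"
proof -
  have [measurable]: "f \<in> borel_measurable borel" using f by auto
  have "((\<lambda>r. mean_on (ball x r) (\<lambda>y. \<bar>f y - a\<bar>) + mean_on (ball x r) (\<lambda>y. \<bar>f y - b\<bar>)) \<longlongrightarrow> 0 + 0) (at_right 0)"
    using L unfolding Lebesgue_value_def by (rule tendsto_add)
  moreover have "\<forall>\<^sub>F r in at_right 0. \<bar>a - b\<bar> \<le> mean_on (ball x r) (\<lambda>y. \<bar>f y - a\<bar>) + mean_on (ball x r) (\<lambda>y. \<bar>f y - b\<bar>)"
    unfolding eventually_at_right_field
  proof (intro exI[of _ 1] conjI allI impI)
    fix r :: real assume "0 < r"
    let ?B = "ball x r"
    have fin: "emeasure lborel ?B < \<infinity>" by (rule emeasure_lborel_ball_finite)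
    have b: "measure lborel ?B > 0" using \<open>0 < r\<close> by (simp add: content_ball)
    have i: "integrable lborel (\<lambda>y. indicator ?B y *\<^sub>R \<bar>f y - c\<bar>)" for c
      by (intro integrable_indicator_ball_abs_diff f fin) auto
    have "\<bar>a - b\<bar> * measure lborel ?B = (LINT y|lborel. \<bar>a - b\<bar> * indicator ?B y)" by simp
    also have "\<dots> \<le> (LINT y|lborel. indicator ?B y *\<^sub>R \<bar>f y - a\<bar> + indicator ?B y *\<^sub>R \<bar>f y - b\<bar>)"
      using i fin by (intro integral_mono Bochner_Integration.integrable_mult_right integrable_real_indicator Bochner_Integration.integrable_add)
        (auto split: split_indicator)
    also have "\<dots> = (LINT y:?B|lborel. \<bar>f y - a\<bar>) + (LINT y:?B|lborel. \<bar>f y - b\<bar>)"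
      unfolding set_lebesgue_integral_def using i by (intro Bochner_Integration.integral_add)
    finally show "\<bar>a - b\<bar> \<le> mean_on ?B (\<lambda>y. \<bar>f y - a\<bar>) + mean_on ?B (\<lambda>y. \<bar>f y - b\<bar>)"
      using b by (simp add: mean_on_ball_eq pos_le_divide_eq flip: add_divide_distrib)
  qed simp
  ultimately have "\<bar>a - b\<bar> \<le> 0 + 0" by (rule tendsto_lowerbound) (simp add: trivial_limit_at_right_real)
  then show ?thesis by simp
qed

lemma Lebesgue_value_precise_representative:
  fixes f :: "'a::euclidean_space \<Rightarrow> real"
  assumes "integrable lborel f" "x \<in> Lebesgue_points \<Omega> f"
  shows "Lebesgue_value f x (precise_representative f x)"
proof -
  obtain a where a: "Lebesgue_value f x a" using assms(2) by (auto simp: Lebesgue_points_def)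
  then have "precise_representative f x = a"
    unfolding precise_representative_def by (rule the_equality) (rule Lebesgue_value_unique[OF assms(1) _ a])
  with a show ?thesis by simp
qed

lemma AE_half_dense:
  fixes E :: "'a::euclidean_space set"
  assumes "E \<in> sets borel"
  shows "AE x in lborel. x \<in> E \<longrightarrow> half_dense_at E x"
proof -
  have "{x\<in>E. \<not> half_dense_at E x} \<in> null_sets lebesgue"
    using negligible_not_half_dense[OF assms] by (simp add: negligible_iff_null_sets)
  then have "AE x in lebesgue. x \<notin> {x\<in>E. \<not> half_dense_at E x}" by (rule AE_not_in)
  then have "AE x in lborel. x \<notin> {x\<in>E. \<not> half_dense_at E x}" by (simp only: AE_completion_iff)
  then show ?thesis by eventually_elim auto
qed

text \<open>The truncated inequality with \<open>q = 1\<close> and Lebesgue measure on \<Omega>. The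
  growth exponent \<open>s * (n - 1)\<close> is at most \<open>n\<close>, and for radii up to
  \<open>R\<close> the excess power of \<open>r\<close> is absorbed into
  \<open>R ^ n\<close>.\<close>

lemma integral_deviation_le:
  fixes f :: "'a::euclidean_space \<Rightarrow> real" and \<Omega> :: "'a set"
  assumes J: "distance_John_domain s C x\<^sub>J \<Omega>" 
    and B: "B = ball x\<^sub>J (infdist x\<^sub>J (frontier \<Omega>) / 4)"
    and f: "integrable lborel f" and T: "total_variation \<Omega> f = ennreal T" "0 \<le> T"
    and m: "measure lborel ({x. m < f x} \<inter> B) \<le> measure lborel B / 2"
      "measure lborel ({x. f x < m} \<inter> B) \<le> measure lborel B / 2"
    and K: "K = 4 * C + max 1 (diameter \<Omega>)" and R: "R = 5 * K * max 1 (diameter \<Omega>)"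
    and s: "s * (real DIM('a) - 1) \<le> real DIM('a)"
  shows "(LINT x:\<Omega>|lborel. \<bar>f x - m\<bar>) \<le>
    max 1 (unit_ball_vol DIM('a) * R ^ DIM('a)) * (5 * K) ^ DIM('a) *
     (4 * 3 ^ (DIM('a) + 1) / (unit_ball_vol DIM('a))\<^sup>2) * (2 * unit_ball_vol DIM('a)) * T" (is "_ \<le> ?C1")
proof -
  let ?n = "DIM('a)"
  have [measurable]: "f \<in> borel_measurable borel" using f by auto
  have o: "open \<Omega>" "bounded \<Omega>" and CJ: "C \<ge> 1" "s \<ge> 1" using J by (auto simp: distance_John_domain_def bounded_domain_def)
  have [measurable]: "\<Omega> \<in> sets borel" using o by simp
  have K1: "K \<ge> 1" using CJ K by simp
  have "1 * 1 \<le> 5 * K * max 1 (diameter \<Omega>)" using K1 by (intro mult_mono) auto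
  then have R1: "R \<ge> 1" using R by simp
  have fin: "emeasure lborel \<Omega> < \<infinity>" using o by (intro emeasure_bounded_finite)
  define \<nu> where "\<nu> = density lborel (indicator \<Omega> :: 'a \<Rightarrow> ennreal)"
  have \<nu>: "emeasure \<nu> A = emeasure lborel (\<Omega> \<inter> A)" if "A \<in> sets borel" for A
    using that unfolding \<nu>_def by (subst emeasure_density) (auto simp: indicator_inter_arith[symmetric] Int_commute)
  have im: "(indicator \<Omega> :: 'a \<Rightarrow> ennreal) \<in> borel_measurable lborel" by simp
  define G where "G x = indicator \<Omega> x *\<^sub>R \<bar>f x - m\<bar>" for x
  have G: "integrable lborel G" unfolding G_def by (intro integrable_indicator_ball_abs_diff f fin) auto
  have G0: "0 \<le> G x" for x by (simp add: G_def)
  have [measurable]: "G \<in> borel_measurable borel" using G by auto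
  have Gi: "(\<integral>\<^sup>+x. ennreal (G x powr 1) \<partial>\<nu>) = ennreal (LINT x:\<Omega>|lborel. \<bar>f x - m\<bar>)"
  proof -
    have "(\<integral>\<^sup>+x. ennreal (G x powr 1) \<partial>\<nu>) = (\<integral>\<^sup>+x. ennreal (G x) \<partial>lborel)"
      unfolding \<nu>_def using G0
      by (subst nn_integral_density) (auto intro!: nn_integral_cong simp: G_def split: split_indicator)
    also have "\<dots> = ennreal (LINT x|lborel. G x)" using G G0 by (intro nn_integral_eq_integral) auto
    finally show ?thesis by (simp add: G_def[abs_def] set_lebesgue_integral_def)
  qed
  have "(\<integral>\<^sup>+x. ennreal (G x powr 1) \<partial>\<nu>) \<le> ennreal ((max 1 (unit_ball_vol ?n * R ^ ?n) * (5 * K) ^ ?n * (4 * 3 ^ (?n + 1) / (unit_ball_vol ?n)\<^sup>2) *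
      (2 * unit_ball_vol ?n) * T) powr 1)"
  proof (rule trace_inequality_truncated[OF J B f T m K])
    show "finite_measure \<nu>" by (rule finite_measureI) (use \<nu>[of UNIV] fin in \<open>auto simp: \<nu>_def\<close>)
    show "sets \<nu> = sets borel" by (simp add: \<nu>_def)
    fix x and r :: real assume r: "0 < r" "r \<le> 5 * K * max 1 (diameter \<Omega>)"
    let ?e = "1 * s * (real ?n - 1)"
    have "emeasure \<nu> (ball x r) \<le> emeasure lborel (ball x r)"
      by (subst \<nu>) (auto intro!: emeasure_mono)
    also have "\<dots> = ennreal (unit_ball_vol ?n * r ^ ?n)" using r by (simp add: emeasure_ball)
    also have "\<dots> \<le> ennreal (max 1 (unit_ball_vol ?n * R ^ ?n) * r powr ?e)"
    proof (rule ennreal_leI)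
      have "r ^ ?n = r powr (real ?n - ?e) * r powr ?e" using r by (simp add: powr_realpow flip: powr_add)
      also have "\<dots> \<le> R powr (real ?n - ?e) * r powr ?e"
        using r R s by (intro mult_right_mono powr_mono2) auto
      also have "\<dots> \<le> R powr real ?n * r powr ?e"
        using R1 CJ by (intro mult_right_mono powr_mono) (auto simp: Suc_leI)
      also have "R powr real ?n = R ^ ?n" using R1 by (simp add: powr_realpow)
      finally have "unit_ball_vol ?n * r ^ ?n \<le> unit_ball_vol ?n * (R ^ ?n * r powr ?e)"
        by (rule mult_left_mono) simp
      also have "\<dots> = (unit_ball_vol ?n * R ^ ?n) * r powr ?e" by simp
      also have "\<dots> \<le> max 1 (unit_ball_vol ?n * R ^ ?n) * r powr ?e" by (intro mult_right_mono) auto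
      finally show "unit_ball_vol ?n * r ^ ?n \<le> max 1 (unit_ball_vol ?n * R ^ ?n) * r powr ?e" .
    qed
    finally show "emeasure \<nu> (ball x r) \<le> ennreal (max 1 (unit_ball_vol ?n * R ^ ?n) * r powr ?e)" .
  next
    show "(\<integral>\<^sup>+x. ennreal (G x powr 1) \<partial>\<nu>) \<noteq> \<infinity>" by (subst Gi) simp
    fix t :: real assume t: "0 < t"
    have "AE x in lborel. x \<in> {y. m + t < f y} \<longrightarrow> half_dense_at {y. m + t < f y} x"
      and "AE x in lborel. x \<in> {y. f y < m - t} \<longrightarrow> half_dense_at {y. f y < m - t} x"
      by (intro AE_half_dense; measurable)+
    then have "AE x in lborel. t < G x \<longrightarrow> x \<in> \<Omega> \<and> (half_dense_at {y. m + t < f y} x \<or> half_dense_at {y. f y < m - t} x)"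
    proof eventually_elim
      case (elim x)
      show ?case
      proof
        assume tG: "t < G x"
        then have x: "x \<in> \<Omega>" using t by (cases "x \<in> \<Omega>") (auto simp: G_def)
        then have "t < \<bar>f x - m\<bar>" using tG by (simp add: G_def)
        then have "m + t < f x \<or> f x < m - t" by linarith
        then show "x \<in> \<Omega> \<and> (half_dense_at {y. m + t < f y} x \<or> half_dense_at {y. f y < m - t} x)"
          using elim x by blast
      qed
    qed
    then have "AE x in lborel. 0 < (indicator \<Omega> x :: ennreal) \<longrightarrow> t < G x \<longrightarrow> x \<in> \<Omega> \<and> (half_dense_at {y. m + t < f y} x \<or> half_dense_at {y. f y < m - t} x)"
      by eventually_elim blast
    then show "AE x in \<nu>. t < G x \<longrightarrow> x \<in> \<Omega> \<and> (half_dense_at {y. m + t < f y} x \<or> half_dense_at {y. f y < m - t} x)"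
      unfolding \<nu>_def by (simp only: AE_density[OF im])
  next
    show "G x \<ge> 0" for x by (rule G0)
    show "1 * s * (real ?n - 1) \<le> real ?n" using s by simp
  qed simp_all
  moreover have "0 \<le> ?C1"
  proof (intro mult_nonneg_nonneg divide_nonneg_nonneg zero_le_power)
    show "0 \<le> max 1 (unit_ball_vol ?n * R ^ ?n)" by (rule order_trans[OF zero_le_one max.cobounded1])
  qed (use K1 T(2) in simp_all)
  ultimately have "ennreal (LINT x:\<Omega>|lborel. \<bar>f x - m\<bar>) \<le> ennreal ?C1"
    unfolding Gi by (simp only: powr_one)
  with \<open>0 \<le> ?C1\<close> show ?thesis by (simp only: ennreal_le_iff)
qed

section \<open>The trace inequality around the mean\<close>

lemma divergence_measurable:
  assumes "\<phi> \<in> C1_compact_support \<Omega>"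
  shows "divergence \<phi> \<in> borel_measurable borel"
proof -
  obtain \<phi>' where c: "continuous_on UNIV \<phi>'" and d: "\<And>x. (\<phi> has_derivative blinfun_apply (\<phi>' x)) (at x)"
    using assms by (auto simp: C1_compact_support_def)
  have "divergence \<phi> = (\<lambda>x. \<Sum>b\<in>Basis. \<phi>' x b \<bullet> b)"
    using frechet_derivative_at[OF d] by (auto simp: divergence_def)
  moreover have "continuous_on UNIV (\<lambda>x. \<Sum>b\<in>Basis. \<phi>' x b \<bullet> b)"
    by (intro continuous_intros c)
  ultimately show ?thesis by (simp add: borel_measurable_continuous_onI)
qed

text \<open>\<open>f\<close> is only Lebesgue measurable on \<Omega> and arbitrary outside. A Borel
  function equal to it almost everywhere on \<Omega> and zero outside has the same mean and total
  variation. Lebesgue values agree at every point of \<Omega>, since they ignore null sets and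
  involve only small balls.\<close>

lemma borel_representative_exists:
  fixes f :: "'a::euclidean_space \<Rightarrow> real"
  assumes f: "f absolutely_integrable_on \<Omega>" and \<Omega>: "open \<Omega>"
  shows "\<exists>g. integrable lborel g \<and> mean_on \<Omega> g = mean_on \<Omega> f \<and> total_variation \<Omega> g = total_variation \<Omega> f \<and>
    (\<forall>x\<in>\<Omega>. Lebesgue_value g x = Lebesgue_value f x)"
proof -
  define u where "u x = indicator \<Omega> x *\<^sub>R f x" for x
  have ui: "integrable lebesgue u"
    using f by (simp add: set_integrable_def u_def[abs_def])
  have [measurable]: "\<Omega> \<in> sets borel" using \<Omega> by simp
  have um[measurable]: "u \<in> borel_measurable (completion lborel)" using ui by auto
  obtain g0 where g0: "g0 \<in> borel_measurable lborel" "AE x in lborel. u x = g0 x"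
    using completion_ex_borel_measurable_real[OF um] by blast
  have [measurable]: "g0 \<in> borel_measurable borel" using g0(1) by simp
  define g where "g x = indicator \<Omega> x *\<^sub>R g0 x" for x
  have [measurable]: "g \<in> borel_measurable borel" unfolding g_def by measurable
  have gL[measurable]: "g \<in> borel_measurable lebesgue" by (rule measurable_completion) simp
  have lebm: "v \<in> borel_measurable lebesgue" if "v \<in> borel_measurable borel" for v :: "'a \<Rightarrow> real"
    by (rule measurable_completion) (use that in simp)
  have "AE x in lborel. u x = g x" using g0(2) by eventually_elim (auto simp: u_def g_def split: split_indicator_asm split_indicator)
  then have ae: "AE x in lebesgue. u x = g x" by (rule AE_completion)
  have "integrable lebesgue g"
    by (rule integrable_cong_AE_imp[OF ui gL]) (use ae in eventually_elim, simp)
  then have gi: "integrable lborel g" by (simp add: integrable_completion)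
  have prod: "(LINT x:\<Omega>|lebesgue. g x * d x) = (LINT x:\<Omega>|lebesgue. f x * d x)" if d: "d \<in> borel_measurable borel" for d
  proof -
    have [measurable]: "d \<in> borel_measurable lebesgue" by (rule lebm[OF d])
    have "(LINT x:\<Omega>|lebesgue. g x * d x) = (LINT x|lebesgue. g x * d x)"
      unfolding set_lebesgue_integral_def by (intro Bochner_Integration.integral_cong) (auto simp: g_def split: split_indicator)
    also have "\<dots> = (LINT x|lebesgue. u x * d x)"
    proof (rule integral_cong_AE)
      show "AE x in lebesgue. g x * d x = u x * d x" using ae by eventually_elim simp
    qed measurable
    also have "\<dots> = (LINT x:\<Omega>|lebesgue. f x * d x)"
      unfolding set_lebesgue_integral_def by (intro Bochner_Integration.integral_cong) (auto simp: u_def split: split_indicator)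
    finally show ?thesis .
  qed
  have "mean_on \<Omega> g = mean_on \<Omega> f" using prod[of "\<lambda>x. 1"] by (simp add: mean_on_def)
  moreover have "total_variation \<Omega> g = total_variation \<Omega> f"
    unfolding total_variation_def by (intro SUP_cong refl arg_cong[where f=ennreal] prod divergence_measurable) auto
  moreover have "Lebesgue_value g x a = Lebesgue_value f x a" if x: "x \<in> \<Omega>" for x a
  proof -
    obtain e where e: "e > 0" "ball x e \<subseteq> \<Omega>" using \<Omega> x open_contains_ball by blast
    have "mean_on (ball x r) (\<lambda>y. \<bar>g y - a\<bar>) = mean_on (ball x r) (\<lambda>y. \<bar>f y - a\<bar>)" if r: "r < e" for r
    proof -
      have sub: "ball x r \<subseteq> \<Omega>" using e(2) subset_ball[of r e x] r by auto
      have [measurable]: "indicat_real (ball x r) \<in> borel_measurable lebesgue" by (rule lebm) simp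
      have "(LINT y:ball x r|lebesgue. \<bar>g y - a\<bar>) = (LINT y|lebesgue. indicator (ball x r) y * \<bar>u y - a\<bar>)"
        unfolding set_lebesgue_integral_def real_scaleR_def
      proof (rule integral_cong_AE)
        show "AE y in lebesgue. indicator (ball x r) y * \<bar>g y - a\<bar> = indicator (ball x r) y * \<bar>u y - a\<bar>"
          using ae by eventually_elim simp
      qed measurable
      also have "\<dots> = (LINT y:ball x r|lebesgue. \<bar>f y - a\<bar>)"
        unfolding set_lebesgue_integral_def real_scaleR_def
      proof (rule Bochner_Integration.integral_cong[OF refl])
        fix y
        show "indicator (ball x r) y * \<bar>u y - a\<bar> = indicator (ball x r) y * \<bar>f y - a\<bar>"
          using subsetD[OF sub, of y] by (cases "y \<in> ball x r") (simp_all add: u_def del: mem_ball)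
      qed
      finally show ?thesis by (simp add: mean_on_def)
    qed
    then have "\<forall>\<^sub>F r in at_right 0. mean_on (ball x r) (\<lambda>y. \<bar>g y - a\<bar>) = mean_on (ball x r) (\<lambda>y. \<bar>f y - a\<bar>)"
      using eventually_at_right_real[OF e(1)] by (auto elim: eventually_mono)
    then show ?thesis unfolding Lebesgue_value_def by (rule tendsto_cong)
  qed
  ultimately show ?thesis using gi by blast
qed

text \<open>The John condition at the end of each curve bounds the distance of every point from the
  John centre by a power of \<open>C\<close> times the distance from that centre to the frontier.
  The diameter is thus controlled by this distance, and the ball of that radius yields a volume
  bound in terms of the dimension, the diameter, \<open>s\<close> and \<open>C\<close>.\<close>

lemma John_domain_size:
  fixes \<Omega> :: "'a::euclidean_space set"
  assumes J: "distance_John_domain s C x\<^sub>J \<Omega>"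
  shows "0 < diameter \<Omega>" "\<Omega> \<subseteq> ball x\<^sub>J (2 * max 1 (diameter \<Omega>))"
    "unit_ball_vol DIM('a) * ((diameter \<Omega> / 2) powr s / C) ^ DIM('a) \<le> measure lborel \<Omega>"
proof -
  let ?D = "diameter \<Omega>" and ?d = "infdist x\<^sub>J (frontier \<Omega>)"
  have o: "open \<Omega>" "bounded \<Omega>" "x\<^sub>J \<in> \<Omega>" and C: "C \<ge> 1" "s \<ge> 1"
    using J by (auto simp: distance_John_domain_def bounded_domain_def)
  obtain e where e: "e > 0" "ball x\<^sub>J e \<subseteq> \<Omega>" using o open_contains_ball by blast
  show D: "0 < ?D" using ball_subset_radius_le[of "e/4" x\<^sub>J \<Omega>] e o by simp
  show "\<Omega> \<subseteq> ball x\<^sub>J (2 * max 1 ?D)"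
  proof
    fix y assume "y \<in> \<Omega>"
    then have "dist x\<^sub>J y \<le> ?D" using o by (intro diameter_bounded_bound)
    then show "y \<in> ball x\<^sub>J (2 * max 1 ?D)" by simp
  qed
  have near: "dist x\<^sub>J y \<le> (C * ?d) powr (1/s)" if y: "y \<in> \<Omega>" for y
  proof -
    obtain \<gamma> where "pathfinish \<gamma> = x\<^sub>J" "\<And>t. t \<in> {0..1} \<Longrightarrow> norm (\<gamma> t - y) powr s < C * infdist (\<gamma> t) (frontier \<Omega>)"
      using J y unfolding distance_John_domain_def by blast
    then have "norm (x\<^sub>J - y) powr s < C * ?d" by (force simp: pathfinish_def)
    then have "(norm (x\<^sub>J - y) powr s) powr (1/s) \<le> (C * ?d) powr (1/s)"
      using C by (intro powr_mono2) auto
    then show ?thesis using C by (simp add: powr_powr dist_norm)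
  qed
  have "?D \<le> 2 * (C * ?d) powr (1/s)"
  proof (rule diameter_le)
    show "norm (y - z) \<le> 2 * (C * ?d) powr (1/s)" if "y \<in> \<Omega>" "z \<in> \<Omega>" for y z
    proof -
      have "dist y z \<le> dist x\<^sub>J y + dist x\<^sub>J z" by (rule dist_triangle3)
      then show ?thesis using near[OF that(1)] near[OF that(2)] by (simp add: dist_norm)
    qed
  qed (use o in auto)
  then have "(?D / 2) powr s \<le> ((C * ?d) powr (1/s)) powr s" using D C by (intro powr_mono2) auto
  also have "\<dots> = C * ?d"
  proof -
    have "0 \<le> C * ?d" using C by (intro mult_nonneg_nonneg infdist_nonneg) auto
    then show ?thesis using C by (simp add: powr_powr)
  qed
  finally have "(?D / 2) powr s / C \<le> ?d" using C by (simp add: divide_le_eq mult.commute)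
  then have "unit_ball_vol DIM('a) * ((?D / 2) powr s / C) ^ DIM('a) \<le> unit_ball_vol DIM('a) * ?d ^ DIM('a)"
    using C by (intro mult_left_mono power_mono) auto
  also have "\<dots> = measure lborel (ball x\<^sub>J ?d)" by (simp add: content_ball infdist_nonneg)
  also have "\<dots> \<le> measure lborel \<Omega>"
  proof (rule measure_mono_fmeasurable)
    show "ball x\<^sub>J ?d \<subseteq> \<Omega>" by (rule ball_infdist_frontier_subset[OF o(3)])
    show "\<Omega> \<in> fmeasurable lborel" using o emeasure_bounded_finite[OF o(2)] by (auto simp: fmeasurable_def)
  qed simp
  finally show "unit_ball_vol DIM('a) * ((?D / 2) powr s / C) ^ DIM('a) \<le> measure lborel \<Omega>" .
qed

text \<open>The integral of \<open>m - f\<close> over \<Omega> is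
  \<open>m - mean_on \<Omega> f\<close> times the volume. The lower bound \<open>v\<close> stands in
  for the volume so that the resulting constant can be expressed by the diameter.\<close>

lemma mean_deviation_le:
  fixes f :: "'a::euclidean_space \<Rightarrow> real"
  assumes f: "integrable lborel f" and \<Omega>: "open \<Omega>" "bounded \<Omega>"
    and I: "(LINT x:\<Omega>|lborel. \<bar>f x - m\<bar>) \<le> I"
    and v: "0 < v" "v \<le> measure lborel \<Omega>"
  shows "\<bar>m - mean_on \<Omega> f\<bar> \<le> I / v"
proof -
  have [measurable]: "f \<in> borel_measurable borel" "\<Omega> \<in> sets borel" using f \<Omega> by auto
  have fin: "emeasure lborel \<Omega> < \<infinity>" using \<Omega> by (intro emeasure_bounded_finite)
  let ?V = "measure lborel \<Omega>"
  have V: "?V > 0" using v by simp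
  have i1: "integrable lborel (\<lambda>x. indicator \<Omega> x *\<^sub>R f x)"
    using integrable_real_mult_indicator[of \<Omega> lborel f] f by (simp add: mult.commute)
  have i2: "integrable lborel (\<lambda>x. indicator \<Omega> x *\<^sub>R m)" using fin by simp
  have mean: "mean_on \<Omega> f = (LINT x|lborel. indicator \<Omega> x *\<^sub>R f x) / ?V"
    unfolding mean_on_def set_lebesgue_integral_def by (subst integral_completion) auto
  have "m * ?V = (LINT x|lborel. indicator \<Omega> x *\<^sub>R m)" using fin by simp
  then have "(m - mean_on \<Omega> f) * ?V = (LINT x|lborel. indicator \<Omega> x *\<^sub>R m - indicator \<Omega> x *\<^sub>R f x)"
    using V i1 i2 by (subst Bochner_Integration.integral_diff) (auto simp: mean left_diff_distrib)
  then have "\<bar>m - mean_on \<Omega> f\<bar> * ?V = \<bar>LINT x|lborel. indicator \<Omega> x *\<^sub>R m - indicator \<Omega> x *\<^sub>R f x\<bar>"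
    using V by (metis abs_mult abs_of_pos)
  also have "\<dots> \<le> (LINT x|lborel. \<bar>indicator \<Omega> x *\<^sub>R m - indicator \<Omega> x *\<^sub>R f x\<bar>)"
    by (rule integral_abs_bound)
  also have "\<dots> = (LINT x:\<Omega>|lborel. \<bar>f x - m\<bar>)"
    unfolding set_lebesgue_integral_def
    by (intro Bochner_Integration.integral_cong) (auto simp: abs_minus_commute split: split_indicator)
  finally have "\<bar>m - mean_on \<Omega> f\<bar> * ?V \<le> I" using I by linarith
  then have "\<bar>m - mean_on \<Omega> f\<bar> * v \<le> I"
    using mult_left_mono[OF v(2), of "\<bar>m - mean_on \<Omega> f\<bar>"] by linarith
  then show ?thesis using v(1) by (simp add: pos_le_divide_eq)
qed

section \<open>The explicit constant and the estimate for Borel functions\<close>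

lemma sum_powr_le:
  fixes a b :: real
  assumes "0 \<le> a" "0 \<le> b" "1 \<le> q"
  shows "(a + b) powr q \<le> 2 powr q * (a powr q + b powr q)"
proof -
  have "(a + b) powr q \<le> (2 * max a b) powr q" using assms by (intro powr_mono2) auto
  also have "\<dots> = 2 powr q * max a b powr q" using assms by (simp add: powr_mult)
  also have "\<dots> \<le> 2 powr q * (a powr q + b powr q)" by (intro mult_left_mono) (auto simp: max_def)
  finally show ?thesis .
qed

text \<open>\<open>A\<close> is the constant of \<open>trace_inequality_truncated\<close> without
  the growth factor. \<open>C1\<close> bounds the gap between median and mean per unit of total
  variation, and \<open>M * (2 * max 1 D) ^ n\<close> bounds the \<mu>-measure of \<Omega>. The
  leading 2 stems from splitting the power of a sum.\<close>

definition trace_constant :: "nat \<Rightarrow> real \<Rightarrow> real \<Rightarrow> real \<Rightarrow> real \<Rightarrow> real" where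
  "trace_constant n s M C D = (let
     K = 4 * C + max 1 D; R = 5 * K * max 1 D; w = unit_ball_vol n;
     A = (5 * K) ^ n * (4 * 3 ^ (n + 1) / w\<^sup>2) * (2 * w);
     C1 = max 1 (w * R ^ n) * A / (w * ((D / 2) powr s / C) ^ n)
   in 2 * (M * A + C1 * (M * (2 * max 1 D) ^ n)))"

text \<open>The integrand is not known to be measurable, so the bound is proved for every simple
  function below it, which is Borel and bounded. Subtracting \<open>c\<close>, the gap between
  median and mean, turns deviations from the mean into deviations from the median.\<close>

lemma trace_inequality:
  fixes f :: "'a::euclidean_space \<Rightarrow> real" and \<mu> :: "'a measure"
  assumes J: "distance_John_domain s C x\<^sub>J \<Omega>" 
    and f: "integrable lborel f" and T: "total_variation \<Omega> f = ennreal T" "0 \<le> T"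
    and q: "1 \<le> q" "q * s * (real DIM('a) - 1) \<le> real DIM('a)"
    and \<mu>: "sets \<mu> = sets borel" and M: "1 \<le> M"
    and growth: "\<And>x r. 0 < r \<Longrightarrow> emeasure \<mu> (ball x r) \<le> ennreal (M * r powr (q * s * (real DIM('a) - 1)))"
  shows "(\<integral>\<^sup>+x\<in>Lebesgue_points \<Omega> f. ennreal (\<bar>precise_representative f x - mean_on \<Omega> f\<bar> powr q) \<partial>\<mu>)
    \<le> ennreal ((trace_constant DIM('a) s M C (diameter \<Omega>) * T) powr q)"
proof -
  let ?n = "DIM('a)" and ?D = "diameter \<Omega>"
  define K where "K = 4 * C + max 1 ?D"
  define R where "R = 5 * K * max 1 ?D"
  define w where "w = unit_ball_vol ?n"
  define A where "A = (5 * K) ^ ?n * (4 * 3 ^ (?n + 1) / w\<^sup>2) * (2 * w)"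
  define v where "v = w * ((?D / 2) powr s / C) ^ ?n"
  define C1 where "C1 = max 1 (w * R ^ ?n) * A / v"
  define V0 where "V0 = M * (2 * max 1 ?D) ^ ?n"
  define B where "B = ball x\<^sub>J (infdist x\<^sub>J (frontier \<Omega>) / 4)"
  have const: "trace_constant ?n s M C ?D = 2 * (M * A + C1 * V0)"
    unfolding trace_constant_def Let_def C1_def V0_def v_def A_def R_def K_def w_def by (rule refl)
  have o: "open \<Omega>" "bounded \<Omega>" and CJ: "C \<ge> 1" "s \<ge> 1" using J by (auto simp: distance_John_domain_def bounded_domain_def)
  have n1: "real ?n \<ge> 1" by (simp add: Suc_leI)
  have \<Omega>b[measurable]: "\<Omega> \<in> sets borel" using o by simp
  note size = John_domain_size[OF J]
  have w: "w > 0" by (simp add: w_def)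
  have K1: "K \<ge> 1" using CJ by (simp add: K_def)
  have A: "A > 0" unfolding A_def using K1 w by (intro mult_pos_pos divide_pos_pos zero_less_power) auto
  have v: "v > 0" unfolding v_def using w size(1) CJ by (intro mult_pos_pos zero_less_power divide_pos_pos) auto
  have C1: "C1 \<ge> 0" unfolding C1_def using A v by (intro divide_nonneg_nonneg mult_nonneg_nonneg) auto
  have "1 * 1 \<le> M * (2 * max 1 ?D) ^ ?n" using M by (intro mult_mono one_le_power) auto
  then have V1: "V0 \<ge> 1" by (simp add: V0_def)
  have fm[measurable]: "f \<in> borel_measurable borel" using f by auto
  obtain m where m: "measure lborel ({x. m < f x} \<inter> B) \<le> measure lborel B / 2"
      "measure lborel ({x. f x < m} \<inter> B) \<le> measure lborel B / 2"
    using median_exists[OF fm] unfolding B_def by blast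
  have "1 * (s * (real ?n - 1)) \<le> q * (s * (real ?n - 1))"
    using q(1) CJ n1 by (intro mult_right_mono mult_nonneg_nonneg) auto
  then have sn: "s * (real ?n - 1) \<le> real ?n" using q(2) by (simp add: mult.assoc)
  have dev: "(LINT x:\<Omega>|lborel. \<bar>f x - m\<bar>) \<le> max 1 (w * R ^ ?n) * A * T"
    using integral_deviation_le[OF J B_def f T m K_def R_def sn] by (simp only: w_def A_def mult.assoc)
  define c where "c = \<bar>m - mean_on \<Omega> f\<bar>"
  have cT: "c \<le> C1 * T"
    using mean_deviation_le[OF f o dev v] size(3) by (simp add: c_def C1_def v_def w_def)
  have c0: "c \<ge> 0" by (simp add: c_def)
  \<comment> \<open>The restriction to \<Omega> is finite by the growth bound, and simple functions
    below the integrand vanish outside \<Omega>.\<close>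
  define \<nu> where "\<nu> = density \<mu> (indicator \<Omega> :: 'a \<Rightarrow> ennreal)"
  have s\<nu>: "sets \<nu> = sets borel" by (simp add: \<nu>_def \<mu>)
  have im: "(indicator \<Omega> :: 'a \<Rightarrow> ennreal) \<in> borel_measurable \<mu>" using \<Omega>b \<mu> by (intro borel_measurable_indicator) simp
  have \<nu>: "emeasure \<nu> S = emeasure \<mu> (\<Omega> \<inter> S)" if "S \<in> sets borel" for S
    using that \<mu> \<Omega>b im unfolding \<nu>_def
    by (subst emeasure_density) (auto simp: indicator_inter_arith[symmetric] nn_integral_indicator)
  have sp: "space \<nu> = UNIV" "space \<mu> = UNIV"
    using sets_eq_imp_space_eq[OF s\<nu>] sets_eq_imp_space_eq[OF \<mu>] by auto
  let ?e = "q * s * (real ?n - 1)"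
  have \<nu>V: "emeasure \<nu> UNIV \<le> ennreal V0"
  proof -
    have "emeasure \<nu> UNIV = emeasure \<mu> \<Omega>" by (simp add: \<nu>)
    also have "\<dots> \<le> emeasure \<mu> (ball x\<^sub>J (2 * max 1 ?D))" using size(2) \<mu> by (intro emeasure_mono) auto
    also have "\<dots> \<le> ennreal (M * (2 * max 1 ?D) powr ?e)" by (intro growth) simp
    also have "\<dots> \<le> ennreal (M * (2 * max 1 ?D) powr real ?n)"
      using M q by (intro ennreal_leI mult_left_mono powr_mono) auto
    also have "(2 * max 1 ?D) powr real ?n = (2 * max 1 ?D) ^ ?n" by (intro powr_realpow) simp
    finally show ?thesis by (simp add: V0_def)
  qed
  have fin\<nu>: "finite_measure \<nu>"
  proof (rule finite_measureI)
    show "emeasure \<nu> (space \<nu>) \<noteq> \<infinity>" unfolding sp using \<nu>V by (auto simp: top_unique)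
  qed
  interpret \<nu>: finite_measure \<nu> by fact
  let ?F = "\<lambda>x. ennreal (\<bar>precise_representative f x - mean_on \<Omega> f\<bar> powr q) * indicator (Lebesgue_points \<Omega> f) x"
  have bound: "integral\<^sup>S \<mu> g \<le> ennreal ((trace_constant ?n s M C ?D * T) powr q)"
    if g: "simple_function \<mu> g" "g \<le> ?F" for g
  proof -
    have gF: "g x \<le> ?F x" for x using g(2) by (simp add: le_fun_def)
    have gfin: "g x < \<infinity>" for x using gF[of x] by (auto simp: less_top[symmetric] top_unique split: split_indicator_asm)
    have gm: "g \<in> borel_measurable borel"
      using borel_measurable_simple_function[OF g(1)] \<mu> by (simp cong: measurable_cong_sets)
    define G0 where "G0 x = enn2real (g x) powr (1/q)" for x
    have G00: "G0 x \<ge> 0" for x by (simp add: G0_def)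
    have gG: "g x = ennreal (G0 x powr q)" for x
      using gfin[of x] q by (simp add: G0_def powr_powr)
    have G0m[measurable]: "G0 \<in> borel_measurable borel" unfolding G0_def using gm by measurable
    have G0le: "x \<in> Lebesgue_points \<Omega> f \<and> G0 x \<le> \<bar>precise_representative f x - mean_on \<Omega> f\<bar>" if "0 < G0 x" for x
    proof -
      have pos: "0 < G0 x powr q" using that by simp
      have le: "ennreal (G0 x powr q) \<le> ?F x" using gF[of x] gG[of x] by simp
      then have x: "x \<in> Lebesgue_points \<Omega> f" using pos by (auto split: split_indicator_asm)
      then have le': "G0 x powr q \<le> \<bar>precise_representative f x - mean_on \<Omega> f\<bar> powr q" using le by simp
      have "G0 x \<le> \<bar>precise_representative f x - mean_on \<Omega> f\<bar>"
      proof (rule ccontr)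
        assume "\<not> ?thesis"
        then have "\<bar>precise_representative f x - mean_on \<Omega> f\<bar> powr q < G0 x powr q"
          using q by (intro powr_less_mono2) auto
        then show False using le' by simp
      qed
      with x show ?thesis ..
    qed
    have g\<nu>: "integral\<^sup>S \<mu> g = (\<integral>\<^sup>+x. ennreal (G0 x powr q) \<partial>\<nu>)"
    proof -
      have "integral\<^sup>S \<mu> g = (\<integral>\<^sup>+x. g x \<partial>\<mu>)" by (rule nn_integral_eq_simple_integral[OF g(1), symmetric])
      also have "\<dots> = (\<integral>\<^sup>+x. indicator \<Omega> x * g x \<partial>\<mu>)"
      proof (rule nn_integral_cong)
        fix x
        have "g x = 0" if "x \<notin> \<Omega>"
          using gF[of x] that by (auto simp: Lebesgue_points_def)
        then show "g x = indicator \<Omega> x * g x" by (auto split: split_indicator)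
      qed
      also have "\<dots> = (\<integral>\<^sup>+x. g x \<partial>\<nu>)"
        unfolding \<nu>_def by (rule nn_integral_density[OF im borel_measurable_simple_function[OF g(1)], symmetric])
      finally show ?thesis by (simp add: gG)
    qed
    \<comment> \<open>The largest value of the simple function gives the finiteness required by
      Minkowski's inequality.\<close>
    have gb: "(\<integral>\<^sup>+x. ennreal (G0 x powr q) \<partial>\<nu>) \<noteq> \<infinity>"
    proof -
      have finr: "finite (range g)" using simple_functionD(1)[OF g(1)] sp by simp
      define b where "b = Max (range g)"
      have b: "g x \<le> b" for x using finr by (simp add: b_def)
      have "b \<in> range g" unfolding b_def using finr by (intro Max_in) auto
      then have "b < \<infinity>" using gfin by auto
      have "(\<integral>\<^sup>+x. ennreal (G0 x powr q) \<partial>\<nu>) \<le> (\<integral>\<^sup>+x. b \<partial>\<nu>)"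
        using b by (intro nn_integral_mono) (simp flip: gG)
      also have "\<dots> < \<infinity>" using \<open>b < \<infinity>\<close> \<nu>V by (simp add: sp ennreal_mult_less_top \<nu>.emeasure_eq_measure)
      finally show ?thesis by simp
    qed
    \<comment> \<open>If \<open>G x > t\<close>, the precise representative differs from the mean by
      more than \<open>t + c\<close>, hence from \<open>m\<close> by more than
      \<open>t\<close>.\<close>
    define G where "G x = max 0 (G0 x - c)" for x
    have Gm[measurable]: "G \<in> borel_measurable borel" unfolding G_def by measurable
    have Gle: "(\<integral>\<^sup>+x. ennreal (G x powr q) \<partial>\<nu>) \<le> (\<integral>\<^sup>+x. ennreal (G0 x powr q) \<partial>\<nu>)"
      using G00 c0 q by (intro nn_integral_mono ennreal_leI powr_mono2) (auto simp: G_def)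
    have main: "(\<integral>\<^sup>+x. ennreal (G x powr q) \<partial>\<nu>) \<le>
      ennreal ((M * (5 * K) ^ ?n * (4 * 3 ^ (?n + 1) / (unit_ball_vol ?n)\<^sup>2) * (2 * unit_ball_vol ?n) * T) powr q)"
    proof (rule trace_inequality_truncated[OF J B_def f T m K_def q fin\<nu> s\<nu> M _ Gm])
      fix x and r :: real assume r: "0 < r"
      have "emeasure \<nu> (ball x r) \<le> emeasure \<mu> (ball x r)"
      proof -
        have "emeasure \<nu> (ball x r) = emeasure \<mu> (\<Omega> \<inter> ball x r)" by (rule \<nu>) simp
        also have "\<dots> \<le> emeasure \<mu> (ball x r)" by (rule emeasure_mono) (simp_all add: \<mu>)
        finally show ?thesis .
      qed
      then show "emeasure \<nu> (ball x r) \<le> ennreal (M * r powr ?e)" using growth[OF r] by (rule order_trans)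
    next
      show "0 \<le> G x" for x by (simp add: G_def)
      show "(\<integral>\<^sup>+x. ennreal (G x powr q) \<partial>\<nu>) \<noteq> \<infinity>" using Gle gb by (auto simp: top_unique)
      fix t :: real assume t: "0 < t"
      show "AE x in \<nu>. t < G x \<longrightarrow> x \<in> \<Omega> \<and> (half_dense_at {y. m + t < f y} x \<or> half_dense_at {y. f y < m - t} x)"
      proof (rule AE_I2, rule impI)
        fix x assume "t < G x"
        then have tG: "t + c < G0 x" using t by (auto simp: G_def)
        then have "0 < G0 x" using t c0 by linarith
        note x = G0le[OF this]
        define a where "a = precise_representative f x"
        have L: "Lebesgue_value f x a" unfolding a_def using x by (intro Lebesgue_value_precise_representative[OF f]) auto
        have "t + c < \<bar>a - mean_on \<Omega> f\<bar>" using tG x by (simp add: a_def)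
        then have "m + t < a \<or> a < m - t" unfolding c_def by linarith
        then show "x \<in> \<Omega> \<and> (half_dense_at {y. m + t < f y} x \<or> half_dense_at {y. f y < m - t} x)"
          using Lebesgue_value_half_dense[OF f L] Lebesgue_value_half_dense_below[OF f L] x
          by (auto simp: Lebesgue_points_def)
      qed
    qed
    have eqA: "M * (5 * K) ^ ?n * (4 * 3 ^ (?n + 1) / (unit_ball_vol ?n)\<^sup>2) * (2 * unit_ball_vol ?n) * T = M * A * T"
      by (simp only: A_def w_def mult.assoc)
    have "(\<integral>\<^sup>+x. ennreal (G0 x powr q) \<partial>\<nu>) \<le> (\<integral>\<^sup>+x. ennreal (2 powr q) * (ennreal (G x powr q) + ennreal (c powr q)) \<partial>\<nu>)"
    proof (rule nn_integral_mono)
      fix x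
      have "G0 x powr q \<le> (G x + c) powr q" using G00 q by (intro powr_mono2) (auto simp: G_def)
      also have "\<dots> \<le> 2 powr q * (G x powr q + c powr q)" using c0 q by (intro sum_powr_le) (auto simp: G_def)
      finally show "ennreal (G0 x powr q) \<le> ennreal (2 powr q) * (ennreal (G x powr q) + ennreal (c powr q))"
        by (simp flip: ennreal_plus ennreal_mult)
    qed
    also have "\<dots> = ennreal (2 powr q) * ((\<integral>\<^sup>+x. ennreal (G x powr q) \<partial>\<nu>) + ennreal (c powr q) * emeasure \<nu> UNIV)"
    proof -
      have [measurable]: "G \<in> borel_measurable \<nu>" using Gm s\<nu> by (simp cong: measurable_cong_sets)
      show ?thesis by (simp add: nn_integral_cmult nn_integral_add sp)
    qed
    also have "\<dots> \<le> ennreal (2 powr q) * (ennreal ((M * A * T) powr q) + ennreal (c powr q) * ennreal V0)"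
      using main \<nu>V unfolding eqA by (intro mult_left_mono add_mono) auto
    also have "\<dots> = ennreal (2 powr q * ((M * A * T) powr q + c powr q * V0))"
      using V1 by (simp flip: ennreal_plus ennreal_mult)
    also have "\<dots> \<le> ennreal (2 powr q * ((M * A * T) powr q + (C1 * T * V0) powr q))"
    proof (intro ennreal_leI mult_left_mono add_left_mono)
      \<comment> \<open>\<open>V0\<close> is at least 1, so it can also be moved under the power
        \<open>q\<close>.\<close>
      have "c powr q * V0 \<le> (C1 * T) powr q * V0 powr q"
      proof (intro mult_mono)
        show "c powr q \<le> (C1 * T) powr q" using cT c0 q by (intro powr_mono2) auto
        have "V0 powr 1 \<le> V0 powr q" using V1 q by (intro powr_mono) auto
        then show "V0 \<le> V0 powr q" using V1 by simp
      qed (use V1 in auto)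
      also have "\<dots> = (C1 * T * V0) powr q" using C1 T(2) V1 by (subst powr_mult[of "C1 * T"]) auto
      finally show "c powr q * V0 \<le> (C1 * T * V0) powr q" .
    qed simp
    also have "\<dots> \<le> ennreal (2 powr q * (M * A * T + C1 * T * V0) powr q)"
      using M A T(2) C1 V1 q by (intro ennreal_leI mult_left_mono powr_add_powr_le) auto
    also have "2 powr q * (M * A * T + C1 * T * V0) powr q = (2 * (M * A * T + C1 * T * V0)) powr q"
      using M A T(2) C1 V1 by (subst powr_mult) auto
    also have "2 * (M * A * T + C1 * T * V0) = trace_constant ?n s M C ?D * T"
      unfolding const by (simp add: algebra_simps)
    finally show ?thesis unfolding g\<nu> .
  qed
  show ?thesis
    unfolding nn_integral_def by (rule SUP_least) (use bound in auto)
qed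

theorem corollary1p9:
  fixes n :: nat and s C\<^sub>\<mu> C\<^sub>J D :: real
  assumes "n = CARD('n::finite)" and "2 \<le> n"
    and "1 \<le> s" and "s \<le> real n / (real n - 1)"
    and "1 \<le> C\<^sub>\<mu>" and "1 \<le> C\<^sub>J"
  shows "\<exists>C>0. \<forall>(q::real) (\<alpha>::real) (\<Omega> :: (real^'n) set) x\<^sub>J \<mu>.
     1 \<le> q \<and> q \<le> real n / (s * (real n - 1)) \<and> \<alpha> = real n - q * s * (real n - 1) \<and>
     distance_John_domain s C\<^sub>J x\<^sub>J \<Omega> \<and> diameter \<Omega> = D \<and>
     Radon_measure \<mu> \<and>
     (\<forall>x r. 0 < r \<longrightarrow> emeasure \<mu> (ball x r) \<le> ennreal (C\<^sub>\<mu> * r powr (real n - \<alpha>))) \<longrightarrow>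
     (\<forall>f. f absolutely_integrable_on \<Omega> \<longrightarrow>
        ennreal_powr
          (\<integral>\<^sup>+x\<in>Lebesgue_points \<Omega> f.
             ennreal (\<bar>precise_representative f x - mean_on \<Omega> f\<bar> powr q) \<partial>\<mu>) (1 / q)
        \<le> ennreal C * total_variation \<Omega> f)"
proof (intro exI conjI allI impI)
  \<comment> \<open>The maximum with 1 secures positivity, which also makes the right-hand side
    infinite when the total variation is.\<close>
  let ?C = "max 1 (trace_constant n s C\<^sub>\<mu> C\<^sub>J D)"
  show "0 < ?C" by simp
  fix q \<alpha> :: real and \<Omega> :: "(real^'n) set" and x\<^sub>J and \<mu> :: "(real^'n) measure" and f :: "real^'n \<Rightarrow> real"
  assume H: "1 \<le> q \<and> q \<le> real n / (s * (real n - 1)) \<and> \<alpha> = real n - q * s * (real n - 1) \<and>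
     distance_John_domain s C\<^sub>J x\<^sub>J \<Omega> \<and> diameter \<Omega> = D \<and> Radon_measure \<mu> \<and>
     (\<forall>x r. 0 < r \<longrightarrow> emeasure \<mu> (ball x r) \<le> ennreal (C\<^sub>\<mu> * r powr (real n - \<alpha>)))"
    and f: "f absolutely_integrable_on \<Omega>"
  have dim: "DIM(real^'n) = n" using assms(1) by simp
  have J: "distance_John_domain s C\<^sub>J x\<^sub>J \<Omega>" and q1: "1 \<le> q" and D: "diameter \<Omega> = D"
    and \<mu>: "sets \<mu> = sets borel" using H by (auto simp: Radon_measure_def)
  have o: "open \<Omega>" using J by (auto simp: distance_John_domain_def bounded_domain_def)
  have q2: "q * s * (real DIM(real^'n) - 1) \<le> real DIM(real^'n)"
  proof -
    have "0 < s * (real n - 1)" using assms(2,3) by simp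
    moreover have "q \<le> real n / (s * (real n - 1))" using H by blast
    ultimately show ?thesis unfolding dim by (simp add: pos_le_divide_eq mult.assoc)
  qed
  have growth: "emeasure \<mu> (ball x r) \<le> ennreal (C\<^sub>\<mu> * r powr (q * s * (real DIM(real^'n) - 1)))" if "0 < r" for x r
  proof -
    have e: "q * s * (real n - 1) = real n - \<alpha>" using H by simp
    show ?thesis using H that unfolding dim e by blast
  qed
  obtain g where g: "integrable lborel g" "mean_on \<Omega> g = mean_on \<Omega> f" "total_variation \<Omega> g = total_variation \<Omega> f"
    "\<forall>x\<in>\<Omega>. Lebesgue_value g x = Lebesgue_value f x"
    using borel_representative_exists[OF f o] by blast
  let ?X = "\<integral>\<^sup>+x\<in>Lebesgue_points \<Omega> f. ennreal (\<bar>precise_representative f x - mean_on \<Omega> f\<bar> powr q) \<partial>\<mu>"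
  have LP: "Lebesgue_points \<Omega> g = Lebesgue_points \<Omega> f" using g(4) by (auto simp: Lebesgue_points_def)
  have X: "?X = (\<integral>\<^sup>+x\<in>Lebesgue_points \<Omega> g. ennreal (\<bar>precise_representative g x - mean_on \<Omega> g\<bar> powr q) \<partial>\<mu>)"
    unfolding LP g(2)
  proof (rule nn_integral_cong)
    fix x
    have "precise_representative g x = precise_representative f x" if "x \<in> Lebesgue_points \<Omega> f"
      using that g(4) by (auto simp: precise_representative_def Lebesgue_points_def)
    then show "ennreal (\<bar>precise_representative f x - mean_on \<Omega> f\<bar> powr q) * indicator (Lebesgue_points \<Omega> f) x =
      ennreal (\<bar>precise_representative g x - mean_on \<Omega> f\<bar> powr q) * indicator (Lebesgue_points \<Omega> f) x"
      by (auto split: split_indicator)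
  qed
  show "ennreal_powr ?X (1 / q) \<le> ennreal ?C * total_variation \<Omega> f"
  proof (cases "total_variation \<Omega> f = \<infinity>")
    case True then show ?thesis by (simp add: ennreal_mult_top)
  next
    case False
    then obtain T where T: "total_variation \<Omega> g = ennreal T" "0 \<le> T"
      unfolding g(3) by (cases "total_variation \<Omega> f") auto
    have "?X \<le> ennreal ((trace_constant n s C\<^sub>\<mu> C\<^sub>J D * T) powr q)"
      unfolding X using trace_inequality[OF J g(1) T q1 q2 \<mu> assms(5) growth] unfolding dim D .
    then obtain y where y: "?X = ennreal y" "0 \<le> y" "y \<le> (trace_constant n s C\<^sub>\<mu> C\<^sub>J D * T) powr q"
      by (cases ?X) (auto simp: top_unique)
    have tc: "0 \<le> trace_constant n s C\<^sub>\<mu> C\<^sub>J D"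
    proof -
      have "0 \<le> a \<Longrightarrow> 0 \<le> b \<Longrightarrow> 0 \<le> 2 * (a + b)" for a b :: real by simp
      then show ?thesis unfolding trace_constant_def Let_def using assms(5,6)
        by (intro mult_nonneg_nonneg add_nonneg_nonneg divide_nonneg_nonneg zero_le_power) auto
    qed
    have "y powr (1/q) \<le> ((trace_constant n s C\<^sub>\<mu> C\<^sub>J D * T) powr q) powr (1/q)"
      using y q1 by (intro powr_mono2) auto
    also have "\<dots> = trace_constant n s C\<^sub>\<mu> C\<^sub>J D * T" using q1 tc T(2) by (simp add: powr_powr)
    also have "\<dots> \<le> ?C * T" using T(2) by (intro mult_right_mono) auto
    finally have "ennreal (y powr (1/q)) \<le> ennreal (?C * T)" by (rule ennreal_leI)
    also have "\<dots> = ennreal ?C * total_variation \<Omega> f"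
      using T by (simp add: g(3) ennreal_mult)
    finally show ?thesis using y by (simp add: ennreal_powr_def)
  qed
qed

end
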